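(* Let $W$ be a Riemann surface, let $\pi:W\to\mathbb{C}$ be a holomorphic map which is locally biholomorphic, and endow $W$ with the metric that is the pullback under $\pi$ of the Euclidean metric of $\mathbb{C}$. Let $U''\subset U'\subset U\subset W$ be path connected open sets such that $\bar U$ is compact and simply connected, and let $\Gamma\subset U''$ be a piecewise smooth curve. Let $f:\bar U\to\mathbb{C}$ be a holomorphic function with no zeros on $\Gamma$. Let $D,\varepsilon>0$ be real numbers with $\frac{D}{\varepsilon}>3$ such that (gap condition) $\pi\text{-gap}(\Gamma,\partial U'')\ge\varepsilon$, $\pi\text{-gap}(U'',\partial U')\ge\varepsilon$, $\pi\text{-gap}(U',\partial U)\ge\varepsilon$; (diameter condition) $\operatorname{diam}_{int}U''\le D$, $\operatorname{diam}_{int}U'\le D$. Then $$V_\Gamma(f)\le B_{U'',U}(f)\left(\frac{|\Gamma|}{\varepsilon}+\kappa(\Gamma)+1\right)e^{\frac{5D}{\varepsilon}}.$$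
   Context: $\pi$-gap: for a connected domain $U\subset W$ and $p\in U$, let $\varepsilon(p,\partial U)$ be the supremum of the radii of disks centered at $p$, located in $U$, on which $\pi$ is bijective (i.e. the supremum of $r>0$ such that there is a set in $U$ containing $p$ that $\pi$ maps bijectively onto the disk of radius $r$ in $\mathbb{C}$ centered at $\pi(p)$). For $K\subset U$, $\pi\text{-gap}(K,\partial U)=\min_{p\in K}\varepsilon(p,\partial U)$ (infimum if $K$ is not compact). Intrinsic diameter: the intrinsic distance between two points of a path connected set $K$ in a metric space is the infimum of the lengths of paths in $K$ connecting these points (if it exists); $\operatorname{diam}_{int}K$ is the supremum of the intrinsic distances between pairs of points of $K$. Bernstein index: $B_{K,U}(f)=\log\frac{M}{m}$ with $M=\sup_U|f|$ and $m=\max_K|f|$; when $K$ is replaced by an open set such as $U''$, $m=\sup_{U''}|f|=\max_{\bar U''}|f|$. Variation of argument: for a curve $\Gamma:[0,1]\to U$ and a function $f$ with $f|_\Gamma\neq0$, choose a continuous branch of $\arg f$ along $\Gamma$ and let $\phi=\arg f\circ\Gamma$; $V_\Gamma(f)$ is the total variation of $\phi$ on $[0,1]$. $|\Gamma|$ is the length of $\Gamma$ and $\kappa(\Gamma)$ is its total (absolute) curvature with respect to the pullback metric, i.e. the integral of the absolute value of the curvature with respect to arc length over the smooth pieces plus the contribution (absolute values of the turning angles) of the vertices. *)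

theory Defs
  imports "HOL-Complex_Analysis.Complex_Analysis"
begin

section \<open>Riemann surfaces and holomorphic maps\<close>

text \<open>
  The Riemann surface is a whole type of class \<open>t2_space\<close> together with a complex atlas. A chart is
  a pair of its domain and a map, which is only meaningful on that domain.
\<close>

definition complex_chart :: "'w::t2_space set \<times> ('w \<Rightarrow> complex) \<Rightarrow> bool" where
  "complex_chart c \<longleftrightarrow>
     (case c of (V, \<phi>) \<Rightarrow> open V \<and> open (\<phi> ` V) \<and> (\<exists>\<psi>. homeomorphism V (\<phi> ` V) \<phi> \<psi>))"

definition riemann_surface :: "('w::t2_space set \<times> ('w \<Rightarrow> complex)) set \<Rightarrow> bool" where
  "riemann_surface \<A> \<longleftrightarrow>
     connected (UNIV :: 'w set) \<and>
     (\<forall>c\<in>\<A>. complex_chart c) \<and>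
     (\<Union>(V, \<phi>)\<in>\<A>. V) = UNIV \<and>
     (\<forall>(V, \<phi>)\<in>\<A>. \<forall>(V', \<phi>')\<in>\<A>. (\<phi>' \<circ> inv_into V \<phi>) holomorphic_on \<phi> ` (V \<inter> V'))"

text \<open>Holomorphy of a complex function on an open subset of the surface.\<close>

definition rs_holomorphic_on ::
  "('w::t2_space set \<times> ('w \<Rightarrow> complex)) set \<Rightarrow> ('w \<Rightarrow> complex) \<Rightarrow> 'w set \<Rightarrow> bool" where
  "rs_holomorphic_on \<A> f S \<longleftrightarrow>
     (\<forall>(V, \<phi>)\<in>\<A>. (f \<circ> inv_into V \<phi>) holomorphic_on \<phi> ` (S \<inter> V))"

definition locally_biholomorphic ::
  "('w::t2_space set \<times> ('w \<Rightarrow> complex)) set \<Rightarrow> ('w \<Rightarrow> complex) \<Rightarrow> bool" where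
  "locally_biholomorphic \<A> \<pi> \<longleftrightarrow>
     (\<forall>p. \<exists>N. open N \<and> p \<in> N \<and> inj_on \<pi> N \<and> open (\<pi> ` N) \<and> rs_holomorphic_on \<A> \<pi> N \<and>
        (\<forall>(V, \<phi>)\<in>\<A>. (\<phi> \<circ> inv_into N \<pi>) holomorphic_on \<pi> ` (N \<inter> V)))"


section \<open>Length, intrinsic diameter and gap\<close>

text \<open>Total variation over \<open>[0,1]\<close>.\<close>

definition total_variation :: "(real \<Rightarrow> 'a::metric_space) \<Rightarrow> ereal" where
  "total_variation g =
     (SUP (n, t) \<in> {(n :: nat, t :: nat \<Rightarrow> real). mono t \<and> range t \<subseteq> {0..1}}.
        ereal (\<Sum>i<n. dist (g (t i)) (g (t (Suc i)))))"

text \<open>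
  The surface carries the pullback under \<open>\<pi>\<close> of the Euclidean metric, so \<open>\<pi>\<close> is a local isometry and
  the length of a path is the Euclidean length of its projection.
\<close>

definition curve_length :: "('w::topological_space \<Rightarrow> complex) \<Rightarrow> (real \<Rightarrow> 'w) \<Rightarrow> ereal" where
  "curve_length \<pi> \<gamma> = total_variation (\<pi> \<circ> \<gamma>)"

definition intrinsic_dist ::
  "('w::topological_space \<Rightarrow> complex) \<Rightarrow> 'w set \<Rightarrow> 'w \<Rightarrow> 'w \<Rightarrow> ereal" where
  "intrinsic_dist \<pi> K p q =
     (INF \<gamma> \<in> {\<gamma>. path \<gamma> \<and> path_image \<gamma> \<subseteq> K \<and> pathstart \<gamma> = p \<and> pathfinish \<gamma> = q}.
        curve_length \<pi> \<gamma>)"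

definition intrinsic_diam :: "('w::topological_space \<Rightarrow> complex) \<Rightarrow> 'w set \<Rightarrow> ereal" where
  "intrinsic_diam \<pi> K = (SUP p\<in>K. SUP q\<in>K. intrinsic_dist \<pi> K p q)"

text \<open>
  \<open>gap_at \<pi> p U\<close> is the supremum of the radii of discs in \<open>U\<close> centred at \<open>p\<close> on which \<open>\<pi>\<close> is
  bijective. Openness of the preimage is what makes it a disc in the surface: for a local
  homeomorphism \<open>\<pi>\<close> the bijection is then a homeomorphism (and an isometry), whereas without openness
  one could glue together points lying on different sheets.
\<close>

definition gap_at :: "('w::topological_space \<Rightarrow> complex) \<Rightarrow> 'w \<Rightarrow> 'w set \<Rightarrow> ereal" where
  "gap_at \<pi> p U =
     (SUP r \<in> {r. r > 0 \<and> (\<exists>\<Delta>. open \<Delta> \<and> p \<in> \<Delta> \<and> \<Delta> \<subseteq> U \<and> bij_betw \<pi> \<Delta> (ball (\<pi> p) r))}. ereal r)"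

definition pi_gap :: "('w::topological_space \<Rightarrow> complex) \<Rightarrow> 'w set \<Rightarrow> 'w set \<Rightarrow> ereal" where
  "pi_gap \<pi> K U = (INF p\<in>K. gap_at \<pi> p U)"


section \<open>Piecewise smooth curves and total curvature\<close>

text \<open>
  Regular pieces of class \<open>C\<^sup>2\<close>, the least smoothness for which the curvature is defined and
  continuous; derivatives at the end points are one-sided.
\<close>

definition smooth_arc_on :: "real \<Rightarrow> real \<Rightarrow> (real \<Rightarrow> complex) \<Rightarrow> bool" where
  "smooth_arc_on a b g \<longleftrightarrow>
     (\<exists>g' g''. (\<forall>t\<in>{a..b}. (g has_vector_derivative g' t) (at t within {a..b}) \<and>
                           (g' has_vector_derivative g'' t) (at t within {a..b}) \<and>
                           g' t \<noteq> 0) \<and>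
               continuous_on {a..b} g'')"

definition piecewise_smooth :: "(real \<Rightarrow> complex) \<Rightarrow> bool" where
  "piecewise_smooth g \<longleftrightarrow>
     (\<exists>(n::nat) t. t 0 = 0 \<and> t n = 1 \<and>
        (\<forall>i<n. t i < t (Suc i) \<and> smooth_arc_on (t i) (t (Suc i)) g))"

text \<open>Curves in the surface are smooth if they are so in the local coordinate \<open>\<pi>\<close>.\<close>

definition piecewise_smooth_curve ::
  "('w::topological_space \<Rightarrow> complex) \<Rightarrow> (real \<Rightarrow> 'w) \<Rightarrow> bool" where
  "piecewise_smooth_curve \<pi> \<gamma> \<longleftrightarrow> path \<gamma> \<and> piecewise_smooth (\<pi> \<circ> \<gamma>)"

definition signed_curvature :: "(real \<Rightarrow> complex) \<Rightarrow> real \<Rightarrow> real" where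
  "signed_curvature g t =
     (let v = (\<lambda>s. vector_derivative g (at s)); a = vector_derivative v (at t)
      in Im (cnj (v t) * a) / cmod (v t) ^ 3)"

definition turning_angle :: "(real \<Rightarrow> complex) \<Rightarrow> real \<Rightarrow> real" where
  "turning_angle g t =
     Arg (vector_derivative g (at_right t) / vector_derivative g (at_left t))"

text \<open>
  For a piecewise smooth curve the integrand is undefined only at finitely many parameters, and only
  finitely many turning angles, all of them at vertices, are nonzero. The curve is parametrised by
  \<open>[0,1]\<close>, so that its end points are not vertices.
\<close>

definition plane_total_curvature :: "(real \<Rightarrow> complex) \<Rightarrow> real" where
  "plane_total_curvature g =
     integral {0..1} (\<lambda>t. \<bar>signed_curvature g t\<bar> * cmod (vector_derivative g (at t))) +
     (\<Sum>t\<in>{t\<in>{0<..<1}. turning_angle g t \<noteq> 0}. \<bar>turning_angle g t\<bar>)"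

text \<open>Curvature for the pullback metric, \<open>\<pi>\<close> being a local isometry.\<close>

definition total_curvature :: "('w::topological_space \<Rightarrow> complex) \<Rightarrow> (real \<Rightarrow> 'w) \<Rightarrow> real" where
  "total_curvature \<pi> \<gamma> = plane_total_curvature (\<pi> \<circ> \<gamma>)"


section \<open>Bernstein index and variation of argument\<close>

definition bernstein_index :: "('w \<Rightarrow> complex) \<Rightarrow> 'w set \<Rightarrow> 'w set \<Rightarrow> real" where
  "bernstein_index f K U = ln ((SUP z\<in>U. cmod (f z)) / (SUP z\<in>K. cmod (f z)))"

definition arg_branch :: "('w \<Rightarrow> complex) \<Rightarrow> (real \<Rightarrow> 'w) \<Rightarrow> (real \<Rightarrow> real) \<Rightarrow> bool" where
  "arg_branch f \<gamma> \<phi> \<longleftrightarrow> continuous_on {0..1} \<phi> \<and> (\<forall>t\<in>{0..1}. is_Arg (f (\<gamma> t)) (\<phi> t))"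

text \<open>
  When \<open>f \<circ> \<gamma>\<close> is continuous without zeros on \<open>[0,1]\<close>, a branch exists and is unique up to an additive
  constant, so the choice is immaterial.
\<close>

definition arg_variation :: "('w \<Rightarrow> complex) \<Rightarrow> (real \<Rightarrow> 'w) \<Rightarrow> ereal" where
  "arg_variation f \<gamma> = total_variation (SOME \<phi>. arg_branch f \<gamma> \<phi>)"

end

theory Submission
  imports Defs
begin

text \<open>
  The proof is local. The surface enters only through sheets: open sets that \<open>\<pi>\<close> maps bijectively
  onto a disc. The gap condition provides a sheet of any radius \<open>r < \<epsilon>\<close> about every point of
  \<open>U''\<close>, and in it \<open>f\<close> is a holomorphic function on a plane disc, bounded by \<open>M = sup \<bar>f\<bar>\<close>.

  Suppose that \<open>\<bar>f\<bar> \<ge> M exp (- A)\<close> at some point of the disc of radius \<open>r/4\<close> about a point of \<open>\<Gamma>\<close>.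
  Dividing by a Blaschke product shows that \<open>f\<close> has at most \<open>3 A\<close> zeros \<open>a\<^sub>i\<close> in the disc of
  radius \<open>r/2\<close>, and Harnack's inequality for the logarithm of the zero-free quotient gives
  \<open>f = (\<Prod>i. z - a\<^sub>i) exp L\<close> with \<open>\<bar>L'\<bar> \<le> 49 A / r\<close> on the disc of radius \<open>r/5\<close>
  (\<open>disc_factorization\<close>). Along an arc of \<open>\<Gamma>\<close> in that small disc the argument of \<open>exp L\<close> varies by
  at most \<open>49 A / r\<close> times the length. The argument of \<open>z - a\<close> varies by at most the total
  curvature of the arc plus \<open>pi\<close>, which is what a straight line seen from \<open>a\<close> takes up
  (\<open>bounds_argument_piecewise_smooth\<close>). As \<open>\<Gamma>\<close> consists of at most \<open>5 \<bar>\<Gamma>\<bar> / r + 1\<close> such arcs, the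
  variation of the argument of \<open>f\<close> along \<open>\<Gamma>\<close> is at most \<open>98 A (\<bar>\<Gamma>\<bar> / r + \<kappa> + 1)\<close>
  (\<open>argument_variation_from_arcs\<close>).

  It remains to bound \<open>A\<close> by the Bernstein index \<open>B\<close>. By its definition some point of \<open>U''\<close> has
  \<open>\<bar>f\<bar>\<close> arbitrarily close to \<open>M exp (- B)\<close>, and it is joined to any point of \<open>\<Gamma>\<close> by a path in
  \<open>U''\<close> of length little more than \<open>D\<close>. By the three circles theorem the bound for \<open>A\<close> at most
  doubles when the centre of the disc moves by \<open>r/4\<close> (\<open>chain_step\<close>), so up to an arbitrarily small
  error in \<open>B\<close> one has \<open>A \<le> 2 powr (4 D / r + 1) B\<close> on \<open>\<Gamma>\<close> (\<open>chain_along_path\<close>). For \<open>r = 19/20 \<epsilon>\<close>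
  the product of all constants is less than \<open>exp (5 D / \<epsilon>)\<close>, because \<open>D / \<epsilon> > 3\<close>
  (\<open>doubling_constant\<close>).
\<close>


section \<open>The projection and its sheets\<close>

text \<open>
  A chart and a neighbourhood on which \<open>\<pi>\<close> is biholomorphic meet in a set on which \<open>\<pi>\<close> itself is a
  chart. This replaces the atlas by the single coordinate \<open>\<pi>\<close>.
\<close>

lemma local_sheet:
  fixes \<A> :: "('w::t2_space set \<times> ('w \<Rightarrow> complex)) set"
  assumes RS: "riemann_surface \<A>" and hol: "rs_holomorphic_on \<A> \<pi> UNIV"
    and LB: "locally_biholomorphic \<A> \<pi>"
  obtains V where "open V" "p \<in> V" "inj_on \<pi> V" "continuous_on V \<pi>"
    "\<forall>X. open X \<and> X \<subseteq> V \<longrightarrow> open (\<pi> ` X)"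
    "\<forall>f S. rs_holomorphic_on \<A> f S \<longrightarrow> (f \<circ> inv_into V \<pi>) holomorphic_on \<pi> ` (S \<inter> V)"
proof -
  obtain N where N: "open N" "p \<in> N" "inj_on \<pi> N" and
    inv: "\<forall>(C, \<phi>)\<in>\<A>. (\<phi> \<circ> inv_into N \<pi>) holomorphic_on \<pi> ` (N \<inter> C)"
    using LB unfolding locally_biholomorphic_def by metis
  have "(\<Union>(V, \<phi>)\<in>\<A>. V) = UNIV" using RS unfolding riemann_surface_def by simp
  then have "p \<in> (\<Union>(V, \<phi>)\<in>\<A>. V)" by simp
  then obtain C \<phi> where C: "(C, \<phi>) \<in> \<A>" "p \<in> C" by auto
  then have "complex_chart (C, \<phi>)" using RS unfolding riemann_surface_def by simp
  then obtain \<psi> where "open C" "open (\<phi> ` C)" and hom: "homeomorphism C (\<phi> ` C) \<phi> \<psi>"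
    unfolding complex_chart_def by auto
  have inj\<phi>: "inj_on \<phi> C" using hom by (metis homeomorphism_def inj_on_inverseI)
  have cont\<phi>: "continuous_on C \<phi>" using hom by (simp add: homeomorphism_def)
  have hol\<pi>: "(\<pi> \<circ> inv_into C \<phi>) holomorphic_on \<phi> ` C"
    using hol C unfolding rs_holomorphic_on_def by auto
  let ?V = "N \<inter> C"
  have eq: "(\<pi> \<circ> inv_into C \<phi>) (\<phi> x) = \<pi> x" if "x \<in> C" for x
    using that inj\<phi> by simp
  show ?thesis
  proof
    show "open ?V" using N \<open>open C\<close> by blast
    show "p \<in> ?V" using N C by blast
    show "inj_on \<pi> ?V" using N by (meson Int_lower1 inj_on_subset)
    have "continuous_on C ((\<pi> \<circ> inv_into C \<phi>) \<circ> \<phi>)"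
      by (rule continuous_on_compose[OF cont\<phi> holomorphic_on_imp_continuous_on[OF hol\<pi>]])
    then have "continuous_on C \<pi>"
      by (rule continuous_on_eq) (use eq in auto)
    then show "continuous_on ?V \<pi>" by (rule continuous_on_subset) auto
  next
    show "\<forall>X. open X \<and> X \<subseteq> ?V \<longrightarrow> open (\<pi> ` X)"
    proof (intro allI impI, elim conjE)
      fix X assume X: "open X" "X \<subseteq> ?V"
      have "openin (top_of_set C) X" using X by (simp add: open_subset)
      then have "openin (top_of_set (\<phi> ` C)) (\<phi> ` X)"
        using homeomorphism_imp_open_map[OF hom] by blast
      then have op: "open (\<phi> ` X)" using \<open>open (\<phi> ` C)\<close> openin_open_trans by blast
      have hX: "(\<pi> \<circ> inv_into C \<phi>) holomorphic_on \<phi> ` X"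
        using X by (intro holomorphic_on_subset[OF hol\<pi>]) auto
      have inj: "inj_on (\<pi> \<circ> inv_into C \<phi>) (\<phi> ` X)"
      proof (rule inj_onI)
        fix a b assume "a \<in> \<phi> ` X" "b \<in> \<phi> ` X"
          and e: "(\<pi> \<circ> inv_into C \<phi>) a = (\<pi> \<circ> inv_into C \<phi>) b"
        then obtain x y where xy: "a = \<phi> x" "x \<in> X" "b = \<phi> y" "y \<in> X" by blast
        then have xyN: "x \<in> N" "x \<in> C" "y \<in> N" "y \<in> C" using X by auto
        then have "\<pi> x = \<pi> y" using e eq[of x] eq[of y] xy by simp
        then show "a = b" using xy(1,3) xyN N(3) by (simp add: inj_on_eq_iff)
    qed
    have "(\<pi> \<circ> inv_into C \<phi>) ` (\<phi> ` X) = \<pi> ` X"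
      using eq X unfolding image_image by (intro image_cong) auto
    then show "open (\<pi> ` X)" using open_mapping_thm3[OF hX op inj] by simp
    qed
  next
    show "\<forall>f S. rs_holomorphic_on \<A> f S \<longrightarrow>
      (f \<circ> inv_into ?V \<pi>) holomorphic_on \<pi> ` (S \<inter> ?V)"
    proof (intro allI impI)
      fix f S assume f: "rs_holomorphic_on \<A> f S"
      have h1: "(f \<circ> inv_into C \<phi>) holomorphic_on \<phi> ` (S \<inter> C)"
        using f C unfolding rs_holomorphic_on_def by auto
      have h2: "(\<phi> \<circ> inv_into N \<pi>) holomorphic_on \<pi> ` (S \<inter> ?V)"
        using inv C(1) by (force intro: holomorphic_on_subset)
      have val: "inv_into N \<pi> (\<pi> x) = x" "inv_into ?V \<pi> (\<pi> x) = x" if "x \<in> ?V" for x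
        using that inv_into_f_f[OF N(3), of x]
          inv_into_f_f[OF inj_on_subset[OF N(3) Int_lower1], of x C] by auto
      have "(\<phi> \<circ> inv_into N \<pi>) ` (\<pi> ` (S \<inter> ?V)) \<subseteq> \<phi> ` (S \<inter> C)"
        using val by auto
      then have "((f \<circ> inv_into C \<phi>) \<circ> (\<phi> \<circ> inv_into N \<pi>)) holomorphic_on \<pi> ` (S \<inter> ?V)"
        using holomorphic_on_compose_gen[OF h2 h1] by simp
      then show "(f \<circ> inv_into ?V \<pi>) holomorphic_on \<pi> ` (S \<inter> ?V)"
        by (rule holomorphic_transform) (use val inj\<phi> in auto)
    qed
  qed
qed

lemma projection_continuous:
  fixes \<A> :: "('w::t2_space set \<times> ('w \<Rightarrow> complex)) set"
  assumes RS: "riemann_surface \<A>" and hol: "rs_holomorphic_on \<A> \<pi> UNIV"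
    and LB: "locally_biholomorphic \<A> \<pi>"
  shows "continuous_on UNIV \<pi>"
proof -
  have "isCont \<pi> p" for p
  proof -
    obtain V where V: "open V" "p \<in> V" "inj_on \<pi> V" "continuous_on V \<pi>"
      "\<forall>X. open X \<and> X \<subseteq> V \<longrightarrow> open (\<pi> ` X)"
      "\<forall>f S. rs_holomorphic_on \<A> f S \<longrightarrow> (f \<circ> inv_into V \<pi>) holomorphic_on \<pi> ` (S \<inter> V)"
      by (rule local_sheet[OF RS hol LB])
    show ?thesis using continuous_on_eq_continuous_at[OF V(1), of \<pi>] V(2,4) by blast
  qed
  then show ?thesis by (simp add: continuous_at_imp_continuous_on)
qed

lemma projection_open_map:
  fixes \<A> :: "('w::t2_space set \<times> ('w \<Rightarrow> complex)) set"
  assumes RS: "riemann_surface \<A>" and hol: "rs_holomorphic_on \<A> \<pi> UNIV"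
    and LB: "locally_biholomorphic \<A> \<pi>" and "open X"
  shows "open (\<pi> ` X)"
proof (subst open_subopen, intro ballI)
  fix z assume "z \<in> \<pi> ` X"
  then obtain p where p: "p \<in> X" "z = \<pi> p" by blast
  obtain V where V: "open V" "p \<in> V" "inj_on \<pi> V" "continuous_on V \<pi>"
      "\<forall>X. open X \<and> X \<subseteq> V \<longrightarrow> open (\<pi> ` X)"
      "\<forall>f S. rs_holomorphic_on \<A> f S \<longrightarrow> (f \<circ> inv_into V \<pi>) holomorphic_on \<pi> ` (S \<inter> V)"
      by (rule local_sheet[OF RS hol LB])
  have "open (\<pi> ` (X \<inter> V))" using V(5) V(1) \<open>open X\<close> by auto
  then show "\<exists>T. open T \<and> z \<in> T \<and> T \<subseteq> \<pi> ` X"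
    using p V by (intro exI[of _ "\<pi> ` (X \<inter> V)"]) auto
qed

lemma sheet_section_continuous:
  fixes \<pi> :: "'w::t2_space \<Rightarrow> complex"
  assumes op: "\<And>X. open X \<Longrightarrow> open (\<pi> ` X)" and "open \<Delta>" "inj_on \<pi> \<Delta>"
  shows "continuous_on (\<pi> ` \<Delta>) (inv_into \<Delta> \<pi>)"
proof (subst continuous_on_open_vimage)
  show "open (\<pi> ` \<Delta>)" using assms by blast
  show "\<forall>B. open B \<longrightarrow> open (inv_into \<Delta> \<pi> -` B \<inter> \<pi> ` \<Delta>)"
  proof (intro allI impI)
    fix B :: "'w set" assume "open B"
    have "inv_into \<Delta> \<pi> -` B \<inter> \<pi> ` \<Delta> = \<pi> ` (B \<inter> \<Delta>)"
      using \<open>inj_on \<pi> \<Delta>\<close> by auto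
    then show "open (inv_into \<Delta> \<pi> -` B \<inter> \<pi> ` \<Delta>)"
      using op \<open>open B\<close> \<open>open \<Delta>\<close> by (simp add: open_Int)
  qed
qed

lemma holomorphic_on_sheet:
  fixes \<A> :: "('w::t2_space set \<times> ('w \<Rightarrow> complex)) set"
  assumes RS: "riemann_surface \<A>" and hol: "rs_holomorphic_on \<A> \<pi> UNIV"
    and LB: "locally_biholomorphic \<A> \<pi>"
    and \<Delta>: "open \<Delta>" "inj_on \<pi> \<Delta>" "\<Delta> \<subseteq> S" and f: "rs_holomorphic_on \<A> f S"
  shows "(f \<circ> inv_into \<Delta> \<pi>) holomorphic_on \<pi> ` \<Delta>"
proof -
  have "(f \<circ> inv_into \<Delta> \<pi>) field_differentiable (at z)" if "z \<in> \<pi> ` \<Delta>" for z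
  proof -
    obtain p where p: "p \<in> \<Delta>" "z = \<pi> p" using \<open>z \<in> \<pi> ` \<Delta>\<close> by blast
    obtain V where V: "open V" "p \<in> V" "inj_on \<pi> V" "continuous_on V \<pi>"
      "\<forall>X. open X \<and> X \<subseteq> V \<longrightarrow> open (\<pi> ` X)"
      "\<forall>f S. rs_holomorphic_on \<A> f S \<longrightarrow> (f \<circ> inv_into V \<pi>) holomorphic_on \<pi> ` (S \<inter> V)"
      by (rule local_sheet[OF RS hol LB])
    let ?X = "\<Delta> \<inter> V"
    have op: "open (\<pi> ` ?X)" using V(5) V(1) \<Delta>(1) by auto
    have "(f \<circ> inv_into V \<pi>) holomorphic_on \<pi> ` ?X"
      using V(6)[rule_format, OF f] by (rule holomorphic_on_subset) (use \<Delta>(3) in auto)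
    then have "(f \<circ> inv_into \<Delta> \<pi>) holomorphic_on \<pi> ` ?X"
      by (rule holomorphic_transform) (use \<Delta>(2) V(3) in auto)
    moreover have "z \<in> \<pi> ` ?X" using p V by auto
    ultimately show ?thesis using op holomorphic_on_imp_differentiable_at by blast
  qed
  then show ?thesis unfolding holomorphic_on_def using field_differentiable_at_within by blast
qed

text \<open>
  Uniqueness of lifts. A point of \<open>C\<close> outside \<open>\<Delta>\<close> has the same projection as some other point of
  \<open>\<Delta>\<close>; separating the two by the Hausdorff property shows that \<open>C \<inter> \<Delta>\<close> is closed in \<open>C\<close> as well as
  open, and \<open>C\<close> is connected.
\<close>

lemma connected_subset_sheet:
  fixes \<pi> :: "'w::t2_space \<Rightarrow> complex"
  assumes cont: "continuous_on UNIV \<pi>" and op: "\<And>X. open X \<Longrightarrow> open (\<pi> ` X)"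
    and \<Delta>: "open \<Delta>" and C: "connected C" "\<pi> ` C \<subseteq> \<pi> ` \<Delta>" "p \<in> C" "p \<in> \<Delta>" "inj_on \<pi> \<Delta>"
  shows "C \<subseteq> \<Delta>"
proof (rule ccontr)
  assume "\<not> C \<subseteq> \<Delta>"
  have far: "\<exists>T. open T \<and> y \<in> T \<and> T \<inter> \<Delta> = {}" if y: "y \<in> C - \<Delta>" for y
  proof -
    obtain x where x: "x \<in> \<Delta>" "\<pi> x = \<pi> y" using y C(2) by (metis DiffD1 image_iff subset_iff)
    then have "x \<noteq> y" using y by blast
    then obtain A B where AB: "open A" "open B" "y \<in> A" "x \<in> B" "A \<inter> B = {}"
      using hausdorff[of y x] by metis
    let ?T = "A \<inter> \<pi> -` (\<pi> ` (B \<inter> \<Delta>))"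
    have "open ?T"
      using AB \<Delta> op[OF open_Int[OF AB(2) \<Delta>]] cont by (intro open_Int open_vimage) auto
    moreover have "y \<in> ?T" using AB x by (metis IntI image_eqI vimageI)
    moreover have "?T \<inter> \<Delta> = {}"
      using AB C(5) by (auto simp: inj_on_def)
    ultimately show ?thesis by blast
  qed
  define Y where "Y = \<Union>{T. open T \<and> T \<inter> \<Delta> = {}}"
  have "open Y" "Y \<inter> \<Delta> = {}" unfolding Y_def by auto
  moreover have "C \<subseteq> \<Delta> \<union> Y"
    using far unfolding Y_def by fast
  moreover have "Y \<inter> C \<noteq> {}" using \<open>\<not> C \<subseteq> \<Delta>\<close> far unfolding Y_def by fast
  ultimately show False
    using connectedD[OF C(1) \<Delta>, of Y] C by blast
qed


section \<open>Harnack's inequality and the three circles theorem\<close>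

text \<open>
  Schwarz's lemma for the Cayley transform \<open>(p - p c) / (p + cnj (p c))\<close>, which maps the disc to
  the unit disc and the centre to \<open>0\<close>. The first claim is Harnack's inequality for the positive
  harmonic function \<open>Re p\<close>, solved for neither value so that it bounds each of them by the other.
\<close>

lemma harnack_at_center:
  fixes p :: "complex \<Rightarrow> complex"
  assumes hol: "p holomorphic_on ball c R" and R: "R > 0"
    and pos: "\<And>z. z \<in> ball c R \<Longrightarrow> Re (p z) > 0"
  shows "z \<in> ball c R \<Longrightarrow> \<bar>Re (p z) - Re (p c)\<bar> \<le> dist c z / R * (Re (p z) + Re (p c))"
    and "cmod (deriv p c) \<le> 2 * Re (p c) / R"
proof -
  define P where "P = (\<lambda>w. p (c + of_real R * w))"
  define S where "S = (\<lambda>w. (P w - p c) / (P w + cnj (p c)))"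
  have in_ball: "c + of_real R * w \<in> ball c R" if "w \<in> ball 0 1" for w
    using that R by (simp add: dist_norm norm_mult)
  have holP: "P holomorphic_on ball 0 1"
    unfolding P_def by (rule holomorphic_on_compose_gen[OF _ hol, unfolded o_def])
      (use in_ball in \<open>auto intro!: holomorphic_intros\<close>)
  have posP: "Re (P w) > 0" if "w \<in> ball 0 1" for w
    unfolding P_def using pos in_ball[OF that] by blast
  have pos0: "Re (p c) > 0" using pos R by simp
  have den: "P w + cnj (p c) \<noteq> 0" if "w \<in> ball 0 1" for w
  proof -
    have "Re (P w + cnj (p c)) > 0" using posP[OF that] pos0 by simp
    then show ?thesis by (metis less_irrefl zero_complex.sel(1))
  qed
  have holS: "S holomorphic_on ball 0 1"
    unfolding S_def using holP den by (intro holomorphic_intros) auto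
  have S0: "S 0 = 0" by (simp add: S_def P_def)
  have sq: "(cmod (P w - p c))\<^sup>2 = (Re (P w) - Re (p c))\<^sup>2 + (Im (P w) - Im (p c))\<^sup>2"
    "(cmod (P w + cnj (p c)))\<^sup>2 = (Re (P w) + Re (p c))\<^sup>2 + (Im (P w) - Im (p c))\<^sup>2" for w
    by (simp_all add: cmod_power2)
  have S1: "cmod (S w) < 1" if w: "cmod w < 1" for w
  proof -
    have "(cmod (P w - p c))\<^sup>2 < (cmod (P w + cnj (p c)))\<^sup>2"
      unfolding sq using mult_pos_pos[OF posP[of w] pos0] w
      by (simp add: power2_eq_square algebra_simps)
    then have "cmod (P w - p c) < cmod (P w + cnj (p c))"
      by (rule power2_less_imp_less) simp
    then show ?thesis unfolding S_def
      by (simp add: norm_divide divide_less_eq_1) 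
  qed
  show "\<bar>Re (p z) - Re (p c)\<bar> \<le> dist c z / R * (Re (p z) + Re (p c))" if z: "z \<in> ball c R"
  proof -
    define w where "w = (z - c) / of_real R"
    have w: "cmod w = dist c z / R" "cmod w < 1" "P w = p z"
      using z R by (simp_all add: w_def P_def norm_divide dist_norm norm_minus_commute)
    have "cmod (S w) \<le> cmod w" using Schwarz_Lemma(1)[OF holS S0 S1 w(2)] .
    then have "cmod (P w - p c) \<le> cmod w * cmod (P w + cnj (p c))"
      using den[of w] w(2) unfolding S_def by (simp add: norm_divide divide_le_eq)
    then have "(cmod (P w - p c))\<^sup>2 \<le> (cmod w)\<^sup>2 * (cmod (P w + cnj (p c)))\<^sup>2"
      by (metis norm_ge_zero power_mono power_mult_distrib)
    then have "(Re (P w) - Re (p c))\<^sup>2 + (Im (P w) - Im (p c))\<^sup>2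
        \<le> (cmod w)\<^sup>2 * (Re (P w) + Re (p c))\<^sup>2 + (cmod w)\<^sup>2 * (Im (P w) - Im (p c))\<^sup>2"
      unfolding sq by (simp add: algebra_simps)
    moreover have "(cmod w)\<^sup>2 * (Im (P w) - Im (p c))\<^sup>2 \<le> 1 * (Im (P w) - Im (p c))\<^sup>2"
      using w(2) by (intro mult_right_mono) (auto simp: power_le_one)
    ultimately have "(Re (P w) - Re (p c))\<^sup>2 \<le> (cmod w * (Re (P w) + Re (p c)))\<^sup>2"
      by (simp add: power_mult_distrib)
    then have "\<bar>Re (P w) - Re (p c)\<bar> \<le> cmod w * (Re (P w) + Re (p c))"
      by (rule abs_le_square_iff[THEN iffD2, THEN order_trans])
        (use posP[of w] pos0 w(2) in auto)
    then show ?thesis using w by simp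
  qed
  show "cmod (deriv p c) \<le> 2 * Re (p c) / R"
  proof -
    have "(p has_field_derivative deriv p c) (at (c + of_real R * 0))"
      using holomorphic_derivI[OF hol] R by simp
    then have "(P has_field_derivative (deriv p c * of_real R)) (at 0)"
      unfolding P_def by (rule DERIV_chain2) (auto intro!: derivative_eq_intros)
    then have dP: "(P has_field_derivative (of_real R * deriv p c)) (at 0)"
      by (simp add: mult.commute)
    have P0: "P 0 = p c" by (simp add: P_def)
    have twoRe: "p c + cnj (p c) = of_real (2 * Re (p c))"
      by (simp add: complex_eq_iff)
    have nz: "p c + cnj (p c) \<noteq> 0" using den[of 0] P0 by simp
    have "(S has_field_derivative (of_real R * deriv p c) / (p c + cnj (p c))) (at 0)"
    proof -
      have "((\<lambda>w. P w - p c) has_field_derivative of_real R * deriv p c) (at 0)"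
        "((\<lambda>w. P w + cnj (p c)) has_field_derivative of_real R * deriv p c) (at 0)"
        by (auto intro!: derivative_eq_intros dP)
      from DERIV_divide[OF this] show ?thesis
        unfolding S_def using nz by (simp add: P0)
    qed
    then have "deriv S 0 = (of_real R * deriv p c) / (p c + cnj (p c))"
      by (rule DERIV_imp_deriv)
    moreover have "cmod (deriv S 0) \<le> 1" using Schwarz_Lemma(2)[OF holS S0 S1, of 0] by simp
    ultimately have "R * cmod (deriv p c) / (2 * Re (p c)) \<le> 1"
      using R pos0 unfolding twoRe by (simp add: norm_divide norm_mult)
    then show ?thesis using pos0 R by (simp add: field_simps)
  qed
qed

text \<open>
  Hadamard's three circles theorem for the radii \<open>r/4\<close>, \<open>r/2\<close>, \<open>r\<close>. With \<open>\<zeta> = z - c\<close> the function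
  \<open>w \<mapsto> F (c + w) * F (c + \<zeta>\<^sup>2 / w)\<close> takes the value \<open>(F z)\<^sup>2\<close> at \<open>w = \<zeta>\<close>. The reflection
  \<open>w \<mapsto> \<zeta>\<^sup>2 / w\<close> exchanges the circle of radius \<open>r\<close> with the one of radius \<open>\<bar>\<zeta>\<bar>\<^sup>2 / r \<le> r/4\<close>, so on
  both boundary circles of the annulus between them one factor is at most \<open>M\<close> and the other at
  most \<open>\<mu>\<close>.
\<close>

lemma three_circles:
  fixes F :: "complex \<Rightarrow> complex"
  assumes hol: "F holomorphic_on S" and S: "open S" "cball c r \<subseteq> S"
    and M: "\<And>z. z \<in> cball c r \<Longrightarrow> cmod (F z) \<le> M"
    and \<mu>: "\<And>z. z \<in> cball c (r/4) \<Longrightarrow> cmod (F z) \<le> \<mu>"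
    and z: "z \<in> cball c (r/2)" and r: "r > 0"
  shows "(cmod (F z))\<^sup>2 \<le> M * \<mu>"
proof (cases "z \<in> cball c (r/4)")
  case True
  then have "cmod (F z) \<le> M" "cmod (F z) \<le> \<mu>" using M \<mu> r by auto
  then show ?thesis unfolding power2_eq_square
    by (intro mult_mono) (use norm_ge_zero order_trans in blast)+
next
  case False
  define \<zeta> where "\<zeta> = z - c"
  have \<zeta>: "cmod \<zeta> > r/4" "cmod \<zeta> \<le> r/2"
    using False z by (auto simp: \<zeta>_def dist_norm norm_minus_commute)
  \<comment> \<open>the inner radius, the reflection of \<open>r\<close> in the circle through \<open>\<zeta>\<close>\<close>
  define s where "s = (cmod \<zeta>)\<^sup>2 / r"
  have "(cmod \<zeta>)\<^sup>2 \<le> (r/2)\<^sup>2" using \<zeta> by (intro power_mono) auto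
  moreover have \<zeta>0: "cmod \<zeta> > 0" using \<zeta>(1) r by linarith
  ultimately have s: "0 < s" "s \<le> r/4"
    using r unfolding s_def power2_eq_square by (auto simp: field_simps)
  have s_le: "s < cmod \<zeta>"
  proof -
    have "cmod \<zeta> * cmod \<zeta> < cmod \<zeta> * r"
      using r \<zeta>(2) \<zeta>0 by (intro mult_strict_left_mono) linarith+
    then show ?thesis using r by (simp add: s_def power2_eq_square pos_divide_less_eq)
  qed
  let ?A = "cball 0 r - ball (0::complex) s"
  define G where "G = (\<lambda>w. F (c + w) * F (c + \<zeta>\<^sup>2 / w))"
  have A: "w \<noteq> 0" "c + w \<in> cball c r" "c + \<zeta>\<^sup>2 / w \<in> cball c r" if "w \<in> ?A" for w
  proof -
    have w: "s \<le> cmod w" "cmod w \<le> r" using that by auto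
    then show "w \<noteq> 0" using s by auto
    show "c + w \<in> cball c r" using w by (simp add: dist_norm)
    have "(cmod \<zeta>)\<^sup>2 / cmod w \<le> (cmod \<zeta>)\<^sup>2 / s"
      using w s by (intro divide_left_mono mult_pos_pos) auto
    also have "\<dots> = r" using r \<zeta>0 by (auto simp: s_def)
    finally show "c + \<zeta>\<^sup>2 / w \<in> cball c r"
      by (simp add: dist_norm norm_divide norm_power)
  qed
  have "(\<lambda>w. F (c + w)) holomorphic_on ?A"
    by (rule holomorphic_on_compose_gen[OF _ hol, unfolded o_def])
      (use A S s(1) in \<open>auto intro!: holomorphic_intros\<close>)
  moreover have "(\<lambda>w. F (c + \<zeta>\<^sup>2 / w)) holomorphic_on ?A"
    by (rule holomorphic_on_compose_gen[OF _ hol, unfolded o_def])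
      (use A S s(1) in \<open>auto intro!: holomorphic_intros\<close>)
  ultimately have holG: "G holomorphic_on ?A"
    unfolding G_def by (rule holomorphic_on_mult)
  have "closed ?A" by (simp add: closed_Diff)
  have "cmod (G \<zeta>) \<le> M * \<mu>"
  proof (rule maximum_modulus_frontier[where f = G and S = ?A])
    show "G holomorphic_on interior ?A"
      using holG interior_subset by (rule holomorphic_on_subset)
    show "continuous_on (closure ?A) G"
      unfolding closure_closed[OF \<open>closed ?A\<close>] using holG by (rule holomorphic_on_imp_continuous_on)
    show "bounded ?A" by (rule bounded_subset[OF bounded_cball]) auto
    show "\<zeta> \<in> ?A" using s_le \<zeta> r by auto
    fix w assume w: "w \<in> frontier ?A"
    have "ball 0 r - cball 0 s \<subseteq> interior ?A"
      by (rule interior_maximal) (auto intro: open_Diff)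
    then have "w \<notin> ball 0 r - cball 0 s" using w unfolding frontier_def by auto
    moreover have wA: "w \<in> ?A" using w \<open>closed ?A\<close> frontier_subset_closed by blast
    ultimately have "cmod w = r \<or> cmod w = s" by auto
    then show "cmod (G w) \<le> M * \<mu>"
    proof
      assume "cmod w = r"
      then have "c + \<zeta>\<^sup>2 / w \<in> cball c (r/4)"
        using s by (simp add: dist_norm norm_divide norm_power s_def)
      then show ?thesis unfolding G_def norm_mult
        using A(2)[OF wA] M \<mu> by (intro mult_mono) (auto intro: order_trans[OF norm_ge_zero])
    next
      assume "cmod w = s"
      then have "c + w \<in> cball c (r/4)" using s by (simp add: dist_norm)
      then have "cmod (F (c + \<zeta>\<^sup>2 / w)) * cmod (F (c + w)) \<le> M * \<mu>"
        using A(3)[OF wA] M \<mu> by (intro mult_mono) (auto intro: order_trans[OF norm_ge_zero])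
      then show ?thesis unfolding G_def norm_mult by (simp add: mult.commute)
    qed
  qed
  moreover have "G \<zeta> = (F z)\<^sup>2"
    using \<zeta>0 by (auto simp: G_def \<zeta>_def power2_eq_square)
  ultimately show ?thesis by (simp add: norm_power)
qed


section \<open>Factorisation of bounded functions on a disc\<close>

lemma blaschke_denominator_unit:
  assumes "cmod z = 1" shows "cmod (1 - cnj a * z) = cmod (z - a)"
proof -
  have "z * cnj z = 1" using assms by (simp add: complex_norm_square[symmetric])
  then have "1 - cnj a * z = z * cnj (z - a)" by (simp add: algebra_simps)
  then have "cmod (1 - cnj a * z) = cmod z * cmod (cnj (z - a))" by (simp only: norm_mult)
  then show ?thesis using assms by (simp only: complex_mod_cnj mult_1)
qed

text \<open>
  The radii make the pseudohyperbolic distance of \<open>a\<close> and \<open>q\<close> at most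
  \<open>(1/2 + 1/4) / (1 + 1/2 \<cdot> 1/4) = 2/3\<close>. Hence each zero in the disc of radius \<open>1/2\<close> costs a
  bounded function a factor \<open>2/3\<close> at \<open>q\<close>.
\<close>

lemma blaschke_factor_bound:
  assumes a: "cmod a \<le> 1/2" and q: "cmod q \<le> 1/4"
  shows "cmod (q - a) \<le> 2/3 * cmod (1 - cnj a * q)"
proof -
  define t where "t = Re (cnj a * q)"
  define x y where "x = cmod q" and "y = cmod a"
  have xy: "0 \<le> x" "x \<le> 1/4" "0 \<le> y" "y \<le> 1/2" using assms by (auto simp: x_def y_def)
  have t: "- t \<le> x * y"
    using abs_Re_le_cmod[of "cnj a * q"] by (simp add: t_def x_def y_def norm_mult mult.commute)
  have 1: "(cmod (q - a))\<^sup>2 = x\<^sup>2 + y\<^sup>2 - 2 * t"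
    unfolding t_def x_def y_def cmod_power2 by (simp add: power2_eq_square algebra_simps)
  have 2: "(cmod (1 - cnj a * q))\<^sup>2 = 1 + (x * y)\<^sup>2 - 2 * t"
    unfolding t_def x_def y_def power_mult_distrib cmod_power2
    by (simp add: power2_eq_square algebra_simps)
  have "x * (3 - 2 * y) \<le> 1/4 * (3 - 2 * y)" using xy by (intro mult_right_mono) auto
  then have "3 * (x + y) \<le> 2 * (1 + x * y)" using xy by (simp add: algebra_simps)
  then have "(3 * (x + y))\<^sup>2 \<le> (2 * (1 + x * y))\<^sup>2" using xy by (intro power_mono) auto
  then have "9 * (x\<^sup>2 + y\<^sup>2) + 10 * (x * y) \<le> 4 * (1 + (x * y)\<^sup>2)"
    by (simp add: power2_eq_square algebra_simps)
  then have "9 * (cmod (q - a))\<^sup>2 \<le> 4 * (cmod (1 - cnj a * q))\<^sup>2"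
    unfolding 1 2 using t by (simp add: algebra_simps)
  then have "(cmod (q - a))\<^sup>2 \<le> (2/3 * cmod (1 - cnj a * q))\<^sup>2"
    by (simp add: power_mult_distrib power_divide)
  then show ?thesis by (rule power2_le_imp_le) simp
qed

text \<open>
  The factorisations that split off some, not necessarily all, zeros in the disc of radius \<open>1/2\<close>,
  counted with multiplicity. Their number is bounded in advance, so that a factorisation that
  cannot be prolonged exists and all zeros are found without counting them beforehand.
\<close>

definition divides_zeros ::
  "complex set \<Rightarrow> (complex \<Rightarrow> complex) \<Rightarrow> nat \<Rightarrow> (nat \<Rightarrow> complex) \<Rightarrow> (complex \<Rightarrow> complex) \<Rightarrow> bool"
  where "divides_zeros S G n a k \<longleftrightarrow> k holomorphic_on S \<and> (\<forall>i<n. a i \<in> ball 0 (1/2)) \<and>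
     (\<forall>z\<in>S. G z = (\<Prod>i<n. z - a i) * k z)"

text \<open>
  The function \<open>h\<close> is \<open>G\<close> divided by the Blaschke product of the zeros \<open>a i\<close>, written without
  denominators. On the unit circle the Blaschke product has modulus \<open>1\<close>, so the maximum principle
  gives \<open>h\<close> the bound of \<open>G\<close>.
\<close>

lemma blaschke_quotient_bounds:
  assumes div: "divides_zeros S G n a k" and S: "open S" "cball 0 1 \<subseteq> S"
    and hol: "G holomorphic_on S" and G1: "\<forall>z\<in>cball 0 1. cmod (G z) < 1"
    and q: "cmod q \<le> 1/4"
  defines "h \<equiv> \<lambda>z. k z * (\<Prod>i<n. 1 - cnj (a i) * z)"
  shows "z \<in> cball 0 1 \<Longrightarrow> cmod (h z) < 1" and "cmod (G q) \<le> (2/3)^n * cmod (h q)"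
proof -
  have holk: "k holomorphic_on S" and a: "\<And>i. i < n \<Longrightarrow> cmod (a i) < 1/2"
    and G: "\<And>z. z \<in> S \<Longrightarrow> G z = (\<Prod>i<n. z - a i) * k z"
    using div by (auto simp: divides_zeros_def)
  have holh: "h holomorphic_on S" unfolding h_def using holk by (intro holomorphic_intros)
  have "continuous_on (cball 0 1) (\<lambda>z. cmod (G z))"
    using hol S(2) by (intro continuous_intros holomorphic_on_imp_continuous_on)
      (rule holomorphic_on_subset)
  then obtain x where x: "x \<in> cball 0 1" "\<And>z. z \<in> cball 0 1 \<Longrightarrow> cmod (G z) \<le> cmod (G x)"
    using continuous_attains_sup[of "cball (0::complex) 1" "\<lambda>z. cmod (G z)"] by auto
  show "cmod (h z) < 1" if z: "z \<in> cball 0 1"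
  proof -
    have "cmod (h z) \<le> cmod (G x)"
    proof (rule maximum_modulus_frontier[where f = h and S = "cball 0 1"])
      show "h holomorphic_on interior (cball 0 1)"
        using holh S(2) interior_subset by (meson holomorphic_on_subset order_trans)
      show "continuous_on (closure (cball 0 1)) h"
        using holh S(2) by (simp add: holomorphic_on_imp_continuous_on holomorphic_on_subset)
      show "bounded (cball (0::complex) 1)" by simp
      show "z \<in> cball 0 1" by fact
      fix w :: complex assume "w \<in> frontier (cball 0 1)"
      then have w: "cmod w = 1" by simp
      then have "w \<in> S" using S(2) by auto
      have "cmod (h w) = cmod (G w)"
        unfolding h_def G[OF \<open>w \<in> S\<close>] norm_mult prod_norm[symmetric]
        using blaschke_denominator_unit[OF w] by simp
      then show "cmod (h w) \<le> cmod (G x)" using x(2)[of w] w by simp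
    qed
    then show ?thesis using G1 x(1) by fastforce
  qed
  have "q \<in> S" using q S(2) by auto
  have "(\<Prod>i<n. cmod (q - a i)) \<le> (\<Prod>i<n. 2/3 * cmod (1 - cnj (a i) * q))"
    using blaschke_factor_bound[OF less_imp_le[OF a] q] by (intro prod_mono) auto
  also have "\<dots> = (2/3)^n * (\<Prod>i<n. cmod (1 - cnj (a i) * q))"
    by (simp only: prod.distrib prod_constant card_lessThan)
  finally have "(\<Prod>i<n. cmod (q - a i)) * cmod (k q)
      \<le> (2/3)^n * (\<Prod>i<n. cmod (1 - cnj (a i) * q)) * cmod (k q)"
    by (rule mult_right_mono) simp
  then show "cmod (G q) \<le> (2/3)^n * cmod (h q)"
    unfolding h_def G[OF \<open>q \<in> S\<close>] norm_mult prod_norm[symmetric] by (simp add: mult_ac)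
qed

text \<open>
  Jensen's bound in the form \<open>exp (- A) \<le> (2/3)^n\<close>, with \<open>ln (2/3) \<le> - 1/3\<close>.
\<close>

lemma zero_count_bound:
  assumes "divides_zeros S G n a k" "open S" "cball 0 1 \<subseteq> S" "G holomorphic_on S"
    and "\<forall>z\<in>cball 0 1. cmod (G z) < 1"
    and q: "cmod q \<le> 1/4" "exp (- A) \<le> cmod (G q)"
  shows "real n \<le> 3 * A"
proof -
  note B = blaschke_quotient_bounds[OF assms(1-6)]
  have "q \<in> cball 0 1" using q by simp
  have "exp (- A) \<le> (2/3)^n * cmod (k q * (\<Prod>i<n. 1 - cnj (a i) * q))"
    using q(2) B(2) by linarith
  also have "\<dots> \<le> (2/3)^n * 1"
    using B(1)[of q] \<open>q \<in> cball 0 1\<close> by (intro mult_left_mono) auto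
  finally have "ln (exp (- A)) \<le> ln ((2/3::real)^n)"
    by (subst ln_le_cancel_iff) auto
  then have "- A \<le> real n * ln (2/3)" by (simp add: ln_realpow)
  also have "\<dots> \<le> real n * (2/3 - 1)"
    by (intro mult_left_mono ln_le_minus_one) auto
  finally show ?thesis by simp
qed

text \<open>
  If the cofactor of a factorisation with as many zeros as possible vanished at \<open>b\<close>, it could be
  divided by \<open>z - b\<close>.
\<close>

lemma maximal_zero_division:
  assumes S: "open S" "cball 0 1 \<subseteq> S" and hol: "G holomorphic_on S"
    and G1: "\<forall>z\<in>cball 0 1. cmod (G z) < 1"
    and q: "cmod q \<le> 1/4" "exp (- A) \<le> cmod (G q)"
  obtains n a k where "divides_zeros S G n a k" "\<forall>z\<in>ball 0 (1/2). k z \<noteq> 0"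
proof -
  define P where "P n \<longleftrightarrow> (\<exists>a k. divides_zeros S G n a k)" for n
  have P0: "P 0" unfolding P_def divides_zeros_def using hol by auto
  have Pb: "\<forall>n. P n \<longrightarrow> n \<le> nat \<lfloor>3 * A\<rfloor>"
  proof (intro allI impI)
    fix m assume "P m"
    then obtain a k where "divides_zeros S G m a k" unfolding P_def by blast
    then have "real m \<le> 3 * A" by (rule zero_count_bound[OF _ S hol G1 q])
    then show "m \<le> nat \<lfloor>3 * A\<rfloor>" by (rule le_nat_floor)
  qed
  obtain n where n: "P n" "\<forall>m. P m \<longrightarrow> m \<le> n"
    using Nat.ex_has_greatest_nat[OF P0 Pb] by (elim exE conjE)
  then obtain a k where ak: "divides_zeros S G n a k" unfolding P_def by blast
  have "k b \<noteq> 0" if b: "b \<in> ball 0 (1/2)" for b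
  proof
    assume "k b = 0"
    have "b \<in> S" using b S by auto
    define l where "l = (\<lambda>z. if z = b then deriv k b else (k z - k b) / (z - b))"
    have "l holomorphic_on S"
      unfolding l_def using ak \<open>b \<in> S\<close> S by (intro pole_lemma) (auto simp: divides_zeros_def interior_open)
    moreover have "k z = (z - b) * l z" for z using \<open>k b = 0\<close> by (simp add: l_def)
    moreover have "(\<Prod>i<n. z - (a(n := b)) i) = (\<Prod>i<n. z - a i)" for z
      by (intro prod.cong) auto
    ultimately have "divides_zeros S G (Suc n) (a(n := b)) l"
      using ak b unfolding divides_zeros_def by (auto simp: less_Suc_eq)
    then have "P (Suc n)" unfolding P_def by blast
    then show False using n(2) by fastforce
  qed
  then show ?thesis by (intro that[OF ak]) blast
qed

text \<open>
  Let \<open>h = exp (- p)\<close> be the quotient of \<open>G\<close> by its Blaschke product. Then \<open>Re p > 0\<close> and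
  \<open>Re (p q) \<le> A\<close>. Harnack's inequality carries the bound from \<open>q\<close> to the centre (\<open>3 * A\<close>) and on
  to the disc of radius \<open>1/5\<close> (\<open>7 * A\<close>), where it bounds the derivative of \<open>p\<close>. The remaining part
  of \<open>L'\<close> comes from the denominators of the at most \<open>3 * A\<close> Blaschke factors:
  \<open>2 * 7 * A / (3/10) + 3 * A * 5/9 < 49 * A\<close>.
\<close>

lemma unit_disc_factorization:
  assumes S: "open S" "cball 0 1 \<subseteq> S" and hol: "G holomorphic_on S"
    and G1: "\<forall>z\<in>cball 0 1. cmod (G z) < 1"
    and q: "cmod q \<le> 1/4" "exp (- A) \<le> cmod (G q)"
  obtains n a L where "real n \<le> 3 * A" "L holomorphic_on ball 0 (1/2)"
    "\<forall>z\<in>ball 0 (1/2). G z = (\<Prod>i<n. z - a i) * exp (L z)"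
    "\<forall>z\<in>cball 0 (1/5). cmod (deriv L z) \<le> 49 * A"
proof -
  obtain n a k where div: "divides_zeros S G n a k"
    and knz: "\<forall>z\<in>ball 0 (1/2). k z \<noteq> 0"
    by (rule maximal_zero_division[OF assms])
  have nA: "real n \<le> 3 * A" by (rule zero_count_bound[OF div S hol G1 q])
  have holk: "k holomorphic_on S" and a: "\<And>i. i < n \<Longrightarrow> cmod (a i) < 1/2"
    and G: "\<And>z. z \<in> S \<Longrightarrow> G z = (\<Prod>i<n. z - a i) * k z"
    using div by (auto simp: divides_zeros_def)
  have sub: "ball 0 (1/2) \<subseteq> S" using S(2) by force
  obtain L where holL: "L holomorphic_on ball 0 (1/2)" and L: "\<And>z. z \<in> ball 0 (1/2) \<Longrightarrow> exp (L z) = k z"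
    using holomorphic_logarithm_exists[OF convex_ball open_ball holomorphic_on_subset[OF holk sub], of 0] knz
    by auto
  have az: "cmod (cnj (a i) * z) \<le> 1/2 * cmod z" if "i < n" for i z
    unfolding norm_mult complex_mod_cnj using a[OF that] by (intro mult_right_mono) auto
  have Re_pos: "Re (1 - cnj (a i) * z) > 0" if "i < n" "cmod z < 1/2" for i z
    using az[OF that(1), of z] that(2) abs_Re_le_cmod[of "cnj (a i) * z"] by simp
  have slit: "1 - cnj (a i) * z \<notin> \<real>\<^sub>\<le>\<^sub>0" if "i < n" "cmod z < 1/2" for i z
    using Re_pos[OF that] by (auto simp: complex_nonpos_Reals_iff)
  define p where "p = (\<lambda>z. - (L z + (\<Sum>i<n. Ln (1 - cnj (a i) * z))))"
  have holp: "p holomorphic_on ball 0 (1/2)"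
    unfolding p_def using holL slit by (intro holomorphic_intros) auto
  define h where "h = (\<lambda>z. k z * (\<Prod>i<n. 1 - cnj (a i) * z))"
  have exp_p: "exp (- p z) = h z" if z: "z \<in> ball 0 (1/2)" for z
  proof -
    have "exp (Ln (1 - cnj (a i) * z)) = 1 - cnj (a i) * z" if "i < n" for i
      using slit[OF that, of z] z by (intro exp_Ln) auto
    then show ?thesis
      unfolding p_def h_def using L[OF z] by (simp add: exp_add exp_sum)
  qed
  have B: "cmod (h z) < 1" if "z \<in> cball 0 1" for z
    using blaschke_quotient_bounds(1)[OF div S hol G1 q(1) that] unfolding h_def .
  have Bq: "cmod (G q) \<le> (2/3)^n * cmod (h q)"
    using blaschke_quotient_bounds(2)[OF div S hol G1 q(1)] unfolding h_def .
  have posp: "Re (p z) > 0" if z: "z \<in> ball 0 (1/2)" for z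
  proof -
    have "exp (- Re (p z)) = cmod (exp (- p z))" by simp
    also have "\<dots> = cmod (h z)" using exp_p[OF z] by simp
    also have "\<dots> < 1" using B[of z] z by simp
    finally show ?thesis by simp
  qed
  have q_in: "q \<in> ball 0 (1/2)" using q by simp
  have pq: "Re (p q) \<le> A"
  proof -
    have "exp (- A) \<le> (2/3)^n * cmod (h q)" using q(2) Bq by linarith
    also have "\<dots> \<le> 1 * cmod (h q)" by (intro mult_right_mono) (auto simp: power_le_one)
    also have "\<dots> = exp (- Re (p q))" using exp_p[OF q_in, symmetric] by simp
    finally show ?thesis by simp
  qed
  have p0: "Re (p 0) \<le> 3 * A"
  proof -
    have "\<bar>Re (p q) - Re (p 0)\<bar> \<le> dist 0 q / (1/2) * (Re (p q) + Re (p 0))"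
      by (rule harnack_at_center(1)[OF holp _ posp q_in]) auto
    also have "\<dots> \<le> 1/2 * (Re (p q) + Re (p 0))"
      using q posp[OF q_in] posp[of 0] by (intro mult_right_mono) auto
    finally have "- (Re (p q) - Re (p 0)) \<le> 1/2 * (Re (p q) + Re (p 0))" by (rule abs_le_D2)
    then show ?thesis using pq by argo
  qed
  have A0: "A \<ge> 0" using p0 posp[of 0] by simp
  show ?thesis
  proof (rule that[OF nA holL]; intro ballI)
    fix z :: complex assume z: "z \<in> ball 0 (1/2)"
    then show "G z = (\<Prod>i<n. z - a i) * exp (L z)" using G L sub by auto
  next
    fix z :: complex assume z: "z \<in> cball 0 (1/5)"
    then have zb: "z \<in> ball 0 (1/2)" by simp
    have "\<bar>Re (p z) - Re (p 0)\<bar> \<le> dist 0 z / (1/2) * (Re (p z) + Re (p 0))"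
      by (rule harnack_at_center(1)[OF holp _ posp zb]) auto
    also have "\<dots> \<le> 2/5 * (Re (p z) + Re (p 0))"
      using z posp[OF zb] posp[of 0] by (intro mult_right_mono) auto
    finally have "Re (p z) - Re (p 0) \<le> 2/5 * (Re (p z) + Re (p 0))" by (rule abs_le_D1)
    then have pz: "Re (p z) \<le> 7 * A" using p0 by argo
    have sub2: "ball z (3/10) \<subseteq> ball 0 (1/2)"
    proof
      fix x assume "x \<in> ball z (3/10)"
      then have "cmod (x - z) < 3/10" by (simp add: dist_norm norm_minus_commute)
      moreover have "cmod z \<le> 1/5" using z by simp
      ultimately show "x \<in> ball 0 (1/2)" using norm_triangle_sub[of x z] by simp
    qed
    have dp: "cmod (deriv p z) \<le> 2 * Re (p z) / (3/10)"
      by (rule harnack_at_center(2)[OF holomorphic_on_subset[OF holp sub2] _ posp])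
        (use sub2 in auto)
    have dL: "(L has_field_derivative deriv L z) (at z)"
      using holomorphic_derivI[OF holL open_ball zb] .
    have "(p has_field_derivative
        - (deriv L z + (\<Sum>i<n. - cnj (a i) / (1 - cnj (a i) * z)))) (at z)"
      unfolding p_def using slit[of _ z] zb
      by (auto intro!: derivative_eq_intros dL sum.cong simp: field_simps)
    then have "deriv p z = - (deriv L z + (\<Sum>i<n. - cnj (a i) / (1 - cnj (a i) * z)))"
      by (rule DERIV_imp_deriv)
    then have "deriv L z = - deriv p z + (\<Sum>i<n. cnj (a i) / (1 - cnj (a i) * z))"
      by (simp add: sum_negf)
    then have "cmod (deriv L z) \<le> cmod (- deriv p z) + cmod (\<Sum>i<n. cnj (a i) / (1 - cnj (a i) * z))"
      by (simp only: norm_triangle_ineq)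
    also have "\<dots> \<le> cmod (deriv p z) + (\<Sum>i<n. cmod (cnj (a i) / (1 - cnj (a i) * z)))"
      unfolding norm_minus_cancel by (intro add_left_mono norm_sum)
    also have "(\<Sum>i<n. cmod (cnj (a i) / (1 - cnj (a i) * z))) \<le> (\<Sum>i<n. 5/9)"
    proof (rule sum_mono)
      fix i assume "i \<in> {..<n}"
      then have i: "i < n" by simp
      have "cmod (1 - cnj (a i) * z) \<ge> 1 - 1/2 * cmod z"
        using az[OF i, of z] norm_triangle_ineq2[of 1 "cnj (a i) * z"] by simp
      then have "cmod (1 - cnj (a i) * z) \<ge> 9/10" using z by simp
      then have "cmod (cnj (a i)) / cmod (1 - cnj (a i) * z) \<le> (1/2) / (9/10)"
        using a[OF i] by (intro frac_le) auto
      then show "cmod (cnj (a i) / (1 - cnj (a i) * z)) \<le> 5/9" by (simp add: norm_divide)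
    qed
    finally show "cmod (deriv L z) \<le> 49 * A" using dp pz nA A0 by simp
  qed
qed

lemma disc_factorization:
  fixes F :: "complex \<Rightarrow> complex"
  assumes S: "open S" "cball c r \<subseteq> S" and hol: "F holomorphic_on S" and r: "r > 0"
    and M: "\<forall>z\<in>cball c r. cmod (F z) < M"
    and q: "q \<in> cball c (r/4)" "M * exp (- A) \<le> cmod (F q)"
  obtains n a L where "real n \<le> 3 * A" "L holomorphic_on ball c (r/2)"
    "\<forall>z\<in>ball c (r/2). F z = (\<Prod>i<n. z - a i) * exp (L z)"
    "\<forall>z\<in>cball c (r/5). cmod (deriv L z) \<le> 49 * A / r"
proof -
  have M0: "M > 0" using M r le_less_trans[OF norm_ge_zero, of "F c" M] by auto
  define G where "G = (\<lambda>w. F (c + of_real r * w) / of_real M)"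
  define T where "T = (\<lambda>w. c + of_real r * w) -` S"
  have T: "open T" unfolding T_def using S by (intro open_vimage continuous_intros) auto
  have in_ball: "c + of_real r * w \<in> cball c r" if "w \<in> cball 0 1" for w
    using that r mult_left_mono[of "cmod w" 1 r] by (simp add: dist_norm norm_mult)
  have T1: "cball 0 1 \<subseteq> T" unfolding T_def using in_ball S(2) by (intro subsetI vimageI2) blast
  have holG: "G holomorphic_on T"
    unfolding G_def
    by (intro holomorphic_on_divide holomorphic_on_const holomorphic_on_compose_gen[OF _ hol, unfolded o_def])
      (use M0 in \<open>auto intro!: holomorphic_intros simp: T_def\<close>)
  have G1: "\<forall>w\<in>cball 0 1. cmod (G w) < 1"
  proof
    fix w :: complex assume "w \<in> cball 0 1"
    then have "cmod (F (c + of_real r * w)) < M" using M in_ball by blast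
    then show "cmod (G w) < 1" using M0 by (simp add: G_def norm_divide)
  qed
  define s where "s = (q - c) / of_real r"
  have s: "cmod s \<le> 1/4" "c + of_real r * s = q"
    using q(1) r by (auto simp: s_def norm_divide dist_norm norm_minus_commute field_simps)
  have Gs: "exp (- A) \<le> cmod (G s)"
    using q(2) M0 s(2) by (simp add: G_def norm_divide field_simps)
  obtain n a L where nA: "real n \<le> 3 * A" and holL: "L holomorphic_on ball 0 (1/2)"
    and fac: "\<forall>z\<in>ball 0 (1/2). G z = (\<Prod>i<n. z - a i) * exp (L z)"
    and dL: "\<forall>z\<in>cball 0 (1/5). cmod (deriv L z) \<le> 49 * A"
    by (rule unit_disc_factorization[OF T T1 holG G1 s(1) Gs])
  \<comment> \<open>scaling the disc to the unit disc multiplies \<open>F\<close> by \<open>1 / M\<close> and each linear factor by \<open>1 / r\<close>\<close>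
  define K :: complex where "K = of_real (ln M - real n * ln r)"
  have expK: "exp K = of_real (M / r ^ n)"
    unfolding K_def exp_of_real using M0 r
    by (simp add: exp_diff exp_of_nat_mult)
  define L' where "L' = (\<lambda>z. L ((z - c) / of_real r) + K)"
  have in_half: "(z - c) / of_real r \<in> ball 0 (1/2)" if "z \<in> ball c (r/2)" for z
    using that r by (simp add: norm_divide dist_norm norm_minus_commute field_simps)
  show ?thesis
  proof (rule that[OF nA]; (intro ballI)?)
    show "L' holomorphic_on ball c (r/2)"
      unfolding L'_def
      by (intro holomorphic_on_add holomorphic_on_const holomorphic_on_compose_gen[OF _ holL, unfolded o_def])
        (use r in_half in \<open>auto intro!: holomorphic_intros\<close>)
    show "F z = (\<Prod>i<n. z - (c + of_real r * a i)) * exp (L' z)" if z: "z \<in> ball c (r/2)" for z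
    proof -
      let ?w = "(z - c) / of_real r"
      have "F z = of_real M * G ?w" using r M0 by (simp add: G_def)
      also have "\<dots> = of_real M * ((\<Prod>i<n. ?w - a i) * exp (L ?w))"
        using fac in_half[OF z] by simp
      also have "(\<Prod>i<n. ?w - a i) = (\<Prod>i<n. (z - (c + of_real r * a i)) / of_real r)"
        using r by (intro prod.cong) (auto simp: field_simps)
      also have "\<dots> = (\<Prod>i<n. z - (c + of_real r * a i)) / of_real r ^ n"
        by (simp add: prod_dividef)
      finally show ?thesis
        unfolding L'_def exp_add expK by (simp add: mult_ac)
    qed
    show "cmod (deriv L' z) \<le> 49 * A / r" if z: "z \<in> cball c (r/5)" for z
    proof -
      let ?w = "(z - c) / of_real r"
      have w: "?w \<in> cball 0 (1/5)"
        using z r by (simp add: norm_divide dist_norm norm_minus_commute field_simps)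
      then have "(L has_field_derivative deriv L ?w) (at ?w)"
        using holomorphic_derivI[OF holL open_ball, of ?w] by simp
      then have "(L' has_field_derivative deriv L ?w * (1 / of_real r)) (at z)"
        unfolding L'_def using r
        by (auto intro!: derivative_eq_intros DERIV_chain2[of L])
      then have "deriv L' z = deriv L ?w / of_real r" by (simp add: DERIV_imp_deriv)
      then show ?thesis using dL w r by (simp add: norm_divide divide_right_mono)
    qed
  qed
qed


section \<open>The direction of a smooth arc seen from a point\<close>

text \<open>
  The unsigned angle between \<open>w\<close> and the positive real axis. The inverse cosine, rather than
  \<open>\<bar>Arg w\<bar>\<close>, can be differentiated after a harmless rescaling of its argument.
\<close>

definition ray_angle :: "complex \<Rightarrow> real" where
  "ray_angle w = arccos (Re w / cmod w)"

lemma ray_angle_cos_bounds: "\<bar>Re w / cmod w\<bar> \<le> 1"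
  using abs_Re_le_cmod[of w] by (cases "w = 0") (auto simp: divide_le_eq)

lemma ray_angle_bounds: "0 \<le> ray_angle w" "ray_angle w \<le> pi"
  using arccos_bounded[OF abs_le_D2[OF ray_angle_cos_bounds, THEN minus_le_iff[THEN iffD1]] abs_le_D1[OF ray_angle_cos_bounds]]
  unfolding ray_angle_def by blast+

lemma ray_angle_eq_Arg: "w \<noteq> 0 \<Longrightarrow> ray_angle w = \<bar>Arg w\<bar>"
proof -
  assume "w \<noteq> 0"
  then have "Re w / cmod w = cos \<bar>Arg w\<bar>" by (simp add: cos_Arg)
  moreover have "\<bar>Arg w\<bar> \<le> pi" using mpi_less_Arg[of w] Arg_le_pi[of w] by linarith
  ultimately show ?thesis unfolding ray_angle_def using arccos_cos[of "\<bar>Arg w\<bar>"] by simp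
qed

text \<open>
  Arguments add up as long as their moduli have a sum less than \<open>pi\<close>; otherwise the bound is
  trivial, because a ray angle is at most \<open>pi\<close>.
\<close>

lemma ray_angle_mult_le:
  assumes "w \<noteq> 0" "z \<noteq> 0" shows "ray_angle (w * z) \<le> ray_angle w + \<bar>Arg z\<bar>"
proof (cases "\<bar>Arg w\<bar> + \<bar>Arg z\<bar> < pi")
  case True
  then have "Arg (w * z) = Arg w + Arg z" using assms by (intro Arg_times) auto
  then show ?thesis using assms by (simp add: ray_angle_eq_Arg)
next
  case False
  then show ?thesis using ray_angle_bounds(2)[of "w * z"] assms(1) by (simp add: ray_angle_eq_Arg)
qed

text \<open>
  The chain rule \<open>(cos \<theta>)' = - sin \<theta> * \<theta>'\<close> for the argument \<open>\<theta>\<close> of \<open>w\<close>, whose derivative is the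
  imaginary part of the logarithmic derivative.
\<close>

lemma cos_direction_derivative:
  fixes w :: "real \<Rightarrow> complex"
  assumes d: "(w has_vector_derivative w') (at t within S)" and nz: "w t \<noteq> 0"
  shows "((\<lambda>t. Re (w t) / cmod (w t)) has_real_derivative
           - (Im (w t) / cmod (w t)) * Im (w' / w t)) (at t within S)"
proof -
  define x y where "x = Re (w t)" and "y = Im (w t)"
  have dx: "((\<lambda>t. Re (w t)) has_real_derivative Re w') (at t within S)"
    and dy: "((\<lambda>t. Im (w t)) has_real_derivative Im w') (at t within S)"
    using d by (auto intro: has_vector_derivative_real_field derivative_eq_intros
      simp: has_real_derivative_iff_has_vector_derivative has_vector_derivative_complex_iff)
  define f1 f2 where "f1 = (\<lambda>t. Re (w t))" and "f2 = (\<lambda>t. Im (w t))"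
  note dx = dx[folded f1_def] and dy = dy[folded f2_def]
  have xy: "x = f1 t" "y = f2 t" by (simp_all add: x_def y_def f1_def f2_def)
  define N where "N = x\<^sup>2 + y\<^sup>2"
  have N: "N > 0" using nz unfolding N_def x_def y_def
    by (metis cmod_power2 zero_less_norm_iff zero_less_power)
  have n: "cmod (w t) = sqrt N" by (simp add: N_def x_def y_def cmod_def)
  have "((\<lambda>t. f1 t / sqrt ((f1 t)\<^sup>2 + (f2 t)\<^sup>2)) has_real_derivative
      (Re w' * sqrt N - x * ((2 * x * Re w' + 2 * y * Im w') / (2 * sqrt N))) / (sqrt N * sqrt N)) (at t within S)"
    using N unfolding N_def xy
    by (auto intro!: derivative_eq_intros dx dy simp: divide_simps)
  moreover have "(Re w' * sqrt N - x * ((2 * x * Re w' + 2 * y * Im w') / (2 * sqrt N))) / (sqrt N * sqrt N)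
      = - (y / sqrt N) * Im (w' / w t)"
  proof -
    have e1: "Im (w' / w t) = (Im w' * x - Re w' * y) / N"
      by (simp add: Im_divide N_def x_def y_def)
    have e2: "(Re w' * sqrt N - x * ((2 * x * Re w' + 2 * y * Im w') / (2 * sqrt N)))
       = (Re w' * N - x * (x * Re w' + y * Im w')) / sqrt N"
      using N by (simp add: field_simps)
    have e3: "Re w' * N - x * (x * Re w' + y * Im w') = - (y * (Im w' * x - Re w' * y))"
      by (simp add: N_def power2_eq_square algebra_simps)
    show ?thesis unfolding e1 e2 e3 using N by simp
  qed
  ultimately show ?thesis unfolding n y_def[symmetric] by (simp add: cmod_def f1_def f2_def)
qed

text \<open>
  The pointwise inequality behind the next lemma. Let \<open>X = cos \<psi>\<close> and \<open>Y = sin \<psi>\<close>. For \<open>c = 1\<close> the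
  quotient \<open>c * Y / sqrt (1 - (c * X)\<^sup>2)\<close> would be the sign of \<open>Y\<close>, and the last term would
  vanish; for \<open>c < 1\<close> it is a smooth substitute \<open>k\<close> with \<open>\<bar>k\<bar> \<le> 1\<close>, and \<open>\<bar>Y\<bar> - k * Y\<close> is at most
  \<open>sqrt (1 - c\<^sup>2) / c\<close>.
\<close>

lemma flattened_sign_estimate:
  fixes c X Y \<kappa> \<rho> :: real
  assumes c: "0 < c" "c < 1" and XY: "X\<^sup>2 + Y\<^sup>2 = 1" and "\<rho> \<ge> 0"
  shows "\<bar>\<rho> * Y\<bar> \<le> \<bar>\<kappa>\<bar> - c * Y / sqrt (1 - (c * X)\<^sup>2) * (\<kappa> - \<rho> * Y) + sqrt (1 - c\<^sup>2) / c * \<rho>"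
proof -
  define s where "s = c * \<bar>Y\<bar>"
  define e where "e = sqrt (1 - c\<^sup>2)"
  define q where "q = sqrt (1 - (c * X)\<^sup>2)"
  have "c\<^sup>2 < 1" using c by (simp add: power_less_one_iff)
  then have e: "e > 0" "e\<^sup>2 = 1 - c\<^sup>2" by (auto simp: e_def)
  have "1 - (c * X)\<^sup>2 = 1 - c\<^sup>2 * (X\<^sup>2)" by (simp add: power_mult_distrib)
  also have "\<dots> = e\<^sup>2 + s\<^sup>2"
  proof -
    have "c\<^sup>2 * (X\<^sup>2 + Y\<^sup>2) = c\<^sup>2" unfolding XY by simp
    then show ?thesis unfolding e(2) s_def power_mult_distrib power2_abs by (simp add: algebra_simps)
  qed
  finally have q: "q = sqrt (e\<^sup>2 + s\<^sup>2)" by (simp add: q_def)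
  have s0: "s \<ge> 0" using c by (simp add: s_def)
  have q1: "s \<le> q" "q \<le> e + s" "q > 0"
    unfolding q using e(1) s0
    by (auto intro: real_le_rsqrt real_le_lsqrt simp: power2_sum add_pos_nonneg)
  define k where "k = c * Y / q"
  have k: "\<bar>k\<bar> = s / q" using c q1(3) by (simp add: k_def s_def abs_mult)
  then have k1: "\<bar>k\<bar> \<le> 1" using q1 by simp
  have "k * \<kappa> \<le> \<bar>k\<bar> * \<bar>\<kappa>\<bar>" by (metis abs_ge_self abs_mult)
  also have "\<dots> \<le> 1 * \<bar>\<kappa>\<bar>" using k1 by (intro mult_right_mono) auto
  finally have 1: "k * \<kappa> \<le> \<bar>\<kappa>\<bar>" by simp
  have "k * Y = s / q * \<bar>Y\<bar>" using c q1(3) by (simp add: k_def s_def abs_mult_self_eq)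
  then have "c * (\<bar>Y\<bar> - k * Y) = s - (s / q) * s" by (simp add: s_def algebra_simps)
  also have "\<dots> = s * (q - s) / q" using q1(3) by (simp add: field_simps)
  also have "\<dots> = (s / q) * (q - s)" by simp
  also have "\<dots> \<le> 1 * (q - s)" using q1 by (intro mult_right_mono) auto
  also have "\<dots> \<le> e" using q1 by simp
  finally have "\<bar>Y\<bar> - k * Y \<le> e / c" using c by (simp add: field_simps)
  then have "\<rho> * (\<bar>Y\<bar> - k * Y) \<le> \<rho> * (e / c)" using \<open>\<rho> \<ge> 0\<close> by (rule mult_left_mono)
  then have 2: "\<bar>\<rho> * Y\<bar> \<le> k * (\<rho> * Y) + e / c * \<rho>"
    using \<open>\<rho> \<ge> 0\<close> by (simp add: abs_mult algebra_simps)
  have "c * Y / q * (\<kappa> - \<rho> * Y) = k * \<kappa> - k * (\<rho> * Y)"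
    by (simp add: k_def right_diff_distrib)
  then show ?thesis using 1 2 unfolding e_def[symmetric] q_def[symmetric] by linarith
qed

text \<open>
  Let \<open>\<phi>\<close> be the argument of \<open>g - a\<close>, \<open>\<theta>\<close> that of the velocity, and \<open>\<psi> = \<theta> - \<phi>\<close>, the argument of
  \<open>W = g' / (g - a)\<close>. Since \<open>\<phi>' = Im W\<close> has the sign \<open>s\<close> of \<open>sin \<psi>\<close>,
  \<open>\<bar>\<phi>'\<bar> = s \<phi>' = s \<theta>' - s \<psi>' \<le> \<bar>\<theta>'\<bar> - s \<psi>'\<close>, and \<open>s \<psi>'\<close> is the derivative of \<open>arccos (cos \<psi>)\<close>, the
  ray angle of \<open>W\<close>. Where \<open>sin \<psi> = 0\<close> this function has corners; so \<open>arccos (c cos \<psi>)\<close> with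
  \<open>c < 1\<close> takes its place, and \<open>c\<close> tends to \<open>1\<close> at the end.
\<close>

lemma smooth_arc_argument_variation:
  fixes g :: "real \<Rightarrow> complex"
  assumes uv: "u < v"
    and g: "\<And>t. t \<in> {u..v} \<Longrightarrow> (g has_vector_derivative d t) (at t within {u..v})"
    and d: "\<And>t. t \<in> {u..v} \<Longrightarrow> (d has_vector_derivative d2 t) (at t within {u..v})"
    and d0: "\<And>t. t \<in> {u..v} \<Longrightarrow> d t \<noteq> 0"
    and d2: "continuous_on {u..v} d2"
    and a: "\<And>t. t \<in> {u..v} \<Longrightarrow> g t \<noteq> a"
  shows "integral {u..v} (\<lambda>t. \<bar>Im (d t / (g t - a))\<bar>) \<le>
     integral {u..v} (\<lambda>t. \<bar>Im (d2 t / d t)\<bar>)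
       + ray_angle (d u / (g u - a)) - ray_angle (d v / (g v - a))"
proof -
  define W where "W = (\<lambda>t. d t / (g t - a))"
  have cg: "continuous_on {u..v} g" and cd: "continuous_on {u..v} d"
    using g d has_vector_derivative_continuous unfolding continuous_on_eq_continuous_within by blast+
  have cW: "continuous_on {u..v} W" unfolding W_def
    using a by (intro continuous_intros cd cg) auto
  have W0: "W t \<noteq> 0" if "t \<in> {u..v}" for t using d0[OF that] a[OF that] by (simp add: W_def)
  have dW: "(W has_vector_derivative W t * (d2 t / d t - W t)) (at t within {u..v})"
    if t: "t \<in> {u..v}" for t
  proof -
    have "((\<lambda>z. inverse (z - a)) has_field_derivative - inverse ((g t - a)\<^sup>2)) (at (g t) within g ` {u..v})"
      using a[OF t] by (auto intro!: derivative_eq_intros simp: power2_eq_square divide_simps)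
    from field_vector_diff_chain_within[OF g[OF t] this]
    have "((\<lambda>t. inverse (g t - a)) has_vector_derivative d t * - inverse ((g t - a)\<^sup>2)) (at t within {u..v})"
      by (simp add: o_def)
    from has_vector_derivative_mult[OF d[OF t] this]
    have "(W has_vector_derivative d t * (d t * - inverse ((g t - a)\<^sup>2)) + d2 t * inverse (g t - a))
        (at t within {u..v})"
      by (simp add: W_def divide_inverse)
    moreover have "d t * (d t * - inverse ((g t - a)\<^sup>2)) + d2 t * inverse (g t - a)
        = W t * (d2 t / d t - W t)"
    proof -
      define b where "b = inverse (g t - a)"
      have "inverse ((g t - a)\<^sup>2) = b\<^sup>2" "W t = d t * b"
        by (simp_all add: b_def W_def divide_inverse power_inverse)
      then show ?thesis using d0[OF t] unfolding b_def[symmetric]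
        by (simp add: power2_eq_square algebra_simps)
    qed
    ultimately show ?thesis by simp
  qed
  define X Y where "X = (\<lambda>t. Re (W t) / cmod (W t))" and "Y = (\<lambda>t. Im (W t) / cmod (W t))"
  have XY: "(X t)\<^sup>2 + (Y t)\<^sup>2 = 1" if "t \<in> {u..v}" for t
    using W0[OF that] unfolding X_def Y_def power_divide add_divide_distrib[symmetric] cmod_power2[symmetric]
    by simp
  have X1: "\<bar>X t\<bar> \<le> 1" for t unfolding X_def by (rule ray_angle_cos_bounds)
  define \<kappa> where "\<kappa> = (\<lambda>t. Im (d2 t / d t))"
  have \<kappa>: "continuous_on {u..v} \<kappa>" unfolding \<kappa>_def
    using d0 by (intro continuous_intros cd d2) auto
  have dX: "(X has_real_derivative - Y t * (\<kappa> t - Im (W t))) (at t within {u..v})" if t: "t \<in> {u..v}" for t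
    using cos_direction_derivative[OF dW[OF t] W0[OF t]] W0[OF t] unfolding X_def Y_def \<kappa>_def by simp
  let ?I = "integral {u..v}"
  have bound: "?I (\<lambda>t. \<bar>Im (W t)\<bar>) \<le> ?I (\<lambda>t. \<bar>\<kappa> t\<bar>) + arccos (c * X u) - arccos (c * X v)
      + sqrt (1 - c\<^sup>2) / c * ?I (\<lambda>t. cmod (W t))" if c: "0 < c" "c < 1" for c
  proof -
    have cX: "\<bar>c * X t\<bar> < 1" for t
    proof -
      have "c * \<bar>X t\<bar> \<le> c * 1" using c X1[of t] by (intro mult_left_mono) auto
      moreover have "\<bar>c * X t\<bar> = c * \<bar>X t\<bar>" using c by (simp add: abs_mult)
      ultimately show ?thesis using c by linarith
    qed
    define h where "h = (\<lambda>t. c * Y t / sqrt (1 - (c * X t)\<^sup>2) * (\<kappa> t - cmod (W t) * Y t))"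
    have ImW: "Im (W t) = cmod (W t) * Y t" for t by (simp add: Y_def)
    have "((\<lambda>t. arccos (c * X t)) has_real_derivative h t) (at t within {u..v})" if t: "t \<in> {u..v}" for t
    proof -
      have "((\<lambda>t. arccos (c * X t)) has_real_derivative
          inverse (- sqrt (1 - (c * X t)\<^sup>2)) * (c * (- Y t * (\<kappa> t - Im (W t))))) (at t within {u..v})"
        using cX[of t]
        by (intro DERIV_chain2[OF DERIV_arccos] derivative_intros DERIV_cmult dX t) (auto simp: abs_less_iff)
      moreover have "inverse (- sqrt (1 - (c * X t)\<^sup>2)) * (c * (- Y t * (\<kappa> t - Im (W t)))) = h t"
        unfolding h_def ImW by (simp add: divide_inverse)
      ultimately show ?thesis by simp
    qed
    then have h: "(h has_integral (arccos (c * X v) - arccos (c * X u))) {u..v}"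
      using uv by (intro fundamental_theorem_of_calculus)
        (auto simp: has_real_derivative_iff_has_vector_derivative)
    have "((\<lambda>t. \<bar>Im (W t)\<bar>) has_integral ?I (\<lambda>t. \<bar>Im (W t)\<bar>)) {u..v}"
      by (intro integrable_integral integrable_continuous_interval continuous_intros cW)
    moreover have "((\<lambda>t. \<bar>\<kappa> t\<bar> - h t + sqrt (1 - c\<^sup>2) / c * cmod (W t)) has_integral
        (?I (\<lambda>t. \<bar>\<kappa> t\<bar>) - (arccos (c * X v) - arccos (c * X u))
          + sqrt (1 - c\<^sup>2) / c * ?I (\<lambda>t. cmod (W t)))) {u..v}"
      by (intro has_integral_add has_integral_diff h has_integral_mult_right
          integrable_integral integrable_continuous_interval continuous_intros cW \<kappa>)
    ultimately have "?I (\<lambda>t. \<bar>Im (W t)\<bar>) \<le> ?I (\<lambda>t. \<bar>\<kappa> t\<bar>) - (arccos (c * X v) - arccos (c * X u))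
          + sqrt (1 - c\<^sup>2) / c * ?I (\<lambda>t. cmod (W t))"
      by (rule has_integral_le)
        (use flattened_sign_estimate[OF c XY norm_ge_zero] in \<open>simp add: ImW h_def\<close>)
    then show ?thesis by simp
  qed
  define c :: "nat \<Rightarrow> real" where "c = (\<lambda>n. 1 - 1 / real (n + 2))"
  have c: "0 < c n" "c n < 1" for n by (auto simp: c_def field_simps)
  have c1: "c \<longlonglongrightarrow> 1"
    unfolding c_def by (rule tendsto_eq_intros LIMSEQ_ignore_initial_segment[OF lim_1_over_n, of 2] | simp)+
  have arc: "(\<lambda>n. arccos (c n * X t)) \<longlonglongrightarrow> arccos (X t)" for t
  proof (rule continuous_on_tendsto_compose[OF continuous_on_arccos'])
    show "(\<lambda>n. c n * X t) \<longlonglongrightarrow> X t" using tendsto_mult_right[OF c1, of "X t"] by simp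
    show "X t \<in> {-1..1}" using X1[of t] by (simp add: abs_le_iff)
    show "\<forall>\<^sub>F n in sequentially. c n * X t \<in> {-1..1}"
    proof (rule always_eventually, rule allI)
      fix n
      have "\<bar>c n * X t\<bar> \<le> 1 * 1"
        unfolding abs_mult using c[of n] X1[of t] by (intro mult_mono) auto
      then show "c n * X t \<in> {-1..1}" by (simp add: abs_le_iff)
    qed
  qed
  have "(\<lambda>n. ?I (\<lambda>t. \<bar>\<kappa> t\<bar>) + arccos (c n * X u) - arccos (c n * X v)
      + sqrt (1 - (c n)\<^sup>2) / c n * ?I (\<lambda>t. cmod (W t)))
    \<longlonglongrightarrow> ?I (\<lambda>t. \<bar>\<kappa> t\<bar>) + arccos (X u) - arccos (X v) + sqrt (1 - 1\<^sup>2) / 1 * ?I (\<lambda>t. cmod (W t))"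
    by (intro tendsto_intros arc c1) auto
  then have "?I (\<lambda>t. \<bar>Im (W t)\<bar>)
      \<le> ?I (\<lambda>t. \<bar>\<kappa> t\<bar>) + arccos (X u) - arccos (X v) + sqrt (1 - 1\<^sup>2) / 1 * ?I (\<lambda>t. cmod (W t))"
    by (rule LIMSEQ_le_const) (use bound[OF c] in blast)
  then show ?thesis by (simp add: ray_angle_def X_def \<kappa>_def W_def)
qed


section \<open>Arcs with vertices\<close>

lemma smooth_arc_on_subset:
  assumes "smooth_arc_on s t g" "s \<le> u" "v \<le> t" shows "smooth_arc_on u v g"
proof -
  have sub: "{u..v} \<subseteq> {s..t}" using assms by auto
  obtain g' g'' where *: "\<And>x. x \<in> {s..t} \<Longrightarrow> (g has_vector_derivative g' x) (at x within {s..t}) \<and>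
      (g' has_vector_derivative g'' x) (at x within {s..t}) \<and> g' x \<noteq> 0" "continuous_on {s..t} g''"
    using assms(1) unfolding smooth_arc_on_def by blast
  have "\<forall>x\<in>{u..v}. (g has_vector_derivative g' x) (at x within {u..v}) \<and>
      (g' has_vector_derivative g'' x) (at x within {u..v}) \<and> g' x \<noteq> 0"
    using *(1) sub has_vector_derivative_within_subset[OF _ sub] by blast
  then show ?thesis unfolding smooth_arc_on_def using continuous_on_subset[OF *(2) sub] by blast
qed

lemma piecewise_interval_induct:
  fixes t :: "nat \<Rightarrow> real"
  assumes inc: "\<And>i. i < n \<Longrightarrow> t i < t (Suc i)"
    and base: "\<And>i u v. \<lbrakk>i < n; t i \<le> u; u < v; v \<le> t (Suc i)\<rbrakk> \<Longrightarrow> R u v"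
    and trans: "\<And>u v w. \<lbrakk>t 0 \<le> u; u < v; v < w; w \<le> t n; R u v; R v w\<rbrakk> \<Longrightarrow> R u w"
  shows "\<lbrakk>t 0 \<le> u; u < v; v \<le> t n\<rbrakk> \<Longrightarrow> R u v"
proof -
  have mono: "t i \<le> t j" if "i \<le> j" "j \<le> n" for i j
    using that
  proof (induction j rule: dec_induct)
    case (step m)
    then show ?case using inc[of m] by simp
  qed simp
  have "m \<le> n \<Longrightarrow> t 0 \<le> u \<Longrightarrow> u < v \<Longrightarrow> v \<le> t m \<Longrightarrow> R u v" for m u v
  proof (induction m arbitrary: u v)
    case (Suc m)
    have tm: "t (Suc m) \<le> t n" using mono Suc.prems(1) by blast
    consider "v \<le> t m" | "t m \<le> u" | "u < t m" "t m < v" by linarith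
    then show ?case
    proof cases
      case 3
      then have "R u (t m)" "R (t m) v" using Suc base[of m "t m" v] by auto
      then show ?thesis using trans[of u "t m" v] 3 Suc.prems tm by linarith
    qed (use Suc base[of m u v] in auto)
  qed simp
  then show "\<lbrakk>t 0 \<le> u; u < v; v \<le> t n\<rbrakk> \<Longrightarrow> R u v" by blast
qed

lemma piecewise_smooth_induct:
  assumes g: "piecewise_smooth g" and uv: "0 \<le> u" "u < v" "v \<le> 1"
    and base: "\<And>u v. \<lbrakk>0 \<le> u; u < v; v \<le> 1; smooth_arc_on u v g\<rbrakk> \<Longrightarrow> R u v"
    and trans: "\<And>u v w. \<lbrakk>0 \<le> u; u < v; v < w; w \<le> 1; R u v; R v w\<rbrakk> \<Longrightarrow> R u w"
  shows "R u v"
proof -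
  obtain n t where t: "t (0::nat) = 0" "t n = 1"
    and sm: "\<And>i. i < n \<Longrightarrow> t i < t (Suc i) \<and> smooth_arc_on (t i) (t (Suc i)) g"
    using g unfolding piecewise_smooth_def by blast
  have mono: "t i \<le> t j" if "i \<le> j" "j \<le> n" for i j
    using that
  proof (induction j rule: dec_induct)
    case (step m)
    then show ?case using sm[of m] by simp
  qed simp
  show ?thesis
  proof (rule piecewise_interval_induct[of n t R])
    fix i u v assume i: "i < n" "t i \<le> u" "u < v" "v \<le> t (Suc i)"
    then have "smooth_arc_on u v g" using sm smooth_arc_on_subset by blast
    moreover have "0 \<le> t i" "t (Suc i) \<le> 1" using mono[of 0 i] mono[of "Suc i" n] t i(1) by auto
    ultimately show "R u v" using base i by simp
  qed (use sm t uv trans in auto)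
qed

lemma smooth_arc_vector_derivatives:
  fixes g :: "real \<Rightarrow> complex"
  assumes uv: "u < v"
    and g: "\<forall>t\<in>{u..v}. (g has_vector_derivative g' t) (at t within {u..v})"
    and g': "\<forall>t\<in>{u..v}. (g' has_vector_derivative g'' t) (at t within {u..v})"
  shows "vector_derivative g (at_right u) = g' u" "vector_derivative g (at_left v) = g' v"
    and "t \<in> {u<..<v} \<Longrightarrow> (g has_vector_derivative g' t) (at t)"
    and "t \<in> {u<..<v} \<Longrightarrow> ((\<lambda>s. vector_derivative g (at s)) has_vector_derivative g'' t) (at t)"
proof -
  have "(g has_vector_derivative g' u) (at u within {u..v})" "(g has_vector_derivative g' v) (at v within {u..v})"
    using g uv by auto
  then show "vector_derivative g (at_right u) = g' u" "vector_derivative g (at_left v) = g' v"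
    unfolding at_within_Icc_at_right[OF uv] at_within_Icc_at_left[OF uv]
    by (auto intro!: vector_derivative_within)
  have at: "at t within {u..v} = at t" if "t \<in> {u<..<v}" for t
    using that by (intro at_within_interior) auto
  show d: "(g has_vector_derivative g' t) (at t)" if "t \<in> {u<..<v}" for t
    using g that at[OF that] by (metis atLeastAtMost_iff greaterThanLessThan_iff less_imp_le)
  show "((\<lambda>s. vector_derivative g (at s)) has_vector_derivative g'' t) (at t)" if t: "t \<in> {u<..<v}" for t
  proof (rule has_vector_derivative_transform_within_open[OF _ _ t])
    show "(g' has_vector_derivative g'' t) (at t)"
      using g' t at[OF t] by (metis atLeastAtMost_iff greaterThanLessThan_iff less_imp_le)
    show "g' x = vector_derivative g (at x)" if "x \<in> {u<..<v}" for x
      using vector_derivative_at[OF d[OF that]] by simp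
  qed auto
qed

definition curvature_density :: "(real \<Rightarrow> complex) \<Rightarrow> real \<Rightarrow> real" where
  "curvature_density g t = \<bar>signed_curvature g t\<bar> * cmod (vector_derivative g (at t))"

text \<open>
  Turning angles at \<open>u\<close> and \<open>v\<close> are left out, as end points are in \<open>plane_total_curvature\<close>, the
  case of the whole curve; when two arcs are joined, the turning angle at the common point is
  added.
\<close>

definition curvature_between :: "(real \<Rightarrow> complex) \<Rightarrow> real \<Rightarrow> real \<Rightarrow> real" where
  "curvature_between g u v = integral {u..v} (curvature_density g) +
     (\<Sum>t\<in>{t\<in>{u<..<v}. turning_angle g t \<noteq> 0}. \<bar>turning_angle g t\<bar>)"

lemma curvature_density_eq:
  assumes g: "\<forall>s\<in>{u<..<v}. (g has_vector_derivative g' s) (at s)"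
    and dv: "((\<lambda>s. vector_derivative g (at s)) has_vector_derivative a) (at t)"
    and t: "t \<in> {u<..<v}" and nz: "g' t \<noteq> 0"
  shows "curvature_density g t = \<bar>Im (a / g' t)\<bar>"
proof -
  have v: "vector_derivative g (at t) = g' t" using g t vector_derivative_at by blast
  have "\<bar>Im (a / g' t)\<bar> = \<bar>Im (a * cnj (g' t))\<bar> / (cmod (g' t))\<^sup>2"
    by (subst complex_div_cnj) (simp add: abs_divide)
  moreover have "cmod (g' t) > 0" using nz by simp
  ultimately show ?thesis
    unfolding curvature_density_def signed_curvature_def Let_def v vector_derivative_at[OF dv]
    by (simp add: abs_divide power3_eq_cube power2_eq_square mult.commute)
qed

text \<open>
  The estimate of \<open>smooth_arc_argument_variation\<close> for a curve with vertices. Keeping the two ray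
  angles, instead of estimating their difference by \<open>pi\<close>, is what makes the estimates of adjacent
  arcs add up; the integrability and finiteness statements make the two sides additive.
\<close>

definition bounds_argument :: "(real \<Rightarrow> complex) \<Rightarrow> complex \<Rightarrow> real \<Rightarrow> real \<Rightarrow> bool" where
  "bounds_argument g a u v \<longleftrightarrow>
     (\<lambda>t. \<bar>Im (vector_derivative g (at t) / (g t - a))\<bar>) integrable_on {u..v} \<and>
     curvature_density g integrable_on {u..v} \<and>
     finite {t\<in>{u<..<v}. turning_angle g t \<noteq> 0} \<and>
     vector_derivative g (at_right u) \<noteq> 0 \<and> vector_derivative g (at_left v) \<noteq> 0 \<and>
     integral {u..v} (\<lambda>t. \<bar>Im (vector_derivative g (at t) / (g t - a))\<bar>) \<le>
       curvature_between g u v + ray_angle (vector_derivative g (at_right u) / (g u - a))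
         - ray_angle (vector_derivative g (at_left v) / (g v - a))"

lemma bounds_argument_smooth_arc:
  assumes uv: "u < v" and sm: "smooth_arc_on u v g" and a: "a \<notin> g ` {u..v}"
  shows "bounds_argument g a u v"
proof -
  obtain d d2 where g: "\<forall>t\<in>{u..v}. (g has_vector_derivative d t) (at t within {u..v})"
    and d: "\<forall>t\<in>{u..v}. (d has_vector_derivative d2 t) (at t within {u..v})"
    and d0: "\<forall>t\<in>{u..v}. d t \<noteq> 0" and d2: "continuous_on {u..v} d2"
    using sm unfolding smooth_arc_on_def by blast
  note D = smooth_arc_vector_derivatives[OF uv g d]
  have D3: "\<forall>t\<in>{u<..<v}. (g has_vector_derivative d t) (at t)" using D(3) by blast
  have cg: "continuous_on {u..v} g" and cd: "continuous_on {u..v} d"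
    using g d has_vector_derivative_continuous unfolding continuous_on_eq_continuous_within by blast+
  have a': "g t \<noteq> a" if "t \<in> {u..v}" for t using a that by auto
  have ne: "g t - a \<noteq> 0" if "t \<in> {u..v}" for t using a'[OF that] by simp
  have ends: "t \<in> {u<..<v}" if "t \<in> {u..v} - {u, v}" for t using that by auto
  have arg_eq: "\<bar>Im (vector_derivative g (at t) / (g t - a))\<bar> = \<bar>Im (d t / (g t - a))\<bar>"
    if "t \<in> {u..v} - {u, v}" for t
    using vector_derivative_at[OF D(3)[OF ends[OF that]]] by simp
  have curv_eq: "curvature_density g t = \<bar>Im (d2 t / d t)\<bar>" if "t \<in> {u..v} - {u, v}" for t
    using curvature_density_eq[OF D3 D(4)[OF ends[OF that]] ends[OF that]] d0 that by simp
  have arg_int: "(\<lambda>t. \<bar>Im (d t / (g t - a))\<bar>) integrable_on {u..v}"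
    by (intro integrable_continuous_interval continuous_intros cg cd ballI ne)
  have curv_int: "(\<lambda>t. \<bar>Im (d2 t / d t)\<bar>) integrable_on {u..v}"
    by (intro integrable_continuous_interval continuous_intros d2 cd ballI) (use d0 in auto)
  have turn: "{t\<in>{u<..<v}. turning_angle g t \<noteq> 0} = {}"
  proof -
    have "turning_angle g t = 0" if t: "t \<in> {u<..<v}" for t
    proof -
      have gt: "(g has_vector_derivative d t) (at t within S)" for S
        using D(3)[OF t] has_vector_derivative_at_within by blast
      have "vector_derivative g (at_right t) = d t" "vector_derivative g (at_left t) = d t"
        using gt by (auto intro!: vector_derivative_within)
      then show ?thesis using d0 t by (simp add: turning_angle_def)
    qed
    then show ?thesis by blast
  qed
  have eqA: "integral {u..v} (\<lambda>t. \<bar>Im (vector_derivative g (at t) / (g t - a))\<bar>)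
      = integral {u..v} (\<lambda>t. \<bar>Im (d t / (g t - a))\<bar>)"
    by (rule integral_spike[of "{u, v}"]) (use arg_eq in auto)
  have eqC: "integral {u..v} (curvature_density g) = integral {u..v} (\<lambda>t. \<bar>Im (d2 t / d t)\<bar>)"
    by (rule integral_spike[of "{u, v}"]) (use curv_eq in auto)
  have "integral {u..v} (\<lambda>t. \<bar>Im (d t / (g t - a))\<bar>) \<le> integral {u..v} (\<lambda>t. \<bar>Im (d2 t / d t)\<bar>)
       + ray_angle (d u / (g u - a)) - ray_angle (d v / (g v - a))"
    by (rule smooth_arc_argument_variation[OF uv]) (use g d d0 d2 a' in auto)
  moreover have "(\<lambda>t. \<bar>Im (vector_derivative g (at t) / (g t - a))\<bar>) integrable_on {u..v}"
    by (rule integrable_spike_finite[OF _ _ arg_int, of "{u, v}"]) (use arg_eq in auto)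
  moreover have "curvature_density g integrable_on {u..v}"
    by (rule integrable_spike_finite[OF _ _ curv_int, of "{u, v}"]) (use curv_eq in auto)
  ultimately show ?thesis
    unfolding bounds_argument_def curvature_between_def turn eqA eqC D(1,2) using d0 uv by simp
qed

text \<open>
  At the common vertex the velocity is turned by \<open>turning_angle g v\<close>, so the ray angle jumps by at
  most \<open>\<bar>turning_angle g v\<bar>\<close>, which is the term that the curvature gains.
\<close>

lemma bounds_argument_join:
  assumes uvw: "u < v" "v < w" and L: "bounds_argument g a u v" and R: "bounds_argument g a v w"
    and a: "g v \<noteq> a"
  shows "bounds_argument g a u w"
    and "curvature_between g u w = curvature_between g u v + \<bar>turning_angle g v\<bar> + curvature_between g v w"
proof -
  note L' = L[unfolded bounds_argument_def] and R' = R[unfolded bounds_argument_def]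
  let ?Z = "\<lambda>u v. {t\<in>{u<..<v}. turning_angle g t \<noteq> 0}"
  let ?p = "vector_derivative g (at_right v)" and ?m = "vector_derivative g (at_left v)"
  have Z: "?Z u w = ?Z u v \<union> (if turning_angle g v = 0 then {} else {v}) \<union> ?Z v w"
    using uvw by (auto simp: not_less less_le)
  have fin: "finite (?Z u v)" "finite (?Z v w)" using L' R' by blast+
  then have finZ: "finite (?Z u w)" unfolding Z by simp
  have sum: "(\<Sum>t\<in>?Z u w. \<bar>turning_angle g t\<bar>) = (\<Sum>t\<in>?Z u v. \<bar>turning_angle g t\<bar>)
      + \<bar>turning_angle g v\<bar> + (\<Sum>t\<in>?Z v w. \<bar>turning_angle g t\<bar>)"
    unfolding Z by (subst sum.union_disjoint; use fin in auto)+
  have le: "u \<le> v" "v \<le> w" using uvw by auto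
  have cint: "curvature_density g integrable_on {u..w}"
    using Henstock_Kurzweil_Integration.integrable_combine[OF le] L' R' by blast
  have aint: "(\<lambda>t. \<bar>Im (vector_derivative g (at t) / (g t - a))\<bar>) integrable_on {u..w}"
    using Henstock_Kurzweil_Integration.integrable_combine[OF le] L' R' by blast
  note comb = Henstock_Kurzweil_Integration.integral_combine[OF le]
  show K: "curvature_between g u w = curvature_between g u v + \<bar>turning_angle g v\<bar> + curvature_between g v w"
    unfolding curvature_between_def sum comb[OF cint, symmetric] by simp
  have "ray_angle (?m / (g v - a) * (?p / ?m)) \<le> ray_angle (?m / (g v - a)) + \<bar>turning_angle g v\<bar>"
    unfolding turning_angle_def using L' R' a by (intro ray_angle_mult_le) auto
  moreover have "?m / (g v - a) * (?p / ?m) = ?p / (g v - a)" using L' by simp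
  ultimately have "ray_angle (?p / (g v - a)) \<le> ray_angle (?m / (g v - a)) + \<bar>turning_angle g v\<bar>" by simp
  then show "bounds_argument g a u w"
    unfolding bounds_argument_def K comb[OF aint, symmetric] using L' R' cint aint finZ by linarith
qed

lemma bounds_argument_piecewise_smooth:
  assumes g: "piecewise_smooth g" and uv: "0 \<le> u" "u < v" "v \<le> 1" and a: "a \<notin> g ` {u..v}"
  shows "bounds_argument g a u v"
proof -
  have "a \<notin> g ` {u..v} \<longrightarrow> bounds_argument g a u v"
  proof (rule piecewise_smooth_induct[OF g uv, of "\<lambda>u v. a \<notin> g ` {u..v} \<longrightarrow> bounds_argument g a u v"])
    fix u v w :: real
    assume *: "u < v" "v < w" "a \<notin> g ` {u..v} \<longrightarrow> bounds_argument g a u v"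
      "a \<notin> g ` {v..w} \<longrightarrow> bounds_argument g a v w"
    show "a \<notin> g ` {u..w} \<longrightarrow> bounds_argument g a u w"
    proof
      assume "a \<notin> g ` {u..w}"
      then have "a \<notin> g ` {u..v}" "a \<notin> g ` {v..w}" "g v \<noteq> a"
        using *(1,2) by (auto simp: image_iff)
      then show "bounds_argument g a u w" using bounds_argument_join(1) * by blast
    qed
  qed (use bounds_argument_smooth_arc in blast)
  then show ?thesis using a by blast
qed

lemma curve_omits_point:
  fixes g :: "real \<Rightarrow> complex"
  assumes "continuous_on {0..1} g" shows "\<exists>a. a \<notin> g ` {0..1}"
proof -
  have "bounded (g ` {0..1})"
    using compact_continuous_image[OF assms compact_Icc] compact_imp_bounded by blast
  then have "g ` {0..1} \<noteq> UNIV" using not_bounded_UNIV[where 'a = complex] by metis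
  then show ?thesis by blast
qed

text \<open>
  Integrability of the curvature and finiteness of the set of vertices are part of
  \<open>bounds_argument\<close>, which needs some point \<open>a\<close> off the curve.
\<close>

lemma curvature_between_superadditive:
  assumes g: "piecewise_smooth g" and c: "continuous_on {0..1} g"
    and uvw: "0 \<le> u" "u < v" "v < w" "w \<le> 1"
  shows "curvature_between g u v + curvature_between g v w \<le> curvature_between g u w"
proof -
  obtain a where a: "a \<notin> g ` {0..1}" using curve_omits_point[OF c] by blast
  have "a \<notin> g ` {u..v}" "a \<notin> g ` {v..w}" "g v \<noteq> a" using a uvw by (auto simp: image_iff)
  then show ?thesis
    using bounds_argument_join(2)[of u v w g a] bounds_argument_piecewise_smooth[OF g, of u v a]
      bounds_argument_piecewise_smooth[OF g, of v w a] uvw by simp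
qed

lemma piecewise_smooth_imp_C1:
  assumes g: "piecewise_smooth g" and c: "continuous_on {0..1} g" 
  shows "g piecewise_C1_differentiable_on {0..1}"
proof -
  let ?D = "\<lambda>x. g differentiable at x \<and> isCont (\<lambda>x. vector_derivative g (at x)) x"
  have "\<exists>S. finite S \<and> (\<forall>x\<in>{0..1} - S. ?D x)"
  proof (rule piecewise_smooth_induct[OF g, of 0 1 "\<lambda>u v. \<exists>S. finite S \<and> (\<forall>x\<in>{u..v} - S. ?D x)"])
    fix u v :: real assume uv: "u < v" and sm: "smooth_arc_on u v g"
    then obtain d d2 where gd: "\<forall>t\<in>{u..v}. (g has_vector_derivative d t) (at t within {u..v})"
      "\<forall>t\<in>{u..v}. (d has_vector_derivative d2 t) (at t within {u..v})"
      unfolding smooth_arc_on_def by blast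
    have "?D x" if "x \<in> {u<..<v}" for x
      using smooth_arc_vector_derivatives(3,4)[OF uv gd that]
      by (metis differentiableI_vector has_vector_derivative_continuous)
    then have "\<forall>x\<in>{u..v} - {u, v}. ?D x" by auto
    then show "\<exists>S. finite S \<and> (\<forall>x\<in>{u..v} - S. ?D x)" by (metis finite.emptyI finite.insertI)
  next
    fix u v w :: real
    assume "u < v" "v < w" "\<exists>S. finite S \<and> (\<forall>x\<in>{u..v} - S. ?D x)" "\<exists>S. finite S \<and> (\<forall>x\<in>{v..w} - S. ?D x)"
    then obtain S T where ST: "finite S" "finite T" "\<forall>x\<in>{u..v} - S. ?D x" "\<forall>x\<in>{v..w} - T. ?D x" by blast
    have "?D x" if "x \<in> {u..w} - (S \<union> T)" for x
      using ST(3,4) that by (cases "x \<le> v") auto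
    then show "\<exists>S. finite S \<and> (\<forall>x\<in>{u..w} - S. ?D x)"
      using ST(1,2) by (intro exI[of _ "S \<union> T"]) blast
  qed auto
  then obtain S where S: "finite S" "\<forall>x\<in>{0..1} - S. ?D x" by blast
  then have "g C1_differentiable_on ({0..1} - S)"
    unfolding C1_differentiable_on_eq using continuous_at_imp_continuous_on by blast
  then show ?thesis unfolding piecewise_C1_differentiable_on_def using c S(1) by blast
qed

lemma piecewise_smooth_lipschitz:
  assumes g: "piecewise_smooth g"
  obtains C where "C \<ge> 0" "\<forall>x y. 0 \<le> x \<longrightarrow> x \<le> y \<longrightarrow> y \<le> 1 \<longrightarrow> dist (g x) (g y) \<le> C * (y - x)"
proof -
  let ?L = "\<lambda>u v. \<exists>C\<ge>0. \<forall>x y. u \<le> x \<longrightarrow> x \<le> y \<longrightarrow> y \<le> v \<longrightarrow> dist (g x) (g y) \<le> C * (y - x)"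
  have "?L 0 1"
  proof (rule piecewise_smooth_induct[OF g, of 0 1 ?L])
    fix u v :: real assume uv: "u < v" and sm: "smooth_arc_on u v g"
    then obtain d d2 where gd: "\<forall>t\<in>{u..v}. (g has_vector_derivative d t) (at t within {u..v})"
      "\<forall>t\<in>{u..v}. (d has_vector_derivative d2 t) (at t within {u..v})"
      unfolding smooth_arc_on_def by blast
    have "continuous_on {u..v} d"
      using gd(2) has_vector_derivative_continuous unfolding continuous_on_eq_continuous_within by blast
    then have "bounded (d ` {u..v})"
      using compact_continuous_image[OF _ compact_Icc] compact_imp_bounded by blast
    then obtain C where C: "C > 0" "\<forall>t\<in>{u..v}. cmod (d t) \<le> C" by (auto simp: bounded_pos)
    have "dist (g x) (g y) \<le> C * (y - x)" if xy: "u \<le> x" "x \<le> y" "y \<le> v" for x y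
    proof -
      have sub: "{x..y} \<subseteq> {u..v}" using xy by auto
      have "norm (g y - g x) \<le> C * norm (y - x)"
      proof (rule differentiable_bound[OF convex_real_interval(5)])
        fix s assume s: "s \<in> {x..y}"
        have "(g has_vector_derivative d s) (at s within {x..y})"
          using gd(1) s sub has_vector_derivative_within_subset by blast
        then show "(g has_derivative (\<lambda>h. h *\<^sub>R d s)) (at s within {x..y})"
          unfolding has_vector_derivative_def .
        show "onorm (\<lambda>h. h *\<^sub>R d s) \<le> C"
        proof (rule onorm_le)
          fix h :: real
          have "\<bar>h\<bar> * cmod (d s) \<le> \<bar>h\<bar> * C" using C(2) s sub by (intro mult_left_mono) auto
          then show "norm (h *\<^sub>R d s) \<le> C * norm h" by (simp add: mult.commute)
        qed
      qed (use xy in auto)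
      then show ?thesis using xy by (simp add: dist_norm norm_minus_commute)
    qed
    then show "?L u v" using C(1) by (intro exI[of _ C]) auto
  next
    fix u v w :: real assume uvw: "u < v" "v < w" and "?L u v" "?L v w"
    then obtain C1 C2 where C: "C1 \<ge> 0" "C2 \<ge> 0"
      and C1: "\<And>x y. \<lbrakk>u \<le> x; x \<le> y; y \<le> v\<rbrakk> \<Longrightarrow> dist (g x) (g y) \<le> C1 * (y - x)"
      and C2: "\<And>x y. \<lbrakk>v \<le> x; x \<le> y; y \<le> w\<rbrakk> \<Longrightarrow> dist (g x) (g y) \<le> C2 * (y - x)" by blast
    have m: "C1 * d \<le> (C1 + C2) * d" "C2 * d \<le> (C1 + C2) * d" if "d \<ge> 0" for d
      using C that by (auto intro!: mult_right_mono)
    have "dist (g x) (g y) \<le> (C1 + C2) * (y - x)" if xy: "u \<le> x" "x \<le> y" "y \<le> w" for x y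
    proof -
      consider "y \<le> v" | "v \<le> x" | "x < v" "v < y" by linarith
      then show ?thesis
      proof cases
        case 1 then show ?thesis using C1[of x y] m(1)[of "y - x"] xy by linarith
      next
        case 2 then show ?thesis using C2[of x y] m(2)[of "y - x"] xy by linarith
      next
        case 3
        have "dist (g x) (g y) \<le> C1 * (v - x) + C2 * (y - v)"
          using dist_triangle[of "g x" "g y" "g v"] C1[of x v] C2[of v y] 3 xy by linarith
        also have "\<dots> \<le> (C1 + C2) * (v - x) + (C1 + C2) * (y - v)"
          using m(1)[of "v - x"] m(2)[of "y - v"] 3 by linarith
        also have "\<dots> = (C1 + C2) * (y - x)" by (simp add: algebra_simps)
        finally show ?thesis .
      qed
    qed
    then show "?L u w" using C by (intro exI[of _ "C1 + C2"]) auto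
  qed auto
  then show ?thesis using that by blast
qed


section \<open>Total variation and subdivision of curves\<close>

text \<open>
  The variation over \<open>[0,T]\<close> as a real number. It is meaningful for functions of finite variation,
  where it increases by at least the length of every chord.
\<close>

definition variation_upto :: "(real \<Rightarrow> 'a::metric_space) \<Rightarrow> real \<Rightarrow> real" where
  "variation_upto g T = (SUP (n, t) \<in> {(n :: nat, t :: nat \<Rightarrow> real). mono t \<and> range t \<subseteq> {0..T}}.
     \<Sum>i<n. dist (g (t i)) (g (t (Suc i))))"

text \<open>
  The sums over \<open>H\<close> telescope. Upper bounds for variations are obtained from dominating functions
  \<open>H\<close> such as indefinite integrals, which can be added and pasted more easily than partitions.
\<close>

lemma partition_sum_le:
  fixes g :: "real \<Rightarrow> 'a::metric_space"
  assumes H: "\<And>x y. \<lbrakk>0 \<le> x; x \<le> y; y \<le> T\<rbrakk> \<Longrightarrow> dist (g x) (g y) \<le> H y - H x"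
    and t: "mono t" "range t \<subseteq> {0..T}"
  shows "(\<Sum>i<n. dist (g (t i)) (g (t (Suc i)))) \<le> H T - H 0"
proof -
  have t01: "0 \<le> t i" "t i \<le> T" for i using t(2) by (auto simp: image_subset_iff)
  have mono: "H x \<le> H y" if "0 \<le> x" "x \<le> y" "y \<le> T" for x y
    using H[OF that] zero_le_dist[of "g x" "g y"] by linarith
  have "(\<Sum>i<n. dist (g (t i)) (g (t (Suc i)))) \<le> (\<Sum>i<n. H (t (Suc i)) - H (t i))"
    using H t01 monoD[OF t(1)] by (intro sum_mono) auto
  also have "\<dots> = H (t n) - H (t 0)" by (rule sum_lessThan_telescope)
  also have "\<dots> \<le> H T - H 0"
    using mono[OF _ t01(1)[of 0] t01(2)[of 0]] mono[of "t n" T] t01[of n] by simp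
  finally show ?thesis .
qed

lemma total_variation_le:
  fixes g :: "real \<Rightarrow> 'a::metric_space"
  assumes "\<And>x y. \<lbrakk>0 \<le> x; x \<le> y; y \<le> 1\<rbrakk> \<Longrightarrow> dist (g x) (g y) \<le> H y - H x"
  shows "total_variation g \<le> ereal (H 1 - H 0)"
  unfolding total_variation_def
  by (rule SUP_least) (auto intro!: partition_sum_le[of 1 g H] assms)

lemma variation_upto_increment:
  fixes g :: "real \<Rightarrow> 'a::metric_space"
  assumes lip: "\<And>x y. \<lbrakk>0 \<le> x; x \<le> y; y \<le> 1\<rbrakk> \<Longrightarrow> dist (g x) (g y) \<le> C * (y - x)"
    and uv: "0 \<le> u" "u \<le> v" "v \<le> 1"
  shows "dist (g u) (g v) \<le> variation_upto g v - variation_upto g u"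
proof -
  let ?P = "\<lambda>T. {(n :: nat, t :: nat \<Rightarrow> real). mono t \<and> range t \<subseteq> {0..T}}"
  let ?s = "\<lambda>(n, t). \<Sum>i<n. dist (g (t i)) (g (t (Suc i)))"
  have bdd: "bdd_above (?s ` ?P v)"
  proof (rule bdd_aboveI2[of _ _ "C * v"], clarify)
    fix n :: nat and t :: "nat \<Rightarrow> real" assume t: "mono t" "range t \<subseteq> {0..v}"
    have "(\<Sum>i<n. dist (g (t i)) (g (t (Suc i)))) \<le> C * v - C * 0"
      by (rule partition_sum_le[of v g "\<lambda>x. C * x"])
        (use lip t uv in \<open>auto simp: right_diff_distrib[symmetric]\<close>)
    then show "(\<Sum>i<n. dist (g (t i)) (g (t (Suc i)))) \<le> C * v" by simp
  qed
  have "variation_upto g u \<le> variation_upto g v - dist (g u) (g v)"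
    unfolding variation_upto_def
  proof (rule cSUP_least)
    have "(0, \<lambda>_. 0) \<in> ?P u" using uv by (auto simp: mono_def)
    then show "?P u \<noteq> {}" by blast
    fix p assume "p \<in> ?P u"
    then obtain n t where p: "p = (n, t)" and t: "mono t" "range t \<subseteq> {0..u}" by blast
    have tb: "0 \<le> t i" "t i \<le> u" for i using t(2) by (auto simp: image_subset_iff)
    have tv: "t i \<le> v" for i using tb(2)[of i] uv(2) by linarith
    \<comment> \<open>continue the partition of \<open>[0,u]\<close> by \<open>u\<close> and \<open>v\<close>\<close>
    define t' where "t' = (\<lambda>i. if i \<le> n then t i else if i = Suc n then u else v)"
    have "mono t'"
      unfolding mono_def t'_def using monoD[OF t(1)] tb tv uv by auto
    moreover have "range t' \<subseteq> {0..v}"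
      unfolding t'_def using tb tv uv by auto
    ultimately have "?s (n + 2, t') \<le> Sup (?s ` ?P v)"
      by (intro cSUP_upper[OF _ bdd]) auto
    moreover have "?s (n + 2, t') = (\<Sum>i<n. dist (g (t i)) (g (t (Suc i)))) + dist (g (t n)) (g u) + dist (g u) (g v)"
      by (simp add: t'_def)
    moreover have "?s p = (\<Sum>i<n. dist (g (t i)) (g (t (Suc i))))" by (simp add: p)
    ultimately show "?s p \<le> Sup (?s ` ?P v) - dist (g u) (g v)"
      using zero_le_dist[of "g (t n)" "g u"] by linarith
  qed
  then show ?thesis by simp
qed

lemma variation_upto_0_nonneg: "0 \<le> variation_upto g 0"
proof -
  let ?P = "{(n :: nat, t :: nat \<Rightarrow> real). mono t \<and> range t \<subseteq> {0..0}}"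
  have "(\<Sum>i<n. dist (g (t i)) (g (t (Suc i)))) = 0" if "range t \<subseteq> {0..0::real}" for n and t :: "nat \<Rightarrow> real"
  proof -
    have "t i = 0" for i using that by (auto simp: image_subset_iff)
    then show ?thesis by simp
  qed
  then have "variation_upto g 0 = (SUP p\<in>?P. 0)"
    unfolding variation_upto_def by (intro SUP_cong) auto
  also have "\<dots> = 0"
  proof -
    have "(0, \<lambda>_. 0) \<in> ?P" by (auto simp: mono_def)
    then have "?P \<noteq> {}" by blast
    then show ?thesis by (rule cSUP_const)
  qed
  finally show ?thesis by simp
qed

lemma partition_sum_le_total_variation:
  assumes "mono t" "range t \<subseteq> {0..1}" 
  shows "ereal (\<Sum>i<n. dist (g (t i)) (g (t (Suc i)))) \<le> total_variation g"
  unfolding total_variation_def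
  by (rule SUP_upper2[of "(n, t)"]) (use assms in auto)

lemma variation_upto_1_le:
  assumes "total_variation g = ereal L" shows "variation_upto g 1 \<le> L"
  unfolding variation_upto_def
proof (rule cSUP_least)
  have "(0, \<lambda>_. 0) \<in> {(n :: nat, t :: nat \<Rightarrow> real). mono t \<and> range t \<subseteq> {0..1}}"
    by (auto simp: mono_def)
  then show "{(n :: nat, t :: nat \<Rightarrow> real). mono t \<and> range t \<subseteq> {0..1}} \<noteq> {}" by blast
  fix p :: "nat \<times> (nat \<Rightarrow> real)" assume "p \<in> {(n, t). mono t \<and> range t \<subseteq> {0..1}}"
  then obtain n t where "p = (n, t)" "mono t" "range t \<subseteq> {0..1}" by blast
  then show "(case p of (n, t) \<Rightarrow> \<Sum>i<n. dist (g (t i)) (g (t (Suc i)))) \<le> L"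
    using partition_sum_le_total_variation[where t = t and n = n and g = g] assms by simp
qed

text \<open>
  The exact distance makes the length bound the number \<open>k\<close> of complete arcs; the last arc is
  exempt, because the curve may end before it reaches distance \<open>s\<close>.
\<close>

definition subdivides :: "(real \<Rightarrow> 'a::metric_space) \<Rightarrow> real \<Rightarrow> real \<Rightarrow> nat \<Rightarrow> (nat \<Rightarrow> real) \<Rightarrow> bool" where
  "subdivides g s x k T \<longleftrightarrow> T 0 = x \<and> T (Suc k) = 1 \<and> (\<forall>i\<le>k. T i < T (Suc i)) \<and>
     (\<forall>i\<le>k. \<forall>y\<in>{T i..T (Suc i)}. dist (g (T i)) (g y) \<le> s) \<and>
     (\<forall>i<k. dist (g (T i)) (g (T (Suc i))) = s)"

text \<open>
  Leave the closed ball of radius \<open>s\<close> about the current point, and start again at the first point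
  at distance \<open>s\<close>. By uniform continuity each arc that ends in this way takes at least time \<open>\<delta>\<close>.
\<close>

lemma greedy_subdivision:
  fixes g :: "real \<Rightarrow> 'a::metric_space"
  assumes cont: "continuous_on {0..1} g" and s: "s > 0"
  obtains k T where "subdivides g s 0 k T"
proof -
  obtain \<delta> where \<delta>: "\<delta> > 0"
    "\<forall>x\<in>{0..1}. \<forall>y\<in>{0..1}. dist y x < \<delta> \<longrightarrow> dist (g y) (g x) < s"
    using compact_uniformly_continuous[OF cont compact_Icc] s unfolding uniformly_continuous_on_def by blast
  have ind: "\<exists>k T. subdivides g s x k T" if "0 \<le> x" "x < 1" "1 - x \<le> real m * \<delta>" for m x
    using that
  proof (induction m arbitrary: x)
    case (Suc m)
    have cd: "continuous_on {x..1} (\<lambda>y. dist (g x) (g y))"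
      using Suc.prems by (intro continuous_intros continuous_on_subset[OF cont]) auto
    show ?case
    proof (cases "\<forall>y\<in>{x..1}. dist (g x) (g y) \<le> s")
      case True
      then have "subdivides g s x 0 (\<lambda>i. if i = 0 then x else 1)"
        unfolding subdivides_def using Suc.prems by auto
      then show ?thesis by blast
    next
      case False
      define E where "E = {x..1} \<inter> (\<lambda>y. dist (g x) (g y)) -` {s..}"
      have "closed E" unfolding E_def by (rule continuous_closed_preimage[OF cd]) auto
      moreover have "bounded E" by (rule bounded_subset[OF bounded_closed_interval[of x 1]]) (auto simp: E_def)
      ultimately have "compact E" by (simp add: compact_eq_bounded_closed)
      moreover have "E \<noteq> {}" using False by (force simp: E_def)
      ultimately obtain z where z: "z \<in> E" "\<forall>y\<in>E. z \<le> y" using compact_attains_inf by blast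
      have zx: "x \<le> z" "z \<le> 1" "s \<le> dist (g x) (g z)" using z(1) by (auto simp: E_def)
      have below: "dist (g x) (g y) < s" if "x \<le> y" "y < z" for y
        using z(2) that zx unfolding E_def by force
      have eq: "dist (g x) (g z) = s"
      proof (rule ccontr)
        assume "dist (g x) (g z) \<noteq> s"
        then have gt: "s < dist (g x) (g z)" using zx by simp
        have "continuous_on {x..z} (\<lambda>y. dist (g x) (g y))"
          using zx by (intro continuous_on_subset[OF cd]) auto
        then obtain y where "x \<le> y" "y \<le> z" "dist (g x) (g y) = s"
          using IVT'[of "\<lambda>y. dist (g x) (g y)" x s z] s gt zx(1) by auto
        then show False using below[of y] gt by (cases "y = z") auto
      qed
      have "z < 1"
      proof (rule ccontr)
        assume "\<not> z < 1"
        then have "z = 1" using zx by simp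
        then have "dist (g x) (g y) \<le> s" if "y \<in> {x..1}" for y
          using that below[of y] eq by (cases "y = 1") auto
        then show False using False by blast
      qed
      have "\<not> dist z x < \<delta>" using \<delta>(2) Suc.prems zx by (force simp: dist_commute)
      then have "z - x \<ge> \<delta>" using zx by (simp add: dist_real_def)
      then have "1 - z \<le> real m * \<delta>" using Suc.prems(3) by (simp add: algebra_simps)
      then obtain k T where T: "subdivides g s z k T" using Suc.IH[of z] Suc.prems zx \<open>z < 1\<close> by auto
      have "z > x" using eq s zx(1) by (cases "z = x") auto
      have first: "dist (g x) (g y) \<le> s" if "y \<in> {x..z}" for y
        using that below[of y] eq by (cases "y = z") auto
      have "subdivides g s x (Suc k) (case_nat x T)"
        using T \<open>z > x\<close> eq first unfolding subdivides_def
        by (auto split: nat.split)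
      then show ?thesis by blast
    qed
  qed simp
  obtain m where "1 / \<delta> \<le> real m" using real_arch_simple by blast
  then have "1 - 0 \<le> real m * \<delta>" using \<delta>(1) by (simp add: divide_le_eq)
  then show ?thesis using ind[of 0 m] that by auto
qed

lemma subdivides_length:
  assumes T: "subdivides g s 0 k T"
  shows "ereal (real k * s) \<le> total_variation g"
proof -
  have T': "T 0 = 0" "T (Suc k) = 1" "\<And>i. i \<le> k \<Longrightarrow> T i < T (Suc i)"
    "\<And>i. i < k \<Longrightarrow> dist (g (T i)) (g (T (Suc i))) = s"
    using T by (auto simp: subdivides_def)
  have mono: "T i \<le> T j" if "i \<le> j" "j \<le> Suc k" for i j
    using that
  proof (induction j rule: dec_induct)
    case (step m)
    then show ?case using T'(3)[of m] by simp
  qed simp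
  define t where "t = (\<lambda>i. T (min i (Suc k)))"
  have "mono t" unfolding t_def mono_def by (auto intro!: mono simp: min_le_iff_disj)
  moreover have "range t \<subseteq> {0..1}"
    unfolding t_def using mono[of 0] mono[of _ "Suc k"] T'(1,2) by auto
  ultimately have "ereal (\<Sum>i<k. dist (g (t i)) (g (t (Suc i)))) \<le> total_variation g"
    by (rule partition_sum_le_total_variation)
  moreover have "(\<Sum>i<k. dist (g (t i)) (g (t (Suc i)))) = real k * s"
    using T'(4) by (simp add: t_def min_def)
  ultimately show ?thesis by simp
qed


section \<open>Variation of the argument along a plane curve\<close>

lemma is_Arg_times:
  assumes z: "is_Arg z r" and w: "is_Arg w s" shows "is_Arg (z * w) (r + s)"
proof -
  have "z * w = (of_real (norm z) * exp (\<i> * of_real r)) * (of_real (norm w) * exp (\<i> * of_real s))"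
    by (rule arg_cong2[of _ _ _ _ "(*)", OF z[unfolded is_Arg_def] w[unfolded is_Arg_def]])
  also have "\<dots> = of_real (norm (z * w)) * exp (\<i> * of_real (r + s))"
    by (simp add: norm_mult distrib_left exp_add mult_ac)
  finally show ?thesis by (simp only: is_Arg_def)
qed

text \<open>
  Two branches differ by multiples of \<open>2 * pi\<close>; if the difference were not constantly \<open>0\<close>, it
  would take a value of modulus in the open interval from \<open>0\<close> to \<open>2 * pi\<close>.
\<close>

lemma argument_branch_unique:
  fixes \<phi> \<theta> :: "real \<Rightarrow> real"
  assumes c: "continuous_on {u..v} \<phi>" "continuous_on {u..v} \<theta>"
    and arg: "\<And>x. x \<in> {u..v} \<Longrightarrow> is_Arg (y x) (\<phi> x)" "\<And>x. x \<in> {u..v} \<Longrightarrow> is_Arg (y x) (\<theta> x)"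
    and nz: "\<And>x. x \<in> {u..v} \<Longrightarrow> y x \<noteq> 0" and eq: "\<phi> u = \<theta> u" and x: "x \<in> {u..v}"
  shows "\<phi> x = \<theta> x"
proof (rule ccontr)
  assume ne: "\<phi> x \<noteq> \<theta> x"
  define D where "D = (\<lambda>t. \<bar>\<phi> t - \<theta> t\<bar>)"
  define m where "m = min (D x) pi"
  have "continuous_on {u..x} D" unfolding D_def
    using x by (intro continuous_intros continuous_on_subset[OF c(1)] continuous_on_subset[OF c(2)]) auto
  moreover have "D u \<le> m" "m \<le> D x" "u \<le> x" using x by (auto simp: D_def m_def eq)
  ultimately obtain t where t: "u \<le> t" "t \<le> x" "D t = m" using IVT'[of D u m x] by blast
  have "m > 0" using ne pi_gt_zero by (simp add: m_def D_def)
  have "m < 2 * pi" using pi_gt_zero by (simp add: m_def min_less_iff_disj)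
  have "t \<in> {u..v}" using t x by simp
  moreover have "\<bar>\<phi> t - \<theta> t\<bar> < 2 * pi" using t(3) \<open>m < 2 * pi\<close> by (simp add: D_def)
  ultimately have "\<phi> t = \<theta> t" using is_Arg_eqI[OF arg(1) arg(2) _ nz] by blast
  then show False using t(3) \<open>m > 0\<close> by (simp add: D_def)
qed

lemma curvature_between_nonneg: "0 \<le> curvature_between g u v"
proof -
  have "0 \<le> integral {u..v} (curvature_density g)"
  proof (cases "curvature_density g integrable_on {u..v}")
    case True
    then show ?thesis
      by (rule Henstock_Kurzweil_Integration.integral_nonneg) (simp add: curvature_density_def)
  qed (simp add: not_integrable_integral)
  then show ?thesis unfolding curvature_between_def by (simp add: sum_nonneg)
qed

lemma Im_integral_bound:
  fixes h :: "real \<Rightarrow> complex"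
  assumes "h integrable_on {x..y}" "(\<lambda>t. \<bar>Im (h t)\<bar>) integrable_on {x..y}"
  shows "\<bar>Im (integral {x..y} h)\<bar> \<le> integral {x..y} (\<lambda>t. \<bar>Im (h t)\<bar>)"
proof -
  have "Im (integral {x..y} h) = integral {x..y} (Im \<circ> h)"
    using integral_linear[OF assms(1) bounded_linear_Im] by simp
  moreover have "norm (integral {x..y} (Im \<circ> h)) \<le> integral {x..y} (\<lambda>t. \<bar>Im (h t)\<bar>)"
    by (rule integral_norm_bound_integral[OF integrable_linear[OF assms(1) bounded_linear_Im] assms(2)]) simp
  ultimately show ?thesis by simp
qed

text \<open>
  On the arc \<open>F = (\<Prod>i<n. z - a i) * exp L\<close>. The argument of each linear factor varies by at most
  the curvature plus \<open>pi\<close>, and there are at most \<open>3 * A\<close> factors; these variations are collected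
  in \<open>E\<close>. The argument of \<open>exp L\<close> is \<open>Im L\<close>, which is Lipschitz along chords, so the length of the
  arc enters only through chords.
\<close>

lemma arc_argument_bound:
  fixes F :: "complex \<Rightarrow> complex"
  assumes g: "piecewise_smooth g" "continuous_on {0..1} g" and uv: "0 \<le> u" "u < v" "v \<le> 1"
    and F: "open S" "cball (g u) r \<subseteq> S" "F holomorphic_on S" "r > 0"
    and M: "\<forall>z\<in>cball (g u) r. cmod (F z) < M"
    and q: "q \<in> cball (g u) (r/4)" "M * exp (- A) \<le> cmod (F q)"
    and near: "\<And>x. x \<in> {u..v} \<Longrightarrow> dist (g u) (g x) \<le> r/5"
    and nz: "\<And>x. x \<in> {u..v} \<Longrightarrow> F (g x) \<noteq> 0"
    and \<phi>: "continuous_on {u..v} \<phi>" "\<And>x. x \<in> {u..v} \<Longrightarrow> is_Arg (F (g x)) (\<phi> x)"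
  obtains E where "E v - E u \<le> 3 * A * (curvature_between g u v + pi)"
    "\<forall>x y. u \<le> x \<longrightarrow> x \<le> y \<longrightarrow> y \<le> v \<longrightarrow> \<bar>\<phi> y - \<phi> x\<bar> \<le> E y - E x + 49 * A / r * dist (g x) (g y)"
proof -
  obtain n a L where nA: "real n \<le> 3 * A" and L: "L holomorphic_on ball (g u) (r/2)"
    and fac: "\<forall>z\<in>ball (g u) (r/2). F z = (\<Prod>i<n. z - a i) * exp (L z)"
    and dL: "\<forall>z\<in>cball (g u) (r/5). cmod (deriv L z) \<le> 49 * A / r"
    by (rule disc_factorization[OF F M q])
  let ?V = "\<lambda>t. vector_derivative g (at t)"
  have sub: "{u..v} \<subseteq> {0..1}" using uv by auto
  have cg: "continuous_on {u..v} g" using g(2) sub by (rule continuous_on_subset)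
  have C1: "g piecewise_C1_differentiable_on {u..x}" if "x \<le> v" for x
    using piecewise_smooth_imp_C1[OF g] by (rule piecewise_C1_differentiable_on_subset) (use that uv in auto)
  have ball: "g x \<in> ball (g u) (r/2)" "g x \<in> cball (g u) (r/5)" if "x \<in> {u..v}" for x
    using near[OF that] F(4) by auto
  have facx: "F (g x) = (\<Prod>i<n. g x - a i) * exp (L (g x))" if "x \<in> {u..v}" for x
    using fac ball(1)[OF that] by blast
  have na: "a i \<notin> g ` {u..v}" if "i < n" for i
  proof
    assume "a i \<in> g ` {u..v}"
    then obtain x where x: "x \<in> {u..v}" "g x - a i = 0" by auto
    have "(\<Prod>i<n. g x - a i) = 0" using x(2) that by (intro prod_zero) auto
    then show False using facx[OF x(1)] nz[OF x(1)] by simp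
  qed
  define h where "h = (\<lambda>i t. ?V t / (g t - a i))"
  define J where "J = (\<lambda>i x. integral {u..x} (h i))"
  have h_int: "h i integrable_on {u..v}" if "i < n" for i
    unfolding h_def using winding_number_exp_integral(1)[OF C1[of v]] na[OF that] uv by simp
  have expJ: "g x - a i = (g u - a i) * exp (J i x)" if i: "i < n" and x: "x \<in> {u..v}" for i x
  proof -
    have "a i \<notin> g ` {u..x}" using na[OF i] x by auto
    then have "exp (- J i x) * (g x - a i) = g u - a i"
      unfolding J_def h_def using winding_number_exp_integral(2)[OF C1[of x], of "a i"] x by simp
    then have "exp (J i x) * (exp (- J i x) * (g x - a i)) = exp (J i x) * (g u - a i)" by simp
    then show ?thesis by (simp add: mult.assoc[symmetric] exp_minus_inverse mult.commute)
  qed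
  \<comment> \<open>the branch of the argument read off from the factorisation, normalised to agree with \<open>\<phi>\<close> at \<open>u\<close>\<close>
  define \<Theta> where "\<Theta> = (\<lambda>x. \<phi> u + (\<Sum>i<n. Im (J i x)) + (Im (L (g x)) - Im (L (g u))))"
  have \<Theta>_arg: "is_Arg (F (g x)) (\<Theta> x)" if x: "x \<in> {u..v}" for x
  proof -
    have u: "u \<in> {u..v}" using uv by simp
    define Q where "Q = (\<Sum>i<n. J i x) + (L (g x) - L (g u))"
    have "(\<Prod>i<n. g x - a i) = (\<Prod>i<n. (g u - a i) * exp (J i x))"
      using expJ[OF _ x] by (intro prod.cong) auto
    then have "F (g x) = F (g u) * exp Q"
      unfolding facx[OF x] facx[OF u] Q_def
      by (simp add: prod.distrib exp_add exp_sum exp_diff)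
    moreover have "is_Arg (F (g u) * exp Q) (\<phi> u + Im Q)"
      by (intro is_Arg_times \<phi>(2) u is_Arg_exp_Im)
    moreover have "\<phi> u + Im Q = \<Theta> x" by (simp add: Q_def \<Theta>_def)
    ultimately show ?thesis by simp
  qed
  have "continuous_on {u..v} (\<lambda>x. L (g x))"
    by (rule continuous_on_compose2[OF holomorphic_on_imp_continuous_on[OF L] cg]) (use ball(1) in auto)
  then have \<Theta>_cont: "continuous_on {u..v} \<Theta>"
    unfolding \<Theta>_def J_def by (intro continuous_intros indefinite_integral_continuous_1 h_int) auto
  have \<phi>\<Theta>: "\<phi> x = \<Theta> x" if "x \<in> {u..v}" for x
    by (rule argument_branch_unique[OF \<phi>(1) \<Theta>_cont \<phi>(2) \<Theta>_arg nz _ that])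
      (auto simp: \<Theta>_def J_def)
  define E where "E = (\<lambda>x. \<Sum>i<n. integral {u..x} (\<lambda>t. \<bar>Im (h i t)\<bar>))"
  have ba: "bounds_argument g (a i) u v" if "i < n" for i
    by (rule bounds_argument_piecewise_smooth[OF g(1) uv na[OF that]])
  have abs_int: "(\<lambda>t. \<bar>Im (h i t)\<bar>) integrable_on {u..v}" if "i < n" for i
    using ba[OF that] by (simp add: bounds_argument_def h_def)
  have "E v - E u = (\<Sum>i<n. integral {u..v} (\<lambda>t. \<bar>Im (h i t)\<bar>))" by (simp add: E_def)
  also have "\<dots> \<le> (\<Sum>i<n. curvature_between g u v + pi)"
  proof (rule sum_mono)
    fix i assume "i \<in> {..<n}"
    then have "bounds_argument g (a i) u v" using ba by simp
    then have "integral {u..v} (\<lambda>t. \<bar>Im (h i t)\<bar>)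
        \<le> curvature_between g u v + ray_angle (vector_derivative g (at_right u) / (g u - a i))
         - ray_angle (vector_derivative g (at_left v) / (g v - a i))"
      by (simp add: bounds_argument_def h_def)
    also have "\<dots> \<le> curvature_between g u v + pi" using ray_angle_bounds by (smt (verit))
    finally show "integral {u..v} (\<lambda>t. \<bar>Im (h i t)\<bar>) \<le> curvature_between g u v + pi" .
  qed
  also have "\<dots> = real n * (curvature_between g u v + pi)" by simp
  also have "\<dots> \<le> 3 * A * (curvature_between g u v + pi)"
    using nA curvature_between_nonneg[of g u v] pi_gt_zero by (intro mult_right_mono) auto
  finally have E1: "E v - E u \<le> 3 * A * (curvature_between g u v + pi)" .
  have E2: "\<bar>\<phi> y - \<phi> x\<bar> \<le> E y - E x + 49 * A / r * dist (g x) (g y)"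
    if xy: "u \<le> x" "x \<le> y" "y \<le> v" for x y
  proof -
    have mem: "x \<in> {u..v}" "y \<in> {u..v}" using xy by auto
    have ii: "(h i) integrable_on {u..y}" "(h i) integrable_on {x..y}"
      "(\<lambda>t. \<bar>Im (h i t)\<bar>) integrable_on {u..y}" "(\<lambda>t. \<bar>Im (h i t)\<bar>) integrable_on {x..y}" if "i < n" for i
      using xy by (auto intro: integrable_on_subinterval[OF h_int[OF that]]
        integrable_on_subinterval[OF abs_int[OF that]])
    note comb = Henstock_Kurzweil_Integration.integral_combine[OF xy(1,2)]
    have "\<bar>\<Sum>i<n. Im (J i y) - Im (J i x)\<bar> \<le> (\<Sum>i<n. \<bar>Im (J i y) - Im (J i x)\<bar>)"
      by (rule sum_abs)
    also have "\<dots> \<le> (\<Sum>i<n. integral {u..y} (\<lambda>t. \<bar>Im (h i t)\<bar>) - integral {u..x} (\<lambda>t. \<bar>Im (h i t)\<bar>))"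
    proof (rule sum_mono)
      fix i assume "i \<in> {..<n}"
      then have i: "i < n" by simp
      have "J i y - J i x = integral {x..y} (h i)" unfolding J_def using comb[OF ii(1)[OF i]] by (simp add: algebra_simps)
      then have "\<bar>Im (J i y) - Im (J i x)\<bar> = \<bar>Im (integral {x..y} (h i))\<bar>" by (metis minus_complex.sel(2))
      also have "\<dots> \<le> integral {x..y} (\<lambda>t. \<bar>Im (h i t)\<bar>)" by (rule Im_integral_bound[OF ii(2,4)[OF i]])
      also have "\<dots> = integral {u..y} (\<lambda>t. \<bar>Im (h i t)\<bar>) - integral {u..x} (\<lambda>t. \<bar>Im (h i t)\<bar>)"
        using comb[OF ii(3)[OF i]] by (simp add: algebra_simps)
      finally show "\<bar>Im (J i y) - Im (J i x)\<bar>
        \<le> integral {u..y} (\<lambda>t. \<bar>Im (h i t)\<bar>) - integral {u..x} (\<lambda>t. \<bar>Im (h i t)\<bar>)" .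
    qed
    also have "\<dots> = E y - E x" by (simp add: E_def sum_subtractf)
    finally have 1: "\<bar>\<Sum>i<n. Im (J i y) - Im (J i x)\<bar> \<le> E y - E x" .
    have "cmod (L (g y) - L (g x)) \<le> 49 * A / r * cmod (g y - g x)"
    proof (rule field_differentiable_bound[OF convex_cball])
      fix z assume z: "z \<in> cball (g u) (r/5)"
      then have "z \<in> ball (g u) (r/2)" using F(4) by auto
      then show "(L has_field_derivative deriv L z) (at z within cball (g u) (r/5))"
        using holomorphic_derivI[OF L open_ball] by blast
      show "cmod (deriv L z) \<le> 49 * A / r" using dL z by blast
    qed (use ball(2) mem in auto)
    then have 2: "\<bar>Im (L (g y)) - Im (L (g x))\<bar> \<le> 49 * A / r * dist (g x) (g y)"
      using abs_Im_le_cmod[of "L (g y) - L (g x)"] by (simp add: dist_norm norm_minus_commute)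
    have "\<phi> y - \<phi> x = (\<Sum>i<n. Im (J i y) - Im (J i x)) + (Im (L (g y)) - Im (L (g x)))"
      unfolding \<phi>\<Theta>[OF mem(1)] \<phi>\<Theta>[OF mem(2)] by (simp add: \<Theta>_def sum_subtractf)
    then show ?thesis using 1 2 by linarith
  qed
  show ?thesis by (rule that[of E]) (use E1 E2 in auto)
qed


text \<open>
  The dominating functions of consecutive arcs are shifted and pasted together. The function \<open>K\<close>
  stands for the curvature of an arc and \<open>p\<close> for the additional \<open>pi\<close> of each arc.
\<close>

lemma glue_arc_bounds:
  fixes \<phi> V :: "real \<Rightarrow> real"
  assumes T0: "T 0 = (0::real)" and inc: "\<And>i. i \<le> k \<Longrightarrow> T i < T (Suc i)" 
    and arc: "\<And>i. i \<le> k \<Longrightarrow> \<exists>E. E (T (Suc i)) - E (T i) \<le> c * (K (T i) (T (Suc i)) + p) \<and>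
      (\<forall>x y. T i \<le> x \<longrightarrow> x \<le> y \<longrightarrow> y \<le> T (Suc i) \<longrightarrow> \<bar>\<phi> y - \<phi> x\<bar> \<le> E y - E x + (V y - V x))"
    and K: "\<And>i. \<lbrakk>i < k\<rbrakk> \<Longrightarrow> K 0 (T (Suc i)) + K (T (Suc i)) (T (Suc (Suc i))) \<le> K 0 (T (Suc (Suc i)))"
    and c: "c \<ge> 0" and i: "i \<le> k"
  shows "\<exists>E. E (T (Suc i)) - E 0 \<le> c * (K 0 (T (Suc i)) + real (Suc i) * p) \<and>
      (\<forall>x y. 0 \<le> x \<longrightarrow> x \<le> y \<longrightarrow> y \<le> T (Suc i) \<longrightarrow> \<bar>\<phi> y - \<phi> x\<bar> \<le> E y - E x + (V y - V x))"
  using i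
proof (induction i)
  case 0
  show ?case using arc[of 0] T0 by simp
next
  case (Suc i)
  define m w where "m = T (Suc i)" and "w = T (Suc (Suc i))"
  have mw: "m < w" using inc[of "Suc i"] Suc.prems by (simp add: m_def w_def)
  have "i < k" using Suc.prems by simp
  obtain E where E: "E m - E 0 \<le> c * (K 0 m + real (Suc i) * p)"
      "\<And>x y. \<lbrakk>0 \<le> x; x \<le> y; y \<le> m\<rbrakk> \<Longrightarrow> \<bar>\<phi> y - \<phi> x\<bar> \<le> E y - E x + (V y - V x)"
    using Suc.IH Suc.prems unfolding m_def by auto
  obtain E' where E': "E' w - E' m \<le> c * (K m w + p)"
      "\<And>x y. \<lbrakk>m \<le> x; x \<le> y; y \<le> w\<rbrakk> \<Longrightarrow> \<bar>\<phi> y - \<phi> x\<bar> \<le> E' y - E' x + (V y - V x)"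
    using arc[OF Suc.prems] unfolding m_def w_def by auto
  have m0: "0 \<le> m"
  proof -
    have "0 \<le> T j" if "j \<le> Suc i" for j
      using that
    proof (induction j)
      case (Suc j)
      then show ?case using inc[of j] \<open>i < k\<close> by simp
    qed (simp add: T0)
    then show ?thesis by (simp add: m_def)
  qed
  define H where "H = (\<lambda>x. if x \<le> m then E x else E m + E' x - E' m)"
  have "H w - H 0 \<le> c * (K 0 m + real (Suc i) * p) + c * (K m w + p)"
    using E(1) E'(1) m0 mw by (simp add: H_def)
  also have "\<dots> = c * ((K 0 m + K m w) + real (Suc (Suc i)) * p)" by (simp add: algebra_simps)
  also have "\<dots> \<le> c * (K 0 w + real (Suc (Suc i)) * p)"
    using K[OF \<open>i < k\<close>] c unfolding m_def w_def by (intro mult_left_mono add_right_mono)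
  finally have 1: "H w - H 0 \<le> c * (K 0 w + real (Suc (Suc i)) * p)" .
  have 2: "\<bar>\<phi> y - \<phi> x\<bar> \<le> H y - H x + (V y - V x)" if xy: "0 \<le> x" "x \<le> y" "y \<le> w" for x y
  proof -
    consider "y \<le> m" | "m < x" | "x \<le> m" "m < y" by linarith
    then show ?thesis
    proof cases
      case 1 then show ?thesis using E(2)[of x y] xy by (simp add: H_def)
    next
      case 2 then show ?thesis using E'(2)[of x y] xy by (simp add: H_def)
    next
      case 3 then show ?thesis using E(2)[of x m] E'(2)[of m y] xy by (simp add: H_def)
    qed
  qed
  show ?case using 1 2 unfolding w_def[symmetric] by blast
qed

lemma piecewise_smooth_total_variation_finite:
  assumes "piecewise_smooth g"
  obtains L where "L \<ge> 0" "total_variation g = ereal L"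
proof -
  obtain C where C: "C \<ge> 0" "\<forall>x y. 0 \<le> x \<longrightarrow> x \<le> y \<longrightarrow> y \<le> 1 \<longrightarrow> dist (g x) (g y) \<le> C * (y - x)"
    by (rule piecewise_smooth_lipschitz[OF assms])
  have "total_variation g \<le> ereal (C * 1 - C * 0)"
    by (rule total_variation_le) (use C(2) in \<open>auto simp: right_diff_distrib\<close>)
  moreover have "0 \<le> total_variation g"
    using partition_sum_le_total_variation[where t = "\<lambda>_. 0" and n = 0 and g = g] by (simp add: mono_def zero_ereal_def)
  ultimately show ?thesis using that by (cases "total_variation g") auto
qed

lemma curvature_between_0_1: "curvature_between g 0 1 = plane_total_curvature g"
  by (simp add: curvature_between_def plane_total_curvature_def curvature_density_def[abs_def])

text \<open>
  A greedy subdivision at scale \<open>r/5\<close> has at most \<open>5 * L / r + 1\<close> arcs. With \<open>pi \<le> 16/5\<close> their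
  contributions add up to \<open>A\<close> times \<open>3 \<kappa> + (48 + 49) L / r + 48/5\<close>.
\<close>

lemma argument_variation_from_arcs:
  fixes g :: "real \<Rightarrow> complex" and \<phi> :: "real \<Rightarrow> real"
  assumes g: "piecewise_smooth g" "continuous_on {0..1} g" and r: "r > 0" and A: "A \<ge> 0"
    and len: "total_variation g = ereal L"
    and arc: "\<And>u v. \<lbrakk>0 \<le> u; u < v; v \<le> 1; \<forall>x\<in>{u..v}. dist (g u) (g x) \<le> r/5\<rbrakk> \<Longrightarrow>
       \<exists>E. E v - E u \<le> 3 * A * (curvature_between g u v + pi) \<and>
         (\<forall>x y. u \<le> x \<longrightarrow> x \<le> y \<longrightarrow> y \<le> v \<longrightarrow>
            \<bar>\<phi> y - \<phi> x\<bar> \<le> E y - E x + 49 * A / r * dist (g x) (g y))"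
  shows "total_variation \<phi> \<le> ereal (98 * A * (L / r + plane_total_curvature g + 1))"
proof -
  obtain C where C: "C \<ge> 0" "\<forall>x y. 0 \<le> x \<longrightarrow> x \<le> y \<longrightarrow> y \<le> 1 \<longrightarrow> dist (g x) (g y) \<le> C * (y - x)"
    by (rule piecewise_smooth_lipschitz[OF g(1)])
  define V where "V = (\<lambda>x. 49 * A / r * variation_upto g x)"
  have Ar: "49 * A / r \<ge> 0" using A r by simp
  have V: "49 * A / r * dist (g x) (g y) \<le> V y - V x" if "0 \<le> x" "x \<le> y" "y \<le> 1" for x y
    unfolding V_def right_diff_distrib[symmetric]
    using variation_upto_increment[of g C x y] C that Ar by (intro mult_left_mono) auto
  obtain k T where T: "subdivides g (r/5) 0 k T"
    using greedy_subdivision[OF g(2), of "r/5"] r by auto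
  have T0: "T 0 = 0" and T1: "T (Suc k) = 1" and inc: "\<And>i. i \<le> k \<Longrightarrow> T i < T (Suc i)"
    and near: "\<And>i. i \<le> k \<Longrightarrow> \<forall>y\<in>{T i..T (Suc i)}. dist (g (T i)) (g y) \<le> r/5"
    using T by (auto simp: subdivides_def)
  have mono: "T i \<le> T j" if "i \<le> j" "j \<le> Suc k" for i j
    using that
  proof (induction j rule: dec_induct)
    case (step m)
    then show ?case using inc[of m] by simp
  qed simp
  have T01: "0 \<le> T i" "T i \<le> 1" if "i \<le> Suc k" for i
    using mono[of 0 i] mono[of i "Suc k"] that T0 T1 by auto
  have arcs: "\<exists>E. E (T (Suc i)) - E (T i) \<le> 3 * A * (curvature_between g (T i) (T (Suc i)) + pi) \<and>
      (\<forall>x y. T i \<le> x \<longrightarrow> x \<le> y \<longrightarrow> y \<le> T (Suc i) \<longrightarrow> \<bar>\<phi> y - \<phi> x\<bar> \<le> E y - E x + (V y - V x))"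
    if i: "i \<le> k" for i
  proof -
    have b: "0 \<le> T i" "T (Suc i) \<le> 1" using T01 i by auto
    obtain E where E: "E (T (Suc i)) - E (T i) \<le> 3 * A * (curvature_between g (T i) (T (Suc i)) + pi)"
      "\<forall>x y. T i \<le> x \<longrightarrow> x \<le> y \<longrightarrow> y \<le> T (Suc i) \<longrightarrow>
            \<bar>\<phi> y - \<phi> x\<bar> \<le> E y - E x + 49 * A / r * dist (g x) (g y)"
      using arc[OF b(1) inc[OF i] b(2) near[OF i]] by blast
    have "\<bar>\<phi> y - \<phi> x\<bar> \<le> E y - E x + (V y - V x)" if "T i \<le> x" "x \<le> y" "y \<le> T (Suc i)" for x y
      using E(2)[rule_format, OF that] V[of x y] that b by linarith
    then show ?thesis using E(1) by blast
  qed
  have Ksup: "curvature_between g 0 (T (Suc i)) + curvature_between g (T (Suc i)) (T (Suc (Suc i)))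
      \<le> curvature_between g 0 (T (Suc (Suc i)))" if "i < k" for i
  proof (rule curvature_between_superadditive[OF g])
    show "0 < T (Suc i)" using T01(1)[of i] inc[of i] that by simp
    show "T (Suc i) < T (Suc (Suc i))" using inc[of "Suc i"] that by simp
    show "T (Suc (Suc i)) \<le> 1" using T01 that by simp
  qed simp
  have "\<exists>E. E (T (Suc k)) - E 0 \<le> 3 * A * (curvature_between g 0 (T (Suc k)) + real (Suc k) * pi) \<and>
      (\<forall>x y. 0 \<le> x \<longrightarrow> x \<le> y \<longrightarrow> y \<le> T (Suc k) \<longrightarrow> \<bar>\<phi> y - \<phi> x\<bar> \<le> E y - E x + (V y - V x))"
    by (rule glue_arc_bounds[where K = "curvature_between g", OF T0 inc arcs Ksup]) (use A in auto)
  then obtain E where E: "E 1 - E 0 \<le> 3 * A * (plane_total_curvature g + real (Suc k) * pi)"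
    "\<And>x y. \<lbrakk>0 \<le> x; x \<le> y; y \<le> 1\<rbrakk> \<Longrightarrow> \<bar>\<phi> y - \<phi> x\<bar> \<le> E y - E x + (V y - V x)"
    unfolding T1 curvature_between_0_1 by blast
  have "total_variation \<phi> \<le> ereal ((E 1 + V 1) - (E 0 + V 0))"
  proof (rule total_variation_le)
    fix x y :: real assume "0 \<le> x" "x \<le> y" "y \<le> 1"
    then show "dist (\<phi> x) (\<phi> y) \<le> (E y + V y) - (E x + V x)"
      using E(2)[of x y] by (simp add: dist_real_def abs_minus_commute)
  qed
  moreover have "(E 1 + V 1) - (E 0 + V 0) \<le> 98 * A * (L / r + plane_total_curvature g + 1)"
  proof -
    have V10: "V 1 - V 0 \<le> 49 * A / r * L"
    proof -
      have "V 1 \<le> 49 * A / r * L"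
        unfolding V_def using variation_upto_1_le[OF len] Ar by (rule mult_left_mono)
      moreover have "V 0 \<ge> 0" unfolding V_def by (rule mult_nonneg_nonneg[OF Ar variation_upto_0_nonneg])
      ultimately show ?thesis by simp
    qed
    have "real k * (r / 5) \<le> L" using subdivides_length[OF T] len by simp
    then have k: "real k \<le> 5 * (L / r)" using r by (simp add: field_simps)
    have "0 \<le> 5 * (L / r)" using k of_nat_0_le_iff[of k, where 'a = real] by (rule order_trans[rotated])
    then have Lr: "L / r \<ge> 0" by simp
    have "real (Suc k) * pi \<le> (5 * (L / r) + 1) * (16/5)"
      using k pi_less_4 pi_approx by (intro mult_mono) auto
    then have "3 * A * (plane_total_curvature g + real (Suc k) * pi)
        \<le> 3 * A * (plane_total_curvature g + (5 * (L / r) + 1) * (16/5))"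
      using A by (intro mult_left_mono add_left_mono) auto
    also have "\<dots> = A * (3 * plane_total_curvature g + 48 * (L / r) + 48/5)"
      by (simp add: algebra_simps)
    finally have "(E 1 + V 1) - (E 0 + V 0) \<le> A * (3 * plane_total_curvature g + 97 * (L / r) + 48/5)"
      using E(1) V10 by (simp add: algebra_simps)
    also have "\<dots> \<le> A * (98 * (L / r + plane_total_curvature g + 1))"
      using A Lr curvature_between_nonneg[of g 0 1] unfolding curvature_between_0_1
      by (intro mult_left_mono) auto
    finally show ?thesis by (simp add: mult_ac)
  qed
  ultimately show ?thesis using order_trans ereal_less_eq(3) by blast
qed


section \<open>Propagation of lower bounds on the surface\<close>

text \<open>
  A disc of radius larger than \<open>r\<close> about \<open>p\<close> in the surface, mapped bijectively to the plane. The
  strict inequality leaves room for the closed disc of radius \<open>r\<close>.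
\<close>

definition sheet :: "('w::topological_space \<Rightarrow> complex) \<Rightarrow> 'w set \<Rightarrow> 'w \<Rightarrow> real \<Rightarrow> 'w set \<Rightarrow> bool" where
  "sheet \<pi> U p r \<Delta> \<longleftrightarrow> open \<Delta> \<and> p \<in> \<Delta> \<and> \<Delta> \<subseteq> U \<and> inj_on \<pi> \<Delta> \<and> (\<exists>R>r. \<pi> ` \<Delta> = ball (\<pi> p) R)"

lemma pi_gap_imp_sheet:
  assumes "pi_gap \<pi> K U \<ge> ereal \<epsilon>" "r < \<epsilon>" "p \<in> K"
  obtains \<Delta> where "sheet \<pi> U p r \<Delta>"
proof -
  have "ereal \<epsilon> \<le> gap_at \<pi> p U"
    using assms(1,3) unfolding pi_gap_def by (meson INF_lower order_trans)
  then have "ereal r < gap_at \<pi> p U" using assms(2) by (metis ereal_less(2) less_le_trans less_ereal.simps(1))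
  then show ?thesis
    using that unfolding gap_at_def less_SUP_iff sheet_def bij_betw_def by auto
qed

lemma sheet_mono: "sheet \<pi> U p r \<Delta> \<Longrightarrow> U \<subseteq> U' \<Longrightarrow> sheet \<pi> U' p r \<Delta>"
  unfolding sheet_def by blast

lemma curve_in_sheet:
  fixes \<pi> :: "'w::t2_space \<Rightarrow> complex" and \<gamma> :: "real \<Rightarrow> 'w"
  assumes cont: "continuous_on UNIV \<pi>" and op: "\<And>X. open X \<Longrightarrow> open (\<pi> ` X)"
    and \<Delta>: "sheet \<pi> U (\<gamma> u) r \<Delta>" and \<gamma>: "continuous_on {u..v} \<gamma>" "u \<le> v"
    and near: "\<And>x. x \<in> {u..v} \<Longrightarrow> dist (\<pi> (\<gamma> u)) (\<pi> (\<gamma> x)) \<le> r"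
  shows "\<gamma> ` {u..v} \<subseteq> \<Delta>"
proof (rule connected_subset_sheet[OF cont op])
  show "open \<Delta>" "\<gamma> u \<in> \<Delta>" "inj_on \<pi> \<Delta>" using \<Delta> by (auto simp: sheet_def)
  show "connected (\<gamma> ` {u..v})" by (rule connected_continuous_image[OF \<gamma>(1) connected_Icc])
  show "\<gamma> u \<in> \<gamma> ` {u..v}" using \<gamma>(2) by auto
  obtain R where "R > r" "\<pi> ` \<Delta> = ball (\<pi> (\<gamma> u)) R" using \<Delta> by (auto simp: sheet_def)
  then show "\<pi> ` \<gamma> ` {u..v} \<subseteq> \<pi> ` \<Delta>" using near by force
qed

text \<open>
  The point \<open>x\<close> also lies in the disc about \<open>p\<close>, at distance at most \<open>r/2\<close>: the segment between
  the projections of \<open>p'\<close> and \<open>x\<close>, lifted to \<open>\<Delta>'\<close>, starts in \<open>\<Delta>\<close> and hence stays there. By the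
  three circles theorem the logarithm of \<open>M / max \<bar>f\<bar>\<close> at most doubles between the disc of radius
  \<open>r/2\<close> and that of radius \<open>r/4\<close>.
\<close>

lemma chain_step:
  fixes \<A> :: "('w::t2_space set \<times> ('w \<Rightarrow> complex)) set"
  assumes RS: "riemann_surface \<A>" and hol: "rs_holomorphic_on \<A> \<pi> UNIV"
    and LB: "locally_biholomorphic \<A> \<pi>"
    and f: "rs_holomorphic_on \<A> f U" and M: "\<And>x. x \<in> U \<Longrightarrow> cmod (f x) \<le> M" and M0: "M > 0" and r: "r > 0"
    and \<Delta>: "sheet \<pi> U p r \<Delta>" and \<Delta>': "sheet \<pi> U p' r \<Delta>'"
    and p': "p' \<in> \<Delta>" "dist (\<pi> p) (\<pi> p') \<le> r/4"
    and x: "x \<in> \<Delta>'" "dist (\<pi> p') (\<pi> x) \<le> r/4" "M * exp (- A) \<le> cmod (f x)"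
  shows "\<exists>y\<in>\<Delta>. dist (\<pi> p) (\<pi> y) \<le> r/4 \<and> M * exp (- (2 * A)) \<le> cmod (f y)"
proof -
  note cont = projection_continuous[OF RS hol LB] and op = projection_open_map[OF RS hol LB]
  obtain R where R: "R > r" "\<pi> ` \<Delta> = ball (\<pi> p) R" and D: "open \<Delta>" "inj_on \<pi> \<Delta>" "\<Delta> \<subseteq> U" "p \<in> \<Delta>"
    using \<Delta> by (auto simp: sheet_def)
  obtain R' where R': "R' > r" "\<pi> ` \<Delta>' = ball (\<pi> p') R'" and D': "open \<Delta>'" "inj_on \<pi> \<Delta>'" "p' \<in> \<Delta>'"
    using \<Delta>' by (auto simp: sheet_def)
  define \<sigma> where "\<sigma> = inv_into \<Delta>' \<pi>"
  define C where "C = closed_segment (\<pi> p') (\<pi> x)"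
  have C1: "C \<subseteq> cball (\<pi> p') (r/4)"
    unfolding C_def using x(2) r by (intro closed_segment_subset) auto
  then have C2: "C \<subseteq> \<pi> ` \<Delta>'" unfolding R' using R'(1) r by force
  have "dist (\<pi> p) z \<le> r/2" if "z \<in> C" for z
    using dist_triangle[of "\<pi> p" z "\<pi> p'"] p'(2) C1 that by force
  then have C3: "C \<subseteq> ball (\<pi> p) R" "dist (\<pi> p) (\<pi> x) \<le> r/2"
    using R(1) r by (fastforce, simp add: C_def)
  have \<sigma>: "\<pi> (\<sigma> z) = z" if "z \<in> C" for z
    using that C2 unfolding \<sigma>_def by (auto intro: f_inv_into_f)
  have "\<sigma> ` C \<subseteq> \<Delta>"
  proof (rule connected_subset_sheet[OF cont op D(1)])
    show "connected (\<sigma> ` C)"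
      unfolding \<sigma>_def C_def
      by (intro connected_continuous_image connected_segment
          continuous_on_subset[OF sheet_section_continuous[OF op D'(1,2)]]) (use C2 C_def in auto)
    show "\<pi> ` \<sigma> ` C \<subseteq> \<pi> ` \<Delta>" unfolding R(2) using C3(1) \<sigma> by auto
    show "p' \<in> \<sigma> ` C"
      using D'(2,3) unfolding \<sigma>_def C_def by (intro image_eqI[of _ _ "\<pi> p'"]) auto
  qed (use p' D in auto)
  moreover have "x \<in> \<sigma> ` C"
    using x(1) D'(2) unfolding \<sigma>_def C_def by (intro image_eqI[of _ _ "\<pi> x"]) auto
  ultimately have x\<Delta>: "x \<in> \<Delta>" by blast
  define F where "F = f \<circ> inv_into \<Delta> \<pi>"
  have holF: "F holomorphic_on ball (\<pi> p) R"
    using holomorphic_on_sheet[OF RS hol LB D(1-3) f] unfolding F_def R(2) .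
  have F: "F (\<pi> y) = f y" if "y \<in> \<Delta>" for y using that D(2) by (simp add: F_def)
  have sub: "cball (\<pi> p) r \<subseteq> ball (\<pi> p) R" using R(1) by auto
  have lift: "\<exists>y\<in>\<Delta>. \<pi> y = z" if "z \<in> cball (\<pi> p) r" for z
    using that sub R(2) by (metis image_iff subset_iff)
  have "continuous_on (cball (\<pi> p) (r/4)) (\<lambda>z. cmod (F z))"
    using holF R(1) r by (intro continuous_intros holomorphic_on_imp_continuous_on)
      (auto elim!: holomorphic_on_subset)
  then obtain w where w: "w \<in> cball (\<pi> p) (r/4)" "\<And>z. z \<in> cball (\<pi> p) (r/4) \<Longrightarrow> cmod (F z) \<le> cmod (F w)"
    using continuous_attains_sup[of "cball (\<pi> p) (r/4)" "\<lambda>z. cmod (F z)"] r by auto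
  have "(cmod (F (\<pi> x)))\<^sup>2 \<le> M * cmod (F w)"
  proof (rule three_circles[OF holF open_ball sub])
    fix z assume "z \<in> cball (\<pi> p) r"
    then show "cmod (F z) \<le> M" using lift F M D(3) by (metis subset_iff)
  qed (use w C3 r in auto)
  moreover have "(M * exp (- A))\<^sup>2 \<le> (cmod (f x))\<^sup>2"
    by (rule power_mono[OF x(3)]) (use M0 in simp)
  ultimately have "(M * exp (- A))\<^sup>2 \<le> M * cmod (F w)"
    unfolding F[OF x\<Delta>] by linarith
  moreover have "(M * exp (- A))\<^sup>2 = M * (M * exp (- (2 * A)))"
    by (simp add: power_mult_distrib power2_eq_square exp_add[symmetric])
  ultimately have "M * exp (- (2 * A)) \<le> cmod (F w)" using M0 by simp
  moreover obtain y where "y \<in> \<Delta>" "\<pi> y = w" using lift[of w] w(1) r by auto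
  ultimately show ?thesis using F w(1) by auto
qed

text \<open>
  The path is divided into steps of size \<open>r/4\<close>, of which at most \<open>4 * \<Lambda> / r\<close> are complete, and the
  estimate is carried backwards from its end, doubling at each complete step. The last, incomplete
  step costs nothing, because the end point itself lies in the quarter disc.
\<close>

lemma chain_along_path:
  fixes \<A> :: "('w::t2_space set \<times> ('w \<Rightarrow> complex)) set"
  assumes RS: "riemann_surface \<A>" and hol: "rs_holomorphic_on \<A> \<pi> UNIV"
    and LB: "locally_biholomorphic \<A> \<pi>"
    and f: "rs_holomorphic_on \<A> f U" and M: "\<And>x. x \<in> U \<Longrightarrow> cmod (f x) \<le> M" and M0: "M > 0" and r: "r > 0"
    and sheets: "\<And>p. p \<in> K \<Longrightarrow> \<exists>\<Delta>. sheet \<pi> U p r \<Delta>"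
    and \<gamma>: "path \<gamma>" "path_image \<gamma> \<subseteq> K" "M * exp (- A) \<le> cmod (f (pathfinish \<gamma>))"
    and len: "curve_length \<pi> \<gamma> < ereal \<Lambda>" and A: "A \<ge> 0"
    and \<Delta>: "sheet \<pi> U (pathstart \<gamma>) r \<Delta>"
  shows "\<exists>y\<in>\<Delta>. dist (\<pi> (pathstart \<gamma>)) (\<pi> y) \<le> r/4 \<and> M * exp (- (2 powr (4 * \<Lambda> / r) * A)) \<le> cmod (f y)"
proof -
  note cont = projection_continuous[OF RS hol LB] and op = projection_open_map[OF RS hol LB]
  define g where "g = \<pi> \<circ> \<gamma>"
  have c\<gamma>: "continuous_on {0..1} \<gamma>" using \<gamma>(1) by (simp add: path_def)
  have cg: "continuous_on {0..1} g" unfolding g_def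
    using c\<gamma> cont by (intro continuous_on_compose) (auto elim: continuous_on_subset)
  obtain k T where T: "subdivides g (r/4) 0 k T"
    using greedy_subdivision[OF cg, of "r/4"] r by auto
  have T0: "T 0 = 0" and T1: "T (Suc k) = 1" and inc: "\<And>i. i \<le> k \<Longrightarrow> T i < T (Suc i)"
    and near: "\<And>i x. i \<le> k \<Longrightarrow> x \<in> {T i..T (Suc i)} \<Longrightarrow> dist (\<pi> (\<gamma> (T i))) (\<pi> (\<gamma> x)) \<le> r/4"
    using T by (auto simp: subdivides_def g_def)
  have mono: "T i \<le> T j" if "i \<le> j" "j \<le> Suc k" for i j
    using that
  proof (induction j rule: dec_induct)
    case (step m)
    then show ?case using inc[of m] by simp
  qed simp
  have T01: "0 \<le> T i" "T i \<le> 1" if "i \<le> Suc k" for i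
    using mono[of 0 i] mono[of i "Suc k"] that T0 T1 by auto
  have next_in: "\<gamma> (T (Suc i)) \<in> \<Delta>" if i: "i \<le> k" and \<Delta>: "sheet \<pi> U (\<gamma> (T i)) r \<Delta>" for i \<Delta>
  proof -
    have "\<gamma> ` {T i..T (Suc i)} \<subseteq> \<Delta>"
    proof (rule curve_in_sheet[where \<gamma> = \<gamma> and u = "T i", OF cont op \<Delta>])
      show "continuous_on {T i..T (Suc i)} \<gamma>"
        using T01[of i] T01[of "Suc i"] i by (intro continuous_on_subset[OF c\<gamma>]) auto
      show "dist (\<pi> (\<gamma> (T i))) (\<pi> (\<gamma> x)) \<le> r" if "x \<in> {T i..T (Suc i)}" for x
        using near[OF i that] r by linarith
    qed (use inc[OF i] in auto)
    then show ?thesis using inc[OF i] by auto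
  qed
  have nxt: "dist (\<pi> (\<gamma> (T i))) (\<pi> (\<gamma> (T (Suc i)))) \<le> r/4" if "i \<le> k" for i
    using near[OF that, of "T (Suc i)"] inc[OF that] by simp
  have claim: "\<exists>y\<in>\<Delta>. dist (\<pi> (\<gamma> (T (k - j)))) (\<pi> y) \<le> r/4 \<and> M * exp (- (2 ^ j * A)) \<le> cmod (f y)"
    if "j \<le> k" "sheet \<pi> U (\<gamma> (T (k - j))) r \<Delta>" for j \<Delta>
    using that
  proof (induction j arbitrary: \<Delta>)
    case 0
    have "\<gamma> (T (Suc k)) \<in> \<Delta>" using next_in[of k] 0 by simp
    moreover have "M * exp (- A) \<le> cmod (f (\<gamma> (T (Suc k))))" using \<gamma>(3) T1 by (simp add: pathfinish_def)
    ultimately show ?case using nxt[of k] by (intro bexI[of _ "\<gamma> (T (Suc k))"]) auto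
  next
    case (Suc j)
    define i where "i = k - Suc j"
    have i: "i \<le> k" "k - j = Suc i" using Suc.prems(1) by (auto simp: i_def)
    have "\<gamma> (T (Suc i)) \<in> K" using \<gamma>(2) T01[of "Suc i"] i(1) by (auto simp: path_image_def)
    then obtain \<Delta>' where \<Delta>': "sheet \<pi> U (\<gamma> (T (Suc i))) r \<Delta>'" using sheets by blast
    then obtain x where x: "x \<in> \<Delta>'" "dist (\<pi> (\<gamma> (T (Suc i)))) (\<pi> x) \<le> r/4" "M * exp (- (2 ^ j * A)) \<le> cmod (f x)"
      using Suc.IH[of \<Delta>'] Suc.prems(1) unfolding i(2) by auto
    have \<Delta>: "sheet \<pi> U (\<gamma> (T i)) r \<Delta>" using Suc.prems(2) by (simp add: i_def)
    show ?case
      using chain_step[OF RS hol LB f M M0 r \<Delta> \<Delta>' next_in[OF i(1) \<Delta>] nxt[OF i(1)] x]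
      unfolding i_def by (simp add: mult.assoc)
  qed
  have "sheet \<pi> U (\<gamma> (T (k - k))) r \<Delta>" using \<Delta> T0 by (simp add: pathstart_def)
  from claim[OF order_refl this] obtain y where y: "y \<in> \<Delta>" "dist (\<pi> (pathstart \<gamma>)) (\<pi> y) \<le> r/4"
    "M * exp (- (2 ^ k * A)) \<le> cmod (f y)"
    using T0 by (auto simp: pathstart_def)
  have "ereal (real k * (r/4)) < ereal \<Lambda>"
    using subdivides_length[OF T] len unfolding curve_length_def g_def by (rule le_less_trans)
  then have "real k \<le> 4 * \<Lambda> / r" using r by (simp add: field_simps)
  then have "(2::real) ^ k \<le> 2 powr (4 * \<Lambda> / r)" by (simp add: powr_realpow[symmetric])
  then have "2 ^ k * A \<le> 2 powr (4 * \<Lambda> / r) * A" using A by (rule mult_right_mono)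
  then have "M * exp (- (2 powr (4 * \<Lambda> / r) * A)) \<le> M * exp (- (2 ^ k * A))" using M0 by simp
  then show ?thesis using y by force
qed

text \<open>
  Here \<open>x = D / \<epsilon>\<close> and the discs have radius \<open>19/20 * \<epsilon>\<close>. Since \<open>ln 2 * 80/19 \<le> 3\<close>, the chain
  costs at most \<open>2 * exp (3 * x)\<close>, and \<open>exp (2 * x) \<ge> exp 6\<close> absorbs the numerical constants.
\<close>

lemma doubling_constant:
  fixes x :: real
  assumes "x > 3" shows "2 powr (4 * x / (19/20) + 1) * (98 / (19/20)) \<le> exp (5 * x)"
proof -
  have "2 powr (4 * x / (19/20) + 1) = 2 * exp (ln 2 * (80 * x / 19))"
    unfolding powr_add by (simp add: powr_def mult_ac)
  also have "\<dots> \<le> 2 * exp (3 * x)"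
  proof -
    have "ln 2 * (80 * x / 19) \<le> 25/36 * (80 * x / 19)"
      using ln2_le_25_over_36 assms by (intro mult_right_mono) auto
    also have "\<dots> \<le> 3 * x" using assms by simp
    finally show ?thesis by simp
  qed
  finally have 1: "2 powr (4 * x / (19/20) + 1) * (98 / (19/20)) \<le> 2 * exp (3 * x) * (98 / (19/20))"
    by (rule mult_right_mono) simp
  have "(5/2::real) \<le> exp 1" using exp_lower_Taylor_quadratic[of "1::real"] by (simp add: power2_eq_square)
  have "2 * (98 / (19/20)) \<le> (5/2::real) ^ 6" by (simp add: power_divide)
  also have "\<dots> \<le> exp 1 ^ 6" using \<open>5/2 \<le> exp 1\<close> by (rule power_mono) simp
  also have "\<dots> = exp (6::real)" by (simp flip: exp_of_nat_mult)
  also have "\<dots> \<le> exp (2 * x)" using assms by simp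
  finally have "2 * (98 / (19/20)) \<le> exp (2 * x)" .
  then have "exp (3 * x) * (2 * (98 / (19/20))) \<le> exp (3 * x) * exp (2 * x)" by (intro mult_left_mono) auto
  also have "\<dots> = exp (5 * x)" by (simp add: exp_add[symmetric])
  finally show ?thesis using 1 by (simp add: mult_ac)
qed

lemma arg_branch_exists:
  assumes "continuous_on {0..1} (\<lambda>t. f (\<gamma> t))" "\<And>t. t \<in> {0..1} \<Longrightarrow> f (\<gamma> t) \<noteq> 0"
  shows "\<exists>\<phi>. arg_branch f \<gamma> \<phi>"
proof -
  obtain l where l: "continuous_on {0..1} l" "\<And>t. t \<in> {0..1} \<Longrightarrow> f (\<gamma> t) = exp (l t)"
    using continuous_logarithm_on_contractible[OF assms(1) convex_imp_contractible assms(2)] by auto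
  have "arg_branch f \<gamma> (\<lambda>t. Im (l t))"
    unfolding arg_branch_def using l(2) by (auto intro!: continuous_intros l(1) simp: is_Arg_exp_Im)
  then show ?thesis by blast
qed

text \<open>
  The two parts together: a point of \<open>K\<close> where \<open>\<bar>f\<bar>\<close> is large is joined to each point of the curve
  by a path in \<open>K\<close> of length less than \<open>\<Lambda>\<close>, and the resulting lower bound for \<open>\<bar>f\<bar>\<close> near the curve
  controls the argument. The strict bound \<open>M\<close> makes \<open>Re p\<close> positive in \<open>unit_disc_factorization\<close>.
\<close>

lemma arg_variation_bound_strict:
  fixes \<A> :: "('w::t2_space set \<times> ('w \<Rightarrow> complex)) set"
  assumes RS: "riemann_surface \<A>" and hol: "rs_holomorphic_on \<A> \<pi> UNIV"
    and LB: "locally_biholomorphic \<A> \<pi>"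
    and f: "rs_holomorphic_on \<A> f U" and M: "\<And>x. x \<in> U \<Longrightarrow> cmod (f x) < M" and r: "r > 0"
    and sheets: "\<And>p. p \<in> K \<Longrightarrow> \<exists>\<Delta>. sheet \<pi> U p r \<Delta>"
    and q: "q \<in> K" "M * exp (- A) \<le> cmod (f q)" and A: "A \<ge> 0"
    and diam: "intrinsic_diam \<pi> K < ereal \<Lambda>"
    and \<Gamma>: "path \<Gamma>" "path_image \<Gamma> \<subseteq> K" "piecewise_smooth (\<pi> \<circ> \<Gamma>)"
    and nz: "\<forall>z\<in>path_image \<Gamma>. f z \<noteq> 0"
    and \<phi>: "arg_branch f \<Gamma> \<phi>" and len: "curve_length \<pi> \<Gamma> = ereal L"
  shows "total_variation \<phi> \<le>
    ereal (98 * (2 powr (4 * \<Lambda> / r) * A) * (L / r + total_curvature \<pi> \<Gamma> + 1))"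
proof -
  note cont = projection_continuous[OF RS hol LB] and op = projection_open_map[OF RS hol LB]
  define g where "g = \<pi> \<circ> \<Gamma>"
  define A' where "A' = 2 powr (4 * \<Lambda> / r) * A"
  have c\<Gamma>: "continuous_on {0..1} \<Gamma>" using \<Gamma>(1) by (simp add: path_def)
  have cg: "continuous_on {0..1} g" unfolding g_def
    using c\<Gamma> cont by (intro continuous_on_compose) (auto elim: continuous_on_subset)
  have sg: "piecewise_smooth g" using \<Gamma>(3) by (simp add: g_def)
  have A': "A' \<ge> 0" using A by (simp add: A'_def)
  obtain \<Delta>q where "sheet \<pi> U q r \<Delta>q" using sheets[OF q(1)] by blast
  then have "q \<in> U" by (auto simp: sheet_def)
  then have M0: "M > 0" using M[of q] norm_ge_zero[of "f q"] by linarith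
  have Mle: "cmod (f x) \<le> M" if "x \<in> U" for x using M[OF that] by simp
  have arc: "\<exists>E. E v - E u \<le> 3 * A' * (curvature_between g u v + pi) \<and>
         (\<forall>x y. u \<le> x \<longrightarrow> x \<le> y \<longrightarrow> y \<le> v \<longrightarrow>
            \<bar>\<phi> y - \<phi> x\<bar> \<le> E y - E x + 49 * A' / r * dist (g x) (g y))"
    if uv: "0 \<le> u" "u < v" "v \<le> 1" and near: "\<forall>x\<in>{u..v}. dist (g u) (g x) \<le> r/5" for u v
  proof -
    have uK: "\<Gamma> u \<in> K" using \<Gamma>(2) uv by (auto simp: path_image_def)
    then obtain \<Delta> where \<Delta>: "sheet \<pi> U (\<Gamma> u) r \<Delta>" using sheets by blast
    obtain R where R: "R > r" "\<pi> ` \<Delta> = ball (\<pi> (\<Gamma> u)) R" and D: "open \<Delta>" "inj_on \<pi> \<Delta>" "\<Delta> \<subseteq> U"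
      using \<Delta> by (auto simp: sheet_def)
    have "intrinsic_dist \<pi> K (\<Gamma> u) q \<le> intrinsic_diam \<pi> K"
      unfolding intrinsic_diam_def using uK q(1) by (meson SUP_upper SUP_upper2 order_refl)
    then have "intrinsic_dist \<pi> K (\<Gamma> u) q < ereal \<Lambda>" using diam by (rule le_less_trans)
    then obtain \<gamma> where \<gamma>: "path \<gamma>" "path_image \<gamma> \<subseteq> K" "pathstart \<gamma> = \<Gamma> u" "pathfinish \<gamma> = q"
      "curve_length \<pi> \<gamma> < ereal \<Lambda>"
      unfolding intrinsic_dist_def INF_less_iff by blast
    have "\<exists>y\<in>\<Delta>. dist (\<pi> (pathstart \<gamma>)) (\<pi> y) \<le> r/4 \<and>
        M * exp (- (2 powr (4 * \<Lambda> / r) * A)) \<le> cmod (f y)"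
      by (rule chain_along_path[OF RS hol LB f Mle M0 r sheets \<gamma>(1,2) _ \<gamma>(5) A])
        (use q(2) \<gamma>(3,4) \<Delta> in auto)
    then obtain y where y: "y \<in> \<Delta>" "dist (\<pi> (\<Gamma> u)) (\<pi> y) \<le> r/4" "M * exp (- A') \<le> cmod (f y)"
      unfolding \<gamma>(3) A'_def by blast
    define F where "F = f \<circ> inv_into \<Delta> \<pi>"
    have holF: "F holomorphic_on ball (g u) R"
      using holomorphic_on_sheet[OF RS hol LB D f] unfolding F_def R(2) g_def by simp
    have F: "F (\<pi> y) = f y" if "y \<in> \<Delta>" for y using that D(2) by (simp add: F_def)
    have sub: "cball (g u) r \<subseteq> ball (g u) R" using R(1) by auto
    have FM: "\<forall>z\<in>cball (g u) r. cmod (F z) < M"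
    proof
      fix z assume "z \<in> cball (g u) r"
      then have "z \<in> \<pi> ` \<Delta>" using sub R(2) by (auto simp: g_def)
      then show "cmod (F z) < M" using F M D(3) by auto
    qed
    have in\<Delta>: "\<Gamma> ` {u..v} \<subseteq> \<Delta>"
    proof (rule curve_in_sheet[where \<gamma> = \<Gamma> and u = u, OF cont op \<Delta>])
      show "continuous_on {u..v} \<Gamma>" using uv by (intro continuous_on_subset[OF c\<Gamma>]) auto
      show "dist (\<pi> (\<Gamma> u)) (\<pi> (\<Gamma> x)) \<le> r" if "x \<in> {u..v}" for x
        using near[rule_format, OF that] r by (simp add: g_def)
    qed (use uv in auto)
    have Fg: "F (g x) = f (\<Gamma> x)" if "x \<in> {u..v}" for x
      using F[OF subsetD[OF in\<Delta> imageI[OF that]]] by (simp add: g_def)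
    obtain E where "E v - E u \<le> 3 * A' * (curvature_between g u v + pi)"
      "\<forall>x y. u \<le> x \<longrightarrow> x \<le> y \<longrightarrow> y \<le> v \<longrightarrow> \<bar>\<phi> y - \<phi> x\<bar> \<le> E y - E x + 49 * A' / r * dist (g x) (g y)"
    proof (rule arc_argument_bound[OF sg cg uv open_ball sub holF r FM])
      show "\<pi> y \<in> cball (g u) (r/4)" using y(2) by (simp add: g_def)
      show "M * exp (- A') \<le> cmod (F (\<pi> y))" using y F by simp
      show "dist (g u) (g x) \<le> r/5" if "x \<in> {u..v}" for x using near that by blast
      show "F (g x) \<noteq> 0" if "x \<in> {u..v}" for x
        using nz uv that by (auto simp: Fg path_image_def)
      show "continuous_on {u..v} \<phi>" 
        using \<phi> uv unfolding arg_branch_def by (auto elim: continuous_on_subset)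
      show "is_Arg (F (g x)) (\<phi> x)" if "x \<in> {u..v}" for x
        using \<phi> uv that unfolding arg_branch_def by (simp add: Fg)
    qed
    then show ?thesis by blast
  qed
  have "total_variation \<phi> \<le> ereal (98 * A' * (L / r + plane_total_curvature g + 1))"
    by (rule argument_variation_from_arcs[OF sg cg r A' _ arc])
      (use len in \<open>auto simp: curve_length_def g_def\<close>)
  then show ?thesis by (simp add: A'_def total_curvature_def g_def)
qed

theorem theorem2:
  fixes \<A> :: "('w::t2_space set \<times> ('w \<Rightarrow> complex)) set"
    and \<pi> :: "'w \<Rightarrow> complex"
    and U U' U'' :: "'w set"
    and \<Gamma> :: "real \<Rightarrow> 'w"
    and f :: "'w \<Rightarrow> complex"
    and D \<epsilon> :: real
  assumes "riemann_surface \<A>"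
    and "rs_holomorphic_on \<A> \<pi> UNIV"
    and "locally_biholomorphic \<A> \<pi>"
    and "open U" "path_connected U"
    and "open U'" "path_connected U'"
    and "open U''" "path_connected U''"
    and "U'' \<subseteq> U'" "U' \<subseteq> U"
    and "compact (closure U)" "simply_connected (closure U)"
    and "piecewise_smooth_curve \<pi> \<Gamma>" "path_image \<Gamma> \<subseteq> U''"
    and "rs_holomorphic_on \<A> f U" "continuous_on (closure U) f"
    and "\<forall>z\<in>path_image \<Gamma>. f z \<noteq> 0"
    and "D > 0" "\<epsilon> > 0" "D / \<epsilon> > 3"
    and "pi_gap \<pi> (path_image \<Gamma>) U'' \<ge> ereal \<epsilon>"
    and "pi_gap \<pi> U'' U' \<ge> ereal \<epsilon>"
    and "pi_gap \<pi> U' U \<ge> ereal \<epsilon>"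
    and "intrinsic_diam \<pi> U'' \<le> ereal D"
    and "intrinsic_diam \<pi> U' \<le> ereal D"
  shows "arg_variation f \<Gamma> \<le>
           ereal (bernstein_index f U'' U) *
           (curve_length \<pi> \<Gamma> / ereal \<epsilon> + ereal (total_curvature \<pi> \<Gamma>) + 1) *
           ereal (exp (5 * D / \<epsilon>))"
proof -
  define r where "r = 19/20 * \<epsilon>"
  have r: "r > 0" "r < \<epsilon>" using \<open>\<epsilon> > 0\<close> by (auto simp: r_def)
  have \<Gamma>: "path \<Gamma>" "piecewise_smooth (\<pi> \<circ> \<Gamma>)"
    using \<open>piecewise_smooth_curve \<pi> \<Gamma>\<close> by (auto simp: piecewise_smooth_curve_def)
  have sheets: "\<exists>\<Delta>. sheet \<pi> U p r \<Delta>" if "p \<in> U''" for p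
    using pi_gap_imp_sheet[OF \<open>pi_gap \<pi> U'' U' \<ge> ereal \<epsilon>\<close> r(2) that] sheet_mono \<open>U' \<subseteq> U\<close> by metis
  obtain L where L: "L \<ge> 0" "curve_length \<pi> \<Gamma> = ereal L"
    unfolding curve_length_def by (rule piecewise_smooth_total_variation_finite[OF \<Gamma>(2)])
  have \<kappa>: "total_curvature \<pi> \<Gamma> \<ge> 0"
    unfolding total_curvature_def curvature_between_0_1[symmetric] by (rule curvature_between_nonneg)
  define M0 m where "M0 = (SUP z\<in>U. cmod (f z))" and "m = (SUP z\<in>U''. cmod (f z))"
  define B where "B = bernstein_index f U'' U"
  have "bounded (f ` closure U)"
    using compact_continuous_image \<open>continuous_on (closure U) f\<close> \<open>compact (closure U)\<close> compact_imp_bounded by blast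
  then obtain b where "\<And>x. x \<in> closure U \<Longrightarrow> cmod (f x) \<le> b" by (auto simp: bounded_iff)
  then have bdd: "bdd_above ((\<lambda>z. cmod (f z)) ` U)"
    using closure_subset by (intro bdd_aboveI2[of _ _ b]) blast
  have UU: "U'' \<subseteq> U" using \<open>U'' \<subseteq> U'\<close> \<open>U' \<subseteq> U\<close> by blast
  have bdd'': "bdd_above ((\<lambda>z. cmod (f z)) ` U'')" using bdd UU by (meson bdd_above_mono image_mono)
  have start: "\<Gamma> 0 \<in> path_image \<Gamma>" by (simp add: path_image_def)
  then have start'': "\<Gamma> 0 \<in> U''" using \<open>path_image \<Gamma> \<subseteq> U''\<close> by blast
  have "0 < cmod (f (\<Gamma> 0))" using \<open>\<forall>z\<in>path_image \<Gamma>. f z \<noteq> 0\<close> start by simp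
  also have "\<dots> \<le> m" unfolding m_def by (rule cSUP_upper[OF start'' bdd''])
  finally have m: "m > 0" .
  have mM: "m \<le> M0" unfolding m_def M0_def
    by (rule cSUP_subset_mono[OF _ bdd UU]) (use start'' in auto)
  have B: "B = ln (M0 / m)" by (simp add: B_def bernstein_index_def M0_def m_def)
  have B0: "B \<ge> 0" unfolding B using m mM by (intro ln_ge_zero) (simp add: le_divide_eq)
  have expB: "exp (- B) = m / M0" unfolding B using m mM by (simp add: exp_minus)
  have cU: "continuous_on U f" using \<open>continuous_on (closure U) f\<close> closure_subset by (rule continuous_on_subset)
  have c\<Gamma>: "continuous_on {0..1} \<Gamma>" using \<Gamma>(1) by (simp add: path_def)
  have imU: "\<Gamma> ` {0..1} \<subseteq> U" using \<open>path_image \<Gamma> \<subseteq> U''\<close> UU by (auto simp: path_image_def)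
  have "\<exists>\<phi>. arg_branch f \<Gamma> \<phi>"
  proof (rule arg_branch_exists)
    show "continuous_on {0..1} (\<lambda>t. f (\<Gamma> t))" by (rule continuous_on_compose2[OF cU c\<Gamma> imU])
    show "f (\<Gamma> t) \<noteq> 0" if "t \<in> {0..1}" for t
      using that \<open>\<forall>z\<in>path_image \<Gamma>. f z \<noteq> 0\<close> by (simp add: path_image_def)
  qed
  then have branch: "arg_branch f \<Gamma> (SOME \<phi>. arg_branch f \<Gamma> \<phi>)" by (rule someI_ex)
  \<comment> \<open>the excess over \<open>D\<close> makes the bound for path lengths strict and costs one more factor \<open>2\<close>\<close>
  define \<Lambda> where "\<Lambda> = D + r/4"
  define X where "X = 98 * 2 powr (4 * \<Lambda> / r) * (L / r + total_curvature \<pi> \<Gamma> + 1)"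
  have X0: "X \<ge> 0" unfolding X_def using L \<kappa> r by simp
  \<comment> \<open>one \<open>\<delta>\<close> makes the upper bound for \<open>\<bar>f\<bar>\<close> strict, the other pays for a supremum that need not be attained\<close>
  have bound: "arg_variation f \<Gamma> \<le> ereal (X * (B + 2 * \<delta>))" if \<delta>: "\<delta> > 0" for \<delta>
  proof -
    have "m * exp (- \<delta>) < m" using m \<delta> by simp
    then obtain q where q: "q \<in> U''" "m * exp (- \<delta>) < cmod (f q)"
      unfolding m_def using less_cSUP_iff[OF _ bdd''] start'' by blast
    have "arg_variation f \<Gamma> \<le> ereal (98 * (2 powr (4 * \<Lambda> / r) * (B + 2 * \<delta>)) * (L / r + total_curvature \<pi> \<Gamma> + 1))"
      unfolding arg_variation_def
    proof (rule arg_variation_bound_strict[of \<A> \<pi> f U "M0 * exp \<delta>" r U'' q])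
      fix x assume "x \<in> U"
      then have "cmod (f x) \<le> M0" unfolding M0_def by (rule cSUP_upper[OF _ bdd])
      also have "M0 < M0 * exp \<delta>" using m mM \<delta> by simp
      finally show "cmod (f x) < M0 * exp \<delta>" .
    next
      have "M0 * exp \<delta> * exp (- (B + 2 * \<delta>)) = M0 * exp (- B) * (exp \<delta> * exp (- (2 * \<delta>)))"
        by (simp add: exp_add[symmetric] mult.assoc) 
      also have "exp \<delta> * exp (- (2 * \<delta>)) = exp (- \<delta>)" by (simp add: exp_add[symmetric])
      finally show "M0 * exp \<delta> * exp (- (B + 2 * \<delta>)) \<le> cmod (f q)"
        using q(2) m mM unfolding expB by simp
      show "intrinsic_diam \<pi> U'' < ereal \<Lambda>"
        using \<open>intrinsic_diam \<pi> U'' \<le> ereal D\<close> by (rule le_less_trans) (use r in \<open>simp add: \<Lambda>_def\<close>)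
    qed (use assms r sheets q B0 \<delta> \<Gamma> branch L in auto)
    then show ?thesis by (simp add: X_def mult_ac)
  qed
  have "arg_variation f \<Gamma> \<le> ereal (X * B)"
  proof (rule ereal_le_epsilon2)
    fix e :: real assume e: "0 < e"
    define \<delta> where "\<delta> = e / (2 * (X + 1))"
    have "\<delta> > 0" using e X0 by (simp add: \<delta>_def)
    then have "arg_variation f \<Gamma> \<le> ereal (X * (B + 2 * \<delta>))" by (rule bound)
    also have "\<dots> \<le> ereal (X * B + e)"
    proof -
      have "2 * \<delta> * (X + 1) = e" using X0 by (simp add: \<delta>_def field_simps)
      moreover have "2 * \<delta> * X \<le> 2 * \<delta> * (X + 1)" using \<open>\<delta> > 0\<close> by (intro mult_left_mono) auto
      ultimately show ?thesis by (simp add: algebra_simps)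
    qed
    finally show "arg_variation f \<Gamma> \<le> ereal (X * B) + ereal e" by simp
  qed
  also have "\<dots> \<le> ereal (B * (L / \<epsilon> + total_curvature \<pi> \<Gamma> + 1) * exp (5 * D / \<epsilon>))"
  proof -
    define x where "x = D / \<epsilon>"
    have expo: "4 * \<Lambda> / r = 4 * x / (19/20) + 1"
      using \<open>\<epsilon> > 0\<close> by (simp add: \<Lambda>_def r_def x_def field_simps)
    have Lr: "L / r = (L / \<epsilon>) / (19/20)" by (simp add: r_def)
    have "X \<le> 2 powr (4 * \<Lambda> / r) * (98 / (19/20)) * (L / \<epsilon> + total_curvature \<pi> \<Gamma> + 1)"
    proof -
      have "L / r + total_curvature \<pi> \<Gamma> + 1 \<le> 1 / (19/20) * (L / \<epsilon> + total_curvature \<pi> \<Gamma> + 1)"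
        unfolding Lr using \<kappa> by (simp add: algebra_simps)
      then have "98 * 2 powr (4 * \<Lambda> / r) * (L / r + total_curvature \<pi> \<Gamma> + 1)
          \<le> 98 * 2 powr (4 * \<Lambda> / r) * (1 / (19/20) * (L / \<epsilon> + total_curvature \<pi> \<Gamma> + 1))"
        by (intro mult_left_mono) auto
      then show ?thesis unfolding X_def by (simp add: mult_ac)
    qed
    also have "\<dots> \<le> exp (5 * x) * (L / \<epsilon> + total_curvature \<pi> \<Gamma> + 1)"
      unfolding expo using doubling_constant[of x] \<open>D / \<epsilon> > 3\<close> L \<kappa> \<open>\<epsilon> > 0\<close>
      by (intro mult_right_mono) (auto simp: x_def)
    finally have "B * X \<le> B * (exp (5 * x) * (L / \<epsilon> + total_curvature \<pi> \<Gamma> + 1))"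
      using B0 by (rule mult_left_mono)
    then show ?thesis by (simp add: x_def mult_ac)
  qed
  finally show ?thesis
    using \<open>\<epsilon> > 0\<close> by (simp add: L(2) B_def one_ereal_def)
qed

end
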